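(* Let $k\ge 2$, $3\le r\le 2k$ and $n\ge 712k$ be integers. Suppose that $G$ is an $n$-vertex graph containing no cycle $C_{2k+1}$ with $\lambda(G)\ge \lambda(T_{n-r+1,2}\circ K_r)$. Then $G\in\mathcal{G}_{n,r}$, unless $G= T_{n-r+1,2}\circ K_r$ (up to isomorphism).
   Context: $\lambda(G)$ denotes the spectral radius (largest eigenvalue) of the adjacency matrix of $G$. $T_{m,2}$ denotes the complete bipartite graph on $m$ vertices with parts of sizes $\lfloor m/2\rfloor$ and $\lceil m/2\rceil$. $T_{n-r+1,2}\circ K_r$ is the $n$-vertex graph obtained by identifying a vertex of the complete graph $K_r$ with a vertex of the smaller part (of size $\lfloor (n-r+1)/2\rfloor$) of $T_{n-r+1,2}$. A graph $H$ is said to be suspended on a graph $B$ if $H$ intersects $B$ in exactly one vertex. $\mathcal{G}_{n,r}$ is the family of $n$-vertex graphs obtained from a bipartite graph $B$ by suspending graphs $G_1,\dots,G_s$ on $B$ (for some $s\in\mathbb{N}$), i.e. the graph is $B\cup G_1\cup\dots\cup G_s$ with each $G_i$ meeting $B$ in exactly one vertex, where $\sum_{i=1}^s|V(G_i)\setminus V(B)|\le r-2$. *)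

theory Defs
  imports Complex_Main
begin

definition simple_graph :: "'a set \<Rightarrow> 'a set set \<Rightarrow> bool" where
  "simple_graph V E \<longleftrightarrow> finite V \<and> E \<subseteq> {e. e \<subseteq> V \<and> card e = 2}"

definition adj_eigenvalue :: "'a set \<Rightarrow> 'a set set \<Rightarrow> real \<Rightarrow> bool" where
  "adj_eigenvalue V E \<mu> \<longleftrightarrow>
     (\<exists>x::'a \<Rightarrow> real. (\<exists>v\<in>V. x v \<noteq> 0) \<and>
        (\<forall>v\<in>V. (\<Sum>u\<in>V. (if {v, u} \<in> E then 1 else 0) * x u) = \<mu> * x v))"

definition graph_lambda :: "'a set \<Rightarrow> 'a set set \<Rightarrow> real" where
  "graph_lambda V E = Max {\<mu>. adj_eigenvalue V E \<mu>}"

definition contains_cycle :: "'a set \<Rightarrow> 'a set set \<Rightarrow> nat \<Rightarrow> bool" where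
  "contains_cycle V E l \<longleftrightarrow>
     (\<exists>f :: nat \<Rightarrow> 'a. inj_on f {0..<l} \<and> f ` {0..<l} \<subseteq> V \<and>
        (\<forall>i<l. {f i, f ((i + 1) mod l)} \<in> E))"

text \<open>The graph T_{n-r+1,2} o K_r on vertex set {0..<n}: with m = n-r+1, the
  parts of T_{m,2} are {0..<m div 2} (smaller) and {m div 2..<m}; the clique K_r is on
  {0} \<union> {m..<n}, sharing vertex 0 (in the smaller part).\<close>
definition TK_edges :: "nat \<Rightarrow> nat \<Rightarrow> nat set set" where
  "TK_edges n r =
     (let m = n - r + 1 in
       {{a, b} | a b. a < m div 2 \<and> m div 2 \<le> b \<and> b < m} \<union>
       {{a, b} | a b. a \<in> insert 0 {m..<n} \<and> b \<in> insert 0 {m..<n} \<and> a \<noteq> b})"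

definition graph_iso :: "'a set \<Rightarrow> 'a set set \<Rightarrow> 'b set \<Rightarrow> 'b set set \<Rightarrow> bool" where
  "graph_iso V E V' E' \<longleftrightarrow>
     (\<exists>f. bij_betw f V V' \<and> (\<forall>u\<in>V. \<forall>v\<in>V. {u, v} \<in> E \<longleftrightarrow> {f u, f v} \<in> E'))"

definition bipartite :: "'a set \<Rightarrow> 'a set set \<Rightarrow> bool" where
  "bipartite V E \<longleftrightarrow> (\<exists>X \<subseteq> V. \<forall>e\<in>E. card (e \<inter> X) = 1)"

definition in_family_G :: "nat \<Rightarrow> nat \<Rightarrow> 'a set \<Rightarrow> 'a set set \<Rightarrow> bool" where
  "in_family_G n r V E \<longleftrightarrow> card V = n \<and>
     (\<exists>VB EB (s::nat) (Vs :: nat \<Rightarrow> 'a set) (Es :: nat \<Rightarrow> 'a set set).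
        simple_graph VB EB \<and> bipartite VB EB \<and>
        (\<forall>i<s. simple_graph (Vs i) (Es i) \<and> (\<exists>w. Vs i \<inter> VB = {w})) \<and>
        V = VB \<union> (\<Union>i<s. Vs i) \<and> E = EB \<union> (\<Union>i<s. Es i) \<and>
        (\<Sum>i<s. card (Vs i - VB)) + 2 \<le> r)"

end

theory Submission
  imports Defs "HOL-Analysis.Function_Topology" "HOL-Analysis.Convex"
begin

text \<open>Let \<open>x\<close> be the Perron vector of \<open>G\<close>, scaled to have maximum 1, attained at \<open>v0\<close>. Since the neighbourhood
  of \<open>v0\<close> contains no path on \<open>2k\<close> vertices it spans few edges, so \<open>\<lambda>\<^sup>2 = \<lambda>\<^sup>2 x(v0)\<close>, a weighted count
  of walks of length two, forces nearly all edges between \<open>N(v0)\<close> and its complement. Hence all but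
  \<open>O(k)\<close> vertices form a dense bipartite core with paths of all admissible lengths. A further vertex with two
  neighbours in the core joins one of its sides; let \<open>T\<close> be the set of the remaining vertices.

  Vertices of \<open>T\<close> have tiny entries in \<open>x\<close>, and the square of the spectral radius of a bipartite graph is at
  most the number of its edges. Comparing with \<open>\<lambda>\<^sup>2 \<ge> \<lfloor>(n-r+1)\<^sup>2/4\<rfloor>\<close> leaves two cases. If
  \<open>|T| \<le> r - 2\<close>, an ear through \<open>T\<close> of the wrong parity closes up to a cycle of length \<open>2k+1\<close>, except in two
  configurations that miss too many edges; so the block of the core is bipartite and everything else is suspended on
  it. Otherwise \<open>|T| = r - 1\<close> and every other vertex lies in the core. Then moving all edges between
  \<open>T\<close> and the core to \<open>v0\<close> and completing the graph does not decrease the quadratic form at \<open>x\<close>, and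
  the Schur test with the Perron vector of the completed graph shows that only \<open>T_{n-r+1,2} \<circ> K_r\<close> reaches
  the bound.\<close>

section \<open>Quadratic forms and Perron vectors\<close>

text \<open>What decides is the leading term: a core on n - |T| vertices has at most (n - |T|)^2/4
  edges, against about (n - r + 1)^2/4. One vertex too many in T costs about n/2 edges, and the
  small entries on T win back far less. The value |T| = r - 1 is a tie, settled only by the exact
  equation for the spectral radius of the extremal graph; it is never solved, the Perron vector
  being written in terms of the radius. For |T| \<le> r - 2 counting alone yields nothing, and the
  cycle condition has to act through parities.

  The obstacle are the vertices that join a side on the strength of two neighbours. They carry many
  non-edges but also raise the bound on the entries in T, so every estimate contains their number q:
  a loss of order n q against a gain of order (1 + q)^2, affordable because q is a small fraction of
  n.

  The decimals are rounded consequences of n \<ge> 712 k. The threshold 0.15 n for missing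
  neighbours balances the number of exceptional vertices against the common neighbours that
  remain.\<close>

definition qform :: "'a set \<Rightarrow> ('a \<Rightarrow> 'a \<Rightarrow> real) \<Rightarrow> ('a \<Rightarrow> real) \<Rightarrow> real" where
  "qform V a x = (\<Sum>u\<in>V. \<Sum>v\<in>V. a u v * x u * x v)"

definition sqnorm :: "'a set \<Rightarrow> ('a \<Rightarrow> real) \<Rightarrow> real" where
  "sqnorm V x = (\<Sum>v\<in>V. (x v)\<^sup>2)"

lemma sqnorm_nonneg [simp]: "sqnorm V x \<ge> 0"
  by (simp add: sqnorm_def sum_nonneg)

lemma sqnorm_pos: "finite V \<Longrightarrow> v \<in> V \<Longrightarrow> x v \<noteq> 0 \<Longrightarrow> sqnorm V x > 0"
  unfolding sqnorm_def by (rule sum_pos2[of V v]) auto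

lemma sqnorm_eq_0: "finite V \<Longrightarrow> sqnorm V x = 0 \<Longrightarrow> v \<in> V \<Longrightarrow> x v = 0"
  using sqnorm_pos[of V v x] by fastforce

lemma qform_eigen:
  assumes "\<And>v. v \<in> V \<Longrightarrow> (\<Sum>u\<in>V. a v u * x u) = \<mu> * x v"
  shows "qform V a x = \<mu> * sqnorm V x"
proof -
  have "qform V a x = (\<Sum>u\<in>V. x u * (\<Sum>v\<in>V. a u v * x v))"
    unfolding qform_def by (simp add: sum_distrib_left mult_ac)
  also have "\<dots> = (\<Sum>u\<in>V. x u * (\<mu> * x u))"
    using assms by (intro sum.cong) auto
  finally show ?thesis
    by (simp add: sqnorm_def sum_distrib_left power2_eq_square mult_ac)
qed

lemma qform_perturb:
  assumes "finite V" "w \<in> V" and sym: "\<And>u v. u \<in> V \<Longrightarrow> v \<in> V \<Longrightarrow> a u v = a v u"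
  shows "qform V a (x(w := x w + s)) = qform V a x + 2 * s * (\<Sum>u\<in>V. a w u * x u) + s\<^sup>2 * a w w"
proof -
  define e where "e u = (if u = w then 1 else 0 :: real)" for u
  have "qform V a (x(w := x w + s)) = (\<Sum>u\<in>V. \<Sum>v\<in>V. a u v * (x u + s * e u) * (x v + s * e v))"
    unfolding qform_def e_def by (intro sum.cong) auto
  also have "\<dots> = (\<Sum>u\<in>V. \<Sum>v\<in>V. a u v * x u * x v + s * (e u * (a u v * x v)) + s * (a u v * x u * e v)
      + s\<^sup>2 * (e u * (a u v * e v)))"
    by (simp add: algebra_simps power2_eq_square)
  also have "\<dots> = qform V a x + s * (\<Sum>u\<in>V. e u * (\<Sum>v\<in>V. a u v * x v))
      + s * (\<Sum>u\<in>V. \<Sum>v\<in>V. a u v * x u * e v) + s\<^sup>2 * (\<Sum>u\<in>V. e u * (\<Sum>v\<in>V. a u v * e v))"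
    by (simp add: sum.distrib sum_distrib_left qform_def)
  also have "(\<Sum>u\<in>V. e u * (\<Sum>v\<in>V. a u v * x v)) = (\<Sum>u\<in>V. a w u * x u)"
    using assms(1,2) by (simp add: e_def if_distrib[of "\<lambda>z. z * _"] sum.delta cong: if_cong)
  also have "(\<Sum>u\<in>V. \<Sum>v\<in>V. a u v * x u * e v) = (\<Sum>u\<in>V. a w u * x u)"
    using assms by (simp add: e_def if_distrib[of "\<lambda>z. _ * z"] sum.delta cong: if_cong)
  also have "(\<Sum>u\<in>V. e u * (\<Sum>v\<in>V. a u v * e v)) = a w w"
    using assms(1,2) by (simp add: e_def if_distrib[of "\<lambda>z. z * _"] if_distrib[of "\<lambda>z. _ * z"] sum.delta cong: if_cong)
  finally show ?thesis by (simp add: fun_upd_def mult.assoc)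
qed

lemma sqnorm_perturb:
  assumes "finite V" "w \<in> V"
  shows "sqnorm V (x(w := x w + s)) = sqnorm V x + 2 * s * x w + s\<^sup>2"
proof -
  have "sqnorm V (x(w := x w + s)) = (x w + s)\<^sup>2 + (\<Sum>v\<in>V-{w}. (x v)\<^sup>2)"
    unfolding sqnorm_def using assms by (subst sum.remove[of V w]) auto
  moreover have "sqnorm V x = (x w)\<^sup>2 + (\<Sum>v\<in>V-{w}. (x v)\<^sup>2)"
    unfolding sqnorm_def using assms by (subst sum.remove[of V w]) auto
  ultimately show ?thesis by (simp add: power2_eq_square algebra_simps)
qed

lemma quadratic_nonpos_imp_linear_coeff_0:
  fixes c D :: real
  assumes "\<And>s. 2 * s * c + s\<^sup>2 * D \<le> 0"
  shows "c = 0"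
proof (rule ccontr)
  assume "c \<noteq> 0"
  define \<epsilon> where "\<epsilon> = 1 / (\<bar>D\<bar> + 1)"
  have e: "\<epsilon> > 0" "\<epsilon> * \<bar>D\<bar> \<le> 1" unfolding \<epsilon>_def by (auto simp: field_simps)
  have "2 * (\<epsilon> * c) * c + (\<epsilon> * c)\<^sup>2 * D = (\<epsilon> * c\<^sup>2) * (2 + \<epsilon> * D)"
    by (simp add: power2_eq_square algebra_simps)
  moreover have "\<epsilon> * D \<ge> - 1" using e by (smt (verit) mult_minus_right mult_left_mono)
  moreover have "\<epsilon> * c\<^sup>2 > 0" using e \<open>c \<noteq> 0\<close> by simp
  ultimately have "2 * (\<epsilon> * c) * c + (\<epsilon> * c)\<^sup>2 * D > 0" by simp
  with assms[of "\<epsilon> * c"] show False by simp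
qed

text \<open>First-order condition at a maximiser, with the variation confined to the coordinate
  \<open>w\<close>. Besides \<open>perron_exists\<close> it serves \<open>exact_comparison\<close>,
  where the Perron vector of G turns out to be one of the completed graph.\<close>

lemma qform_max_imp_eigen:
  assumes "finite V" and sym: "\<And>u v. u \<in> V \<Longrightarrow> v \<in> V \<Longrightarrow> a u v = a v u"
    and le: "\<And>y. qform V a y \<le> \<mu> * sqnorm V y" and eq: "qform V a x = \<mu> * sqnorm V x"
    and "w \<in> V"
  shows "(\<Sum>u\<in>V. a w u * x u) = \<mu> * x w"
proof -
  have "2 * s * ((\<Sum>u\<in>V. a w u * x u) - \<mu> * x w) + s\<^sup>2 * (a w w - \<mu>) \<le> 0" for s
  proof -
    have "qform V a (x(w := x w + s)) = qform V a x + 2 * s * (\<Sum>u\<in>V. a w u * x u) + s\<^sup>2 * a w w"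
      using assms(1,5) sym by (rule qform_perturb)
    with le[of "x(w := x w + s)"] eq show ?thesis
      unfolding sqnorm_perturb[OF assms(1,5)] by (simp add: algebra_simps)
  qed
  from quadratic_nonpos_imp_linear_coeff_0[OF this] show ?thesis by simp
qed

lemma qform_scale: "qform V a (\<lambda>v. c * x v) = c\<^sup>2 * qform V a x"
  by (simp add: qform_def sum_distrib_left power2_eq_square mult_ac)

lemma sqnorm_scale: "sqnorm V (\<lambda>v. c * x v) = c\<^sup>2 * sqnorm V x"
  by (simp add: sqnorm_def sum_distrib_left power_mult_distrib)

lemma qform_cong: "(\<And>v. v \<in> V \<Longrightarrow> x v = y v) \<Longrightarrow> qform V a x = qform V a y"
  by (simp add: qform_def)

lemma sqnorm_cong: "(\<And>v. v \<in> V \<Longrightarrow> x v = y v) \<Longrightarrow> sqnorm V x = sqnorm V y"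
  by (simp add: sqnorm_def)

text \<open>Functions vanishing outside \<open>V\<close> with values in \<open>[-1,1]\<close> form a compact set in the
  product topology, which spares us from choosing coordinates on \<open>V\<close>.\<close>
lemma qform_attains_max:
  fixes a :: "'a \<Rightarrow> 'a \<Rightarrow> real"
  assumes "finite V" "V \<noteq> {}"
  obtains x where "sqnorm V x = 1" "\<And>y. qform V a y \<le> qform V a x * sqnorm V y"
proof -
  define K where "K = PiE UNIV (\<lambda>i::'a. if i \<in> V then {-1..1::real} else {0})"
  have "compactin (product_topology (\<lambda>i. euclidean) UNIV) K"
    unfolding K_def by (subst compactin_PiE) (auto simp: compactin_euclidean_iff)
  then have "compact K"
    by (simp add: euclidean_product_topology)
  have cc: "continuous_on S (\<lambda>x :: 'a \<Rightarrow> real. x v)" for S v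
    by (rule continuous_on_subset[OF continuous_on_product_coordinates]) auto
  have cn: "continuous_on S (sqnorm V)" for S
    unfolding sqnorm_def by (intro continuous_intros cc)
  have cq: "continuous_on S (qform V a)" for S
    unfolding qform_def by (intro continuous_intros cc)
  have "closed {x. sqnorm V x = 1}"
    using continuous_closed_preimage_constant[OF cn[of UNIV], of 1] by simp
  then have cS: "compact (K \<inter> {x. sqnorm V x = 1})"
    using \<open>compact K\<close> by (rule compact_Int_closed[rotated])
  obtain v0 where "v0 \<in> V" using assms by blast
  have "(\<lambda>v. if v = v0 then 1 else 0) \<in> K \<inter> {x. sqnorm V x = 1}"
    using assms \<open>v0 \<in> V\<close> by (auto simp: K_def sqnorm_def PiE_def Pi_def if_distrib[of "\<lambda>z. z^2"] cong: if_cong)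
  then obtain x where x: "x \<in> K \<inter> {x. sqnorm V x = 1}"
    and mx: "\<And>y. y \<in> K \<inter> {x. sqnorm V x = 1} \<Longrightarrow> qform V a y \<le> qform V a x"
    using continuous_attains_sup[OF cS _ cq] by blast
  have "qform V a y \<le> qform V a x * sqnorm V y" for y
  proof (cases "sqnorm V y = 0")
    case True
    then have "y v = 0" if "v \<in> V" for v using sqnorm_eq_0[OF assms(1)] that by blast
    then show ?thesis using True by (simp add: qform_def)
  next
    case False
    then have pos: "sqnorm V y > 0" using sqnorm_nonneg[of V y] by linarith
    define c where "c = 1 / sqrt (sqnorm V y)"
    have c2: "c\<^sup>2 * sqnorm V y = 1" "c\<^sup>2 = 1 / sqnorm V y"
      using pos by (auto simp: c_def power_divide)
    define z where "z v = (if v \<in> V then c * y v else 0)" for v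
    have nz: "sqnorm V z = 1"
      using sqnorm_cong[of V z "\<lambda>v. c * y v"] c2(1) by (simp add: z_def sqnorm_scale)
    have qz: "qform V a z = c\<^sup>2 * qform V a y"
      using qform_cong[of V z "\<lambda>v. c * y v"] by (simp add: z_def qform_scale)
    have "\<bar>z v\<bar> \<le> 1" if "v \<in> V" for v
    proof -
      have "(z v)\<^sup>2 \<le> sqnorm V z"
        unfolding sqnorm_def using assms(1) that by (intro member_le_sum) auto
      then show ?thesis using nz by (simp add: abs_square_le_1)
    qed
    then have "z \<in> K" by (force simp: K_def PiE_def Pi_def z_def abs_le_iff)
    then have "qform V a z \<le> qform V a x" using mx nz by auto
    then show ?thesis unfolding qz c2 using pos by (simp add: field_simps)
  qed
  then show ?thesis using that x by blast
qed

text \<open>The entries of \<open>a\<close> are nonnegative, so taking absolute values of a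
  maximiser does not decrease the form; the result is again a maximiser and hence an eigenvector. As
  the graph may be disconnected, zero entries are possible.\<close>

lemma perron_exists:
  fixes a :: "'a \<Rightarrow> 'a \<Rightarrow> real"
  assumes "finite V" "V \<noteq> {}" and sym: "\<And>u v. u \<in> V \<Longrightarrow> v \<in> V \<Longrightarrow> a u v = a v u"
    and nn: "\<And>u v. u \<in> V \<Longrightarrow> v \<in> V \<Longrightarrow> a u v \<ge> 0"
  obtains x \<mu> where "\<And>v. x v \<ge> 0" "\<exists>v\<in>V. x v > 0"
    "\<And>v. v \<in> V \<Longrightarrow> (\<Sum>u\<in>V. a v u * x u) = \<mu> * x v" "\<And>y. qform V a y \<le> \<mu> * sqnorm V y"
proof -
  obtain x where x: "sqnorm V x = 1" "\<And>y. qform V a y \<le> qform V a x * sqnorm V y"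
    using qform_attains_max[OF assms(1,2)] by metis
  define z where "z v = \<bar>x v\<bar>" for v
  have nz: "sqnorm V z = 1" using x by (simp add: sqnorm_def z_def)
  have "qform V a x \<le> qform V a z"
    unfolding qform_def z_def mult.assoc
    by (intro sum_mono mult_left_mono nn) (auto simp flip: abs_mult)
  with x(2)[of z] nz have eq: "qform V a z = qform V a x" by simp
  have "\<exists>v\<in>V. z v \<noteq> 0"
  proof (rule ccontr)
    assume "\<not> ?thesis"
    then have "sqnorm V z = 0" by (simp add: sqnorm_def)
    with nz show False by simp
  qed
  then have "\<exists>v\<in>V. z v > 0" by (auto simp: z_def)
  moreover have "(\<Sum>u\<in>V. a v u * z u) = qform V a x * z v" if "v \<in> V" for v
    using qform_max_imp_eigen[OF assms(1) sym x(2) _ that, of z] eq nz by simp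
  ultimately show ?thesis using that[of z "qform V a x"] x(2) by (auto simp: z_def)
qed

text \<open>Weighted AM-GM for each product \<open>x u * x v\<close>. The row quotients stay in the
  bound instead of their maximum, so that equality can later be examined row by row.\<close>

lemma schur_test:
  fixes a :: "'a \<Rightarrow> 'a \<Rightarrow> real"
  assumes sym: "\<And>u v. u \<in> V \<Longrightarrow> v \<in> V \<Longrightarrow> a u v = a v u"
    and nn: "\<And>u v. u \<in> V \<Longrightarrow> v \<in> V \<Longrightarrow> a u v \<ge> 0"
    and pos: "\<And>v. v \<in> V \<Longrightarrow> y v > 0"
  shows "qform V a x \<le> (\<Sum>v\<in>V. (\<Sum>u\<in>V. a v u * y u) / y v * (x v)\<^sup>2)"
proof -
  have "qform V a x \<le> (\<Sum>u\<in>V. \<Sum>v\<in>V. a u v * ((x u)\<^sup>2 * y v / y u + (x v)\<^sup>2 * y u / y v) / 2)"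
    unfolding qform_def
  proof (intro sum_mono)
    fix u v assume uv: "u \<in> V" "v \<in> V"
    have p: "y u > 0" "y v > 0" using pos uv by auto
    have "0 \<le> (x u * y v - x v * y u)\<^sup>2 / (y u * y v)" using p by simp
    also have "\<dots> = (x u)\<^sup>2 * y v / y u + (x v)\<^sup>2 * y u / y v - 2 * x u * x v"
      using p by (simp add: field_simps power2_eq_square)
    finally have "x u * x v \<le> ((x u)\<^sup>2 * y v / y u + (x v)\<^sup>2 * y u / y v) / 2" by simp
    then have "a u v * (x u * x v) \<le> a u v * (((x u)\<^sup>2 * y v / y u + (x v)\<^sup>2 * y u / y v) / 2)"
      using nn[OF uv] by (rule mult_left_mono)
    then show "a u v * x u * x v \<le> a u v * ((x u)\<^sup>2 * y v / y u + (x v)\<^sup>2 * y u / y v) / 2"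
      by (simp add: mult.assoc)
  qed
  also have "\<dots> = ((\<Sum>u\<in>V. \<Sum>v\<in>V. a u v * ((x u)\<^sup>2 * y v / y u))
      + (\<Sum>u\<in>V. \<Sum>v\<in>V. a u v * ((x v)\<^sup>2 * y u / y v))) / 2"
    by (simp add: sum_divide_distrib sum.distrib[symmetric] distrib_left add_divide_distrib)
  also have "(\<Sum>u\<in>V. \<Sum>v\<in>V. a u v * ((x v)\<^sup>2 * y u / y v)) = (\<Sum>v\<in>V. \<Sum>u\<in>V. a v u * ((x v)\<^sup>2 * y u / y v))"
    by (subst sum.swap) (simp add: sym)
  finally show ?thesis
    by (simp add: sum_distrib_left sum_distrib_right sum_divide_distrib mult_ac)
qed

section \<open>Orthogonality of eigenvectors and the largest eigenvalue\<close>

lemma eigen_orthogonal: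
  fixes a :: "'a \<Rightarrow> 'a \<Rightarrow> real"
  assumes sym: "\<And>u v. u \<in> V \<Longrightarrow> v \<in> V \<Longrightarrow> a u v = a v u"
    and x: "\<And>v. v \<in> V \<Longrightarrow> (\<Sum>u\<in>V. a v u * x u) = \<mu> * x v"
    and y: "\<And>v. v \<in> V \<Longrightarrow> (\<Sum>u\<in>V. a v u * y u) = \<nu> * y v"
    and ne: "\<mu> \<noteq> \<nu>"
  shows "(\<Sum>v\<in>V. x v * y v) = 0"
proof -
  have "\<mu> * (\<Sum>v\<in>V. x v * y v) = (\<Sum>v\<in>V. (\<Sum>u\<in>V. a v u * x u) * y v)"
    using x by (simp add: sum_distrib_left mult.assoc)
  also have "\<dots> = (\<Sum>u\<in>V. \<Sum>v\<in>V. a v u * x u * y v)"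
    by (subst sum.swap) (simp add: sum_distrib_right)
  also have "\<dots> = (\<Sum>u\<in>V. x u * (\<Sum>v\<in>V. a u v * y v))"
    using sym by (intro sum.cong) (auto simp: sum_distrib_left mult_ac intro!: sum.cong)
  also have "\<dots> = \<nu> * (\<Sum>v\<in>V. x v * y v)"
    using y by (simp add: sum_distrib_left mult_ac)
  finally show ?thesis using ne by simp
qed

text \<open>Bessel's inequality for the coordinate vectors bounds the number of eigenvalues.\<close>
lemma card_orthonormal_le:
  fixes f :: "'i \<Rightarrow> 'a \<Rightarrow> real"
  assumes "finite V" "finite I" and n1: "\<And>i. i \<in> I \<Longrightarrow> sqnorm V (f i) = 1"
    and orth: "\<And>i j. i \<in> I \<Longrightarrow> j \<in> I \<Longrightarrow> i \<noteq> j \<Longrightarrow> (\<Sum>v\<in>V. f i v * f j v) = 0"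
  shows "card I \<le> card V"
proof -
  have bess: "(\<Sum>i\<in>I. (f i w)\<^sup>2) \<le> 1" if "w \<in> V" for w
  proof -
    \<comment> \<open>\<open>g\<close> is the projection of the coordinate vector of
      \<open>w\<close> onto the span of the family; its squared norm equals \<open>g w\<close>,
      which forces \<open>g w \<le> 1\<close>.\<close>
    define g where "g v = (\<Sum>i\<in>I. f i w * f i v)" for v
    have ip: "(\<Sum>v\<in>V. f i v * f j v) = (if i = j then 1 else 0)" if "i \<in> I" "j \<in> I" for i j
      using n1[OF that(1)] orth[OF that] by (auto simp: sqnorm_def power2_eq_square)
    have "(\<Sum>v\<in>V. (g v)\<^sup>2) = (\<Sum>v\<in>V. \<Sum>i\<in>I. \<Sum>j\<in>I. f i w * f j w * (f i v * f j v))"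
      unfolding g_def power2_eq_square sum_product by (simp add: mult_ac)
    also have "\<dots> = (\<Sum>i\<in>I. \<Sum>j\<in>I. \<Sum>v\<in>V. f i w * f j w * (f i v * f j v))"
      by (subst sum.swap, rule sum.cong, simp, rule sum.swap)
    also have "\<dots> = (\<Sum>i\<in>I. \<Sum>j\<in>I. f i w * f j w * (if i = j then 1 else 0))"
      using ip by (simp add: sum_distrib_left[symmetric])
    also have "\<dots> = (\<Sum>i\<in>I. (f i w)\<^sup>2)"
      using assms(2) by (simp add: if_distrib[of "\<lambda>z. _ * z"] sum.delta power2_eq_square cong: if_cong)
    finally have s: "(\<Sum>v\<in>V. (g v)\<^sup>2) = (\<Sum>i\<in>I. (f i w)\<^sup>2)" .
    have gw: "g w = (\<Sum>i\<in>I. (f i w)\<^sup>2)" by (simp add: g_def power2_eq_square)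
    have "(g w)\<^sup>2 \<le> (\<Sum>v\<in>V. (g v)\<^sup>2)" using assms(1) that by (intro member_le_sum) auto
    then have "g w * g w \<le> g w" using s gw by (simp add: power2_eq_square)
    moreover have "g w \<ge> 0" unfolding gw by (simp add: sum_nonneg)
    ultimately have "g w \<le> 1"
      using mult_strict_right_mono[of 1 "g w" "g w"] by linarith
    then show ?thesis using gw by simp
  qed
  have "real (card I) = (\<Sum>i\<in>I. \<Sum>v\<in>V. (f i v)\<^sup>2)" using n1 by (simp add: sqnorm_def)
  also have "\<dots> = (\<Sum>v\<in>V. \<Sum>i\<in>I. (f i v)\<^sup>2)" by (rule sum.swap)
  also have "\<dots> \<le> (\<Sum>v\<in>V. 1)" by (intro sum_mono bess)
  finally show ?thesis by simp
qed

abbreviation adjm :: "'a set set \<Rightarrow> 'a \<Rightarrow> 'a \<Rightarrow> real" where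
  "adjm E v u \<equiv> (if {v, u} \<in> E then 1 else 0)"

text \<open>\<open>Max\<close> in \<open>graph_lambda\<close> is meaningful only for a finite set.
  Normalised eigenvectors of distinct eigenvalues are orthonormal, so there are at most
  \<open>card V\<close> eigenvalues.\<close>

lemma finite_adj_eigenvalues:
  assumes "finite V"
  shows "finite {\<mu>. adj_eigenvalue V E \<mu>}"
proof (rule ccontr)
  assume "infinite {\<mu>. adj_eigenvalue V E \<mu>}"
  then obtain I where I: "I \<subseteq> {\<mu>. adj_eigenvalue V E \<mu>}" "finite I" "card I = Suc (card V)"
    using infinite_arbitrarily_large by blast
  have "\<exists>x. sqnorm V x = 1 \<and> (\<forall>v\<in>V. (\<Sum>u\<in>V. adjm E v u * x u) = \<mu> * x v)" if "\<mu> \<in> I" for \<mu>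
  proof -
    from that I obtain x where x: "\<exists>v\<in>V. x v \<noteq> 0" "\<forall>v\<in>V. (\<Sum>u\<in>V. adjm E v u * x u) = \<mu> * x v"
      unfolding adj_eigenvalue_def by blast
    have pos: "sqnorm V x > 0" using sqnorm_pos[OF assms] x by blast
    define c where "c = 1 / sqrt (sqnorm V x)"
    have "c\<^sup>2 * sqnorm V x = 1" using pos by (auto simp: c_def power_divide)
    then have "sqnorm V (\<lambda>v. c * x v) = 1" by (simp add: sqnorm_scale)
    moreover have "(\<Sum>u\<in>V. adjm E v u * (c * x u)) = \<mu> * (c * x v)" if "v \<in> V" for v
    proof -
      have "(\<Sum>u\<in>V. adjm E v u * (c * x u)) = c * (\<Sum>u\<in>V. adjm E v u * x u)"
        by (simp only: sum_distrib_left mult.left_commute)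
      then show ?thesis using x that by simp
    qed
    ultimately show ?thesis by blast
  qed
  then have "\<forall>\<mu>\<in>I. \<exists>x. sqnorm V x = 1 \<and> (\<forall>v\<in>V. (\<Sum>u\<in>V. adjm E v u * x u) = \<mu> * x v)" by blast
  from bchoice[OF this] obtain f where "\<forall>\<mu>\<in>I. sqnorm V (f \<mu>) = 1 \<and>
    (\<forall>v\<in>V. (\<Sum>u\<in>V. adjm E v u * f \<mu> u) = \<mu> * f \<mu> v)" by blast
  then have f: "\<And>\<mu>. \<mu> \<in> I \<Longrightarrow> sqnorm V (f \<mu>) = 1"
    "\<And>\<mu> v. \<mu> \<in> I \<Longrightarrow> v \<in> V \<Longrightarrow> (\<Sum>u\<in>V. adjm E v u * f \<mu> u) = \<mu> * f \<mu> v" by blast+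
  have "card I \<le> card V"
    using assms I(2) f(1)
  proof (rule card_orthonormal_le)
    fix i j assume "i \<in> I" "j \<in> I" "i \<noteq> j"
    then show "(\<Sum>v\<in>V. f i v * f j v) = 0"
      using f(2) by (intro eigen_orthogonal[where a = "adjm E" and \<mu> = i and \<nu> = j])
        (auto simp: insert_commute)
  qed
  with I show False by simp
qed

lemma graph_lambda_perron:
  assumes "finite V" "V \<noteq> {}"
  obtains x where "\<And>v. x v \<ge> 0" "\<exists>v\<in>V. x v > 0"
    "\<And>v. v \<in> V \<Longrightarrow> (\<Sum>u\<in>V. adjm E v u * x u) = graph_lambda V E * x v"
    "\<And>y. qform V (adjm E) y \<le> graph_lambda V E * sqnorm V y"
proof -
  obtain x \<mu> where x: "\<And>v. x v \<ge> 0" "\<exists>v\<in>V. x v > 0"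
    "\<And>v. v \<in> V \<Longrightarrow> (\<Sum>u\<in>V. adjm E v u * x u) = \<mu> * x v"
    "\<And>y. qform V (adjm E) y \<le> \<mu> * sqnorm V y"
  proof (rule perron_exists[OF assms, of "adjm E"])
    show "adjm E u v = adjm E v u" for u v by (simp add: insert_commute)
    show "0 \<le> adjm E u v" for u v by simp
  qed (use that in blast)
  have lam: "graph_lambda V E = \<mu>"
    unfolding graph_lambda_def
  proof (rule Max_eqI[OF finite_adj_eigenvalues[OF assms(1)]])
    show "\<mu> \<in> {\<mu>. adj_eigenvalue V E \<mu>}"
      unfolding adj_eigenvalue_def using x(2,3) by (force intro!: exI[of _ x])
    fix \<nu> assume "\<nu> \<in> {\<mu>. adj_eigenvalue V E \<mu>}"
    then obtain y where y: "\<exists>v\<in>V. y v \<noteq> 0" "\<And>v. v \<in> V \<Longrightarrow> (\<Sum>u\<in>V. adjm E v u * y u) = \<nu> * y v"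
      unfolding adj_eigenvalue_def by auto
    have "\<nu> * sqnorm V y = qform V (adjm E) y" using qform_eigen[OF y(2)] by simp
    with x(4)[of y] have "\<nu> * sqnorm V y \<le> \<mu> * sqnorm V y" by simp
    moreover have "sqnorm V y > 0" using sqnorm_pos[OF assms(1)] y(1) by blast
    ultimately show "\<nu> \<le> \<mu>" by simp
  qed
  show ?thesis by (rule that[of x], unfold lam) (fact x)+
qed

section \<open>Odd cycles through a dense bipartite graph\<close>

locale fin_graph =
  fixes V :: "'a set" and E :: "'a set set"
  assumes simple: "simple_graph V E"
begin

abbreviation adj :: "'a \<Rightarrow> 'a \<Rightarrow> bool" where
  "adj u v \<equiv> {u, v} \<in> E"

definition nb :: "'a \<Rightarrow> 'a set \<Rightarrow> 'a set" where
  "nb u S = {v \<in> S. adj u v}"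

definition path :: "'a list \<Rightarrow> bool" where
  "path p \<longleftrightarrow> distinct p \<and> successively adj p"

lemma finV: "finite V"
  using simple by (simp add: simple_graph_def)

lemma adj_sym: "adj u v \<longleftrightarrow> adj v u"
  by (simp add: insert_commute)

lemma adjD: "adj u v \<Longrightarrow> u \<in> V \<and> v \<in> V \<and> u \<noteq> v"
  using simple unfolding simple_graph_def by (fastforce simp: card_2_iff doubleton_eq_iff)

lemma edge_cases:
  assumes "e \<in> E"
  obtains u v where "e = {u, v}" "u \<noteq> v" "u \<in> V" "v \<in> V"
proof -
  have "e \<subseteq> V" "card e = 2" using assms simple unfolding simple_graph_def by auto
  then show ?thesis using that by (metis card_2_iff insert_subset)
qed

lemma nb_subset: "nb u S \<subseteq> S" "nb u S \<subseteq> V"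
  using adjD by (auto simp: nb_def)

lemma finite_nb [simp]: "finite (nb u S)"
  using nb_subset(2) finV finite_subset by blast

lemma nb_Un: "nb u (S \<union> T) = nb u S \<union> nb u T"
  by (auto simp: nb_def)

lemma nb_mono: "S \<subseteq> T \<Longrightarrow> nb u S \<subseteq> nb u T"
  by (auto simp: nb_def)

lemma path_Cons: "path (u # p) \<longleftrightarrow> u \<notin> set p \<and> (p = [] \<or> adj u (hd p)) \<and> path p"
  by (auto simp: path_def successively_Cons)

lemma path_append:
  "path (p @ q) \<longleftrightarrow> path p \<and> path q \<and> set p \<inter> set q = {} \<and> (p = [] \<or> q = [] \<or> adj (last p) (hd q))"
  by (auto simp: path_def successively_append_iff)

lemma path_rev [simp]: "path (rev p) \<longleftrightarrow> path p"
  unfolding path_def using adj_sym by (simp add: insert_commute)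

lemma path_Nil [simp]: "path []" and path_single [simp]: "path [u]"
  by (auto simp: path_def)

lemma cycle_from_path:
  assumes "path p" "set p \<subseteq> V" "length p \<ge> 2" "adj (last p) (hd p)"
  shows "contains_cycle V E (length p)"
proof -
  have ne: "p \<noteq> []" using assms(3) by auto
  have "adj (p ! i) (p ! ((i + 1) mod length p))" if i: "i < length p" for i
  proof (cases "Suc i < length p")
    case True
    then show ?thesis using assms(1) successively_nth by (auto simp: path_def)
  next
    case False
    then have "i = length p - 1" using i by simp
    then show ?thesis using assms(4) ne i False by (simp add: last_conv_nth hd_conv_nth)
  qed
  then show ?thesis
    unfolding contains_cycle_def using assms(1,2)
    by (intro exI[of _ "\<lambda>i. p ! i"]) (auto simp: path_def inj_on_nth)
qed

text \<open>Density in the form that greedy path building uses: two vertices of one side have a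
  common neighbour outside any small forbidden set. The case \<open>a = a'\<close> is included and
  yields minimum degree \<open>K\<close>.\<close>

definition linked :: "nat \<Rightarrow> 'a set \<Rightarrow> 'a set \<Rightarrow> bool" where
  "linked K A B \<longleftrightarrow> A \<subseteq> V \<and> B \<subseteq> V \<and> A \<inter> B = {} \<and> K \<le> card A \<and> K \<le> card B \<and>
     (\<forall>a\<in>A. \<forall>a'\<in>A. K \<le> card (nb a B \<inter> nb a' B)) \<and>
     (\<forall>b\<in>B. \<forall>b'\<in>B. K \<le> card (nb b A \<inter> nb b' A))"

lemma linked_sym: "linked K A B \<Longrightarrow> linked K B A"
  unfolding linked_def by auto

section \<open>Greedy paths with prescribed ends in a linked pair\<close>

lemma ex_not_in_smaller:
  assumes "finite F" "card F < card S"
  shows "\<exists>x\<in>S. x \<notin> F"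
proof (rule ccontr)
  assume "\<not> ?thesis"
  then have "S \<subseteq> F" by blast
  then show False using assms card_mono[of F S] by simp
qed

text \<open>The forbidden set \<open>F\<close> is general because the induction puts the two
  vertices just used, \<open>a\<close> and \<open>b\<close>, into it; \<open>card F + 2 * j\<close>
  stays constant. Callers use \<open>F\<close> to keep further vertices of a cycle off the
  path.\<close>

lemma even_path_Suc:
  assumes L: "linked K A B" and "a' \<in> A"
  shows "a \<in> A \<Longrightarrow> a \<noteq> a' \<Longrightarrow> finite F \<Longrightarrow> a \<notin> F \<Longrightarrow> a' \<notin> F \<Longrightarrow> card F + 2 * j + 4 \<le> K \<Longrightarrow>
    \<exists>p. path p \<and> p \<noteq> [] \<and> hd p = a \<and> last p = a' \<and> length p = 2 * j + 3 \<and>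
      set p \<subseteq> A \<union> B \<and> set p \<inter> F = {}"
proof (induction j arbitrary: a F)
  case 0
  have "card F < card (nb a B \<inter> nb a' B)"
  proof -
    have "K \<le> card (nb a B \<inter> nb a' B)" using L 0(1) assms(2) unfolding linked_def by blast
    then show ?thesis using 0 by linarith
  qed
  from ex_not_in_smaller[OF 0(3) this] obtain b where b: "b \<in> nb a B" "b \<in> nb a' B" "b \<notin> F" by blast
  then have "adj a b" "adj b a'" "b \<in> B" by (auto simp: nb_def insert_commute)
  moreover have "A \<inter> B = {}" using L by (auto simp: linked_def)
  ultimately have "path [a, b, a'] \<and> set [a, b, a'] \<subseteq> A \<union> B \<and> set [a, b, a'] \<inter> F = {}"
    using 0 assms(2) b adjD by (auto simp: path_Cons)
  then show ?case by (intro exI[of _ "[a, b, a']"]) auto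
next
  case (Suc j)
  have AB: "A \<inter> B = {}" using L by (auto simp: linked_def)
  have c2: "card (insert a (insert a' F)) \<le> card F + 2"
    using Suc.prems by (simp add: card_insert_if)
  have "card (insert a (insert a' F)) < card A" using c2 L Suc.prems unfolding linked_def by linarith
  from ex_not_in_smaller[OF _ this] Suc.prems(3)
  obtain a1 where a1: "a1 \<in> A" "a1 \<notin> F" "a1 \<noteq> a" "a1 \<noteq> a'" by auto
  have "K \<le> card (nb a B \<inter> nb a1 B)" using L Suc.prems(1) a1(1) by (auto simp: linked_def)
  then have "card F < card (nb a B \<inter> nb a1 B)" using Suc.prems by linarith
  from ex_not_in_smaller[OF Suc.prems(3) this]
  obtain b where b: "b \<in> nb a B" "b \<in> nb a1 B" "b \<notin> F" by blast
  then have ab: "adj a b" "adj b a1" "b \<in> B" by (auto simp: nb_def insert_commute)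
  have "card (insert a (insert b F)) + 2 * j + 4 \<le> K"
    using Suc.prems by (simp add: card_insert_if)
  moreover have "a1 \<notin> insert a (insert b F)" "a' \<notin> insert a (insert b F)"
    using a1 Suc.prems assms(2) ab(3) AB by auto
  ultimately obtain p where p: "path p" "p \<noteq> []" "hd p = a1" "last p = a'" "length p = 2 * j + 3"
    "set p \<subseteq> A \<union> B" "set p \<inter> insert a (insert b F) = {}"
    using Suc.IH[of a1 "insert a (insert b F)"] a1 Suc.prems by auto
  have "a \<noteq> b" using adjD ab(1) by blast
  then have "path (a # b # p)" using p ab by (auto simp: path_Cons)
  then show ?case using p Suc.prems ab b by (intro exI[of _ "a # b # p"]) auto
qed

lemma even_path:
  assumes L: "linked K A B" and "a \<in> A" "a' \<in> A" "a \<noteq> a'" "j \<ge> 1"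
    and "finite F" "a \<notin> F" "a' \<notin> F" "card F + 2 * j + 2 \<le> K"
  shows "\<exists>p. path p \<and> p \<noteq> [] \<and> hd p = a \<and> last p = a' \<and> length p = 2 * j + 1 \<and>
    set p \<subseteq> A \<union> B \<and> set p \<inter> F = {}"
proof -
  obtain i where "j = Suc i" using assms(5) by (cases j) auto
  then show ?thesis using even_path_Suc[OF L assms(3,2,4,6,7,8), of i] assms(9)
    by (simp add: eval_nat_numeral)
qed

lemma odd_path:
  assumes L: "linked K A B" and "a \<in> A" "b \<in> B" "j \<ge> 1"
    and "finite F" "a \<notin> F" "b \<notin> F" "card F + 2 * j + 3 \<le> K"
  shows "\<exists>p. path p \<and> p \<noteq> [] \<and> hd p = a \<and> last p = b \<and> length p = 2 * j + 2 \<and>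
    set p \<subseteq> A \<union> B \<and> set p \<inter> F = {}"
proof -
  have AB: "A \<inter> B = {}" using L by (auto simp: linked_def)
  have "K \<le> card (nb b A \<inter> nb b A)" using L assms(3) unfolding linked_def by blast
  then have "K \<le> card (nb b A)" by simp
  moreover have "card (insert a F) \<le> card F + 1" using assms(5) by (simp add: card_insert_if)
  ultimately have "card (insert a F) < card (nb b A)" using assms(8) by linarith
  from ex_not_in_smaller[OF _ this] assms(5)
  obtain a' where a': "a' \<in> A" "adj b a'" "a' \<notin> F" "a' \<noteq> a" by (auto simp: nb_def)
  have "card (insert b F) + 2 * j + 2 \<le> K"
    using assms(5,8) by (simp add: card_insert_if)
  moreover have "a \<notin> insert b F" "a' \<notin> insert b F" using assms a' AB by auto
  ultimately obtain p where p: "path p" "p \<noteq> []" "hd p = a" "last p = a'" "length p = 2 * j + 1"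
    "set p \<subseteq> A \<union> B" "set p \<inter> insert b F = {}"
    using even_path[OF L assms(2) a'(1) _ assms(4), of "insert b F"] a' assms(5) by blast
  have "path (p @ [b])" using p a' by (auto simp: path_append insert_commute)
  then show ?thesis using p assms by (intro exI[of _ "p @ [b]"]) auto
qed

text \<open>The added vertices are forced onto the side of \<open>A\<close>: an odd cycle would arise if one of them
  also had a neighbour in \<open>A\<close>.\<close>
definition ext :: "'a set \<Rightarrow> 'a set \<Rightarrow> 'a set" where
  "ext A B = A \<union> {w \<in> V - A - B. 2 \<le> card (nb w B)}"

end

locale odd_cycle_free = fin_graph +
  fixes k :: nat
  assumes k2: "k \<ge> 2" and nocyc: "\<not> contains_cycle V E (2 * k + 1)"
begin

section \<open>Consequences of excluding cycles of length 2k + 1\<close>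

lemma no_cycle_path:
  assumes "path p" "set p \<subseteq> V" "length p = 2 * k + 1" "adj (last p) (hd p)"
  shows False
  using cycle_from_path[OF assms(1,2) _ assms(4)] assms(3) nocyc k2 by simp

text \<open>The constant \<open>2 * k + 4\<close> is what \<open>even_path\<close> needs for a path
  on \<open>2 * k + 1\<close> vertices with two vertices kept off it, which covers every use
  below.\<close>

lemma linked_indep:
  assumes L: "linked (2 * k + 4) A B" and "u \<in> A" "v \<in> A"
  shows "\<not> adj u v"
proof
  assume "adj u v"
  then obtain p where p: "path p" "p \<noteq> []" "hd p = u" "last p = v" "length p = 2 * k + 1" "set p \<subseteq> A \<union> B"
    using even_path[OF L assms(2,3), of k "{}"] adjD k2 by auto
  have "set p \<subseteq> V" using p(6) L by (auto simp: linked_def)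
  then show False using no_cycle_path[of p] p \<open>adj u v\<close> by (simp add: insert_commute)
qed

lemma linked_outside:
  assumes L: "linked (2 * k + 4) A B" and "w \<notin> A \<union> B" "a \<in> A" "b \<in> B" "adj w a" "adj w b"
  shows False
proof -
  obtain p where p: "path p" "p \<noteq> []" "hd p = a" "last p = b" "length p = 2 * (k - 1) + 2" "set p \<subseteq> A \<union> B"
  proof -
    have "1 \<le> k - 1" "2 * (k - 1) + 3 \<le> 2 * k + 4" using k2 by arith+
    then show ?thesis using odd_path[OF L assms(3,4), of "k - 1" "{}"] that by force
  qed
  have "set p \<subseteq> V" using p(6) L by (auto simp: linked_def)
  moreover have "path (w # p)" using p assms by (auto simp: path_Cons)
  moreover have "length (w # p) = 2 * k + 1" using p(5) k2 by simp
  moreover have "w \<in> V" using assms(5) adjD by blast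
  ultimately show False using no_cycle_path[of "w # p"] p assms(6) by (simp add: insert_commute)
qed

text \<open>The reason for the threshold two in \<open>ext\<close>: a neighbour can be chosen
  different from a prescribed vertex, such as the other end of an ear.\<close>

lemma two_nbs:
  assumes "2 \<le> card (nb w B)"
  obtains b where "b \<in> B" "adj w b" "b \<noteq> x"
proof -
  have "card {x} < card (nb w B)" using assms by simp
  from ex_not_in_smaller[OF _ this] show ?thesis using that by (auto simp: nb_def)
qed

lemma ext_nb:
  assumes "linked (2 * k + 4) A B" "w \<in> ext A B"
  shows "2 \<le> card (nb w B)"
proof (cases "w \<in> A")
  case True
  then have "2 * k + 4 \<le> card (nb w B \<inter> nb w B)" using assms unfolding linked_def by blast
  then show ?thesis by simp
qed (use assms in \<open>auto simp: ext_def\<close>)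

lemma ext_subset: "linked K A B \<Longrightarrow> ext A B \<subseteq> V" "A \<subseteq> ext A B"
  by (auto simp: ext_def linked_def)

lemma ext_disjoint:
  assumes L: "linked (2 * k + 4) A B"
  shows "ext A B \<inter> ext B A = {}"
proof (rule ccontr)
  assume "\<not> ?thesis"
  then obtain w where w: "w \<in> ext A B" "w \<in> ext B A" by blast
  have "A \<inter> B = {}" using L by (auto simp: linked_def)
  with w have "w \<notin> A \<union> B" by (auto simp: ext_def)
  moreover obtain b where "b \<in> B" "adj w b" using two_nbs[OF ext_nb[OF L w(1)]] by metis
  moreover obtain a where "a \<in> A" "adj w a" using two_nbs[OF ext_nb[OF linked_sym[OF L] w(2)]] by metis
  ultimately show False using linked_outside[OF L] by blast
qed

text \<open>An edge between a vertex of \<open>A\<close> and an added one would give the latter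
  neighbours on both sides. An edge between two added vertices is closed by a path on
  \<open>2 * k - 1\<close> vertices between distinct neighbours in \<open>B\<close>.\<close>

lemma ext_indep:
  assumes L: "linked (2 * k + 4) A B" and u: "u \<in> ext A B" and v: "v \<in> ext A B"
  shows "\<not> adj u v"
proof
  assume uv: "adj u v"
  have one: False if asm: "u \<in> A" "v \<notin> A" "adj u v" "v \<in> ext A B" for u v
  proof -
    have o: "v \<notin> A \<union> B" using asm by (auto simp: ext_def)
    obtain b where b: "b \<in> B" "adj v b" using two_nbs[OF ext_nb[OF L asm(4)]] by metis
    have "adj v u" using asm(3) by (simp add: insert_commute)
    then show False using linked_outside[OF L o asm(1) b(1) _ b(2)] by blast
  qed
  consider "u \<in> A" "v \<in> A" | "u \<in> A" "v \<notin> A" | "u \<notin> A" "v \<in> A" | "u \<notin> A" "v \<notin> A" by blast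
  then show False
  proof cases
    case 1 then show ?thesis using linked_indep[OF L] uv by blast
  next
    case 2 then show ?thesis using one uv v by blast
  next
    case 3 then show ?thesis using one[of v u] uv u by (simp add: insert_commute)
  next
    case 4
    obtain b where b: "b \<in> B" "adj u b" using two_nbs[OF ext_nb[OF L u]] by metis
    obtain b' where b': "b' \<in> B" "adj v b'" "b' \<noteq> b" using two_nbs[OF ext_nb[OF L v]] by metis
    obtain p where p: "path p" "p \<noteq> []" "hd p = b" "last p = b'" "length p = 2 * (k - 1) + 1" "set p \<subseteq> B \<union> A"
    proof -
      have "1 \<le> k - 1" "2 * (k - 1) + 2 \<le> 2 * k + 4" using k2 by arith+
      then show ?thesis
        using even_path[OF linked_sym[OF L] b(1) b'(1), of "k - 1" "{}"] b'(3) that by force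
    qed
    have "u \<notin> A \<union> B" "v \<notin> A \<union> B" using 4 u v by (auto simp: ext_def)
    then have "path (u # p @ [v])"
      using p b b' adjD[OF uv] by (auto simp: path_Cons path_append insert_commute)
    moreover have "set (u # p @ [v]) \<subseteq> V" using p L adjD[OF uv] by (auto simp: linked_def)
    moreover have "length (u # p @ [v]) = 2 * k + 1" using p(5) k2 by simp
    ultimately show ?thesis
      using no_cycle_path[of "u # p @ [v]"] uv by (simp add: insert_commute)
  qed
qed

text \<open>Such a vertex sees at most one of the sides by \<open>linked_outside\<close>, and there
  fewer than two vertices. Only neighbours in the original sides are bounded, not those among the
  added vertices; this is the origin of the term \<open>1 + q\<close> in later estimates.\<close>

lemma card_nb_rest:
  assumes L: "linked (2 * k + 4) A B" and w: "w \<in> V" "w \<notin> ext A B" "w \<notin> ext B A"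
  shows "card (nb w (A \<union> B)) \<le> 1"
proof (cases "nb w A = {}")
  case True
  then have "nb w (A \<union> B) = nb w B" by (simp add: nb_Un)
  moreover have "card (nb w B) < 2" using w by (auto simp: ext_def)
  ultimately show ?thesis by simp
next
  case False
  then have "nb w B = {}"
    using linked_outside[OF L, of w] w by (auto simp: nb_def ext_def)
  then have "nb w (A \<union> B) = nb w A" by (simp add: nb_Un)
  moreover have "card (nb w A) < 2" using w by (auto simp: ext_def)
  ultimately show ?thesis by simp
qed

lemma outer_cycle:
  assumes p: "path p" "p \<noteq> []" "set p \<subseteq> C" "hd p = c1" "last p = c2"
    and e: "path e" "e \<noteq> []" "set e \<inter> C = {}" "adj c1 (hd e)" "adj (last e) c2"
    and len: "length p + length e = 2 * k + 1" and V: "C \<subseteq> V" "set e \<subseteq> V"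
  shows False
proof -
  have "path (p @ rev e)"
    using p e by (auto simp: path_append hd_rev insert_commute)
  moreover have "set (p @ rev e) \<subseteq> V" using p V by auto
  ultimately show False
    using no_cycle_path[of "p @ rev e"] p e len by (simp add: last_rev insert_commute)
qed

text \<open>The missing part of the cycle is a core path from \<open>c1\<close> to \<open>c2\<close>
  with \<open>2 * k + 1 - length e\<close> vertices. The ends are sure only of two neighbours each
  in \<open>B\<close>, so such a path is available from five vertices on; with three vertices it
  needs a common neighbour, and this is the exceptional configuration.\<close>

lemma outer_same:
  assumes L: "linked (2 * k + 4) A B" and c: "c1 \<in> ext A B" "c2 \<in> ext A B" "c1 \<noteq> c2"
    and e: "path e" "e \<noteq> []" "set e \<subseteq> V - ext A B - ext B A" "adj c1 (hd e)" "adj (last e) c2"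
    and par: "even (length e)" and len: "length e \<le> 2 * k - 2"
  shows "length e = 2 * k - 2 \<and> nb c1 (ext B A) \<inter> nb c2 (ext B A) = {}"
proof (rule ccontr)
  assume neg: "\<not> ?thesis"
  define C where "C = ext A B \<union> ext B A"
  have CV: "C \<subseteq> V" unfolding C_def using ext_subset(1)[OF L] ext_subset(1)[OF linked_sym[OF L]] by blast
  have eC: "set e \<inter> C = {}" "set e \<subseteq> V" using e(3) by (auto simp: C_def)
  show False
  proof (cases "length e = 2 * k - 2")
    case True
    with neg obtain b where b: "b \<in> ext B A" "adj c1 b" "adj c2 b" by (auto simp: nb_def)
    have "path [c1, b, c2]" using b c(3) adjD by (auto simp: path_Cons insert_commute)
    moreover have "length [c1, b, c2] + length e = 2 * k + 1" using True k2 by simp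
    moreover have "set [c1, b, c2] \<subseteq> C" using b c by (simp add: C_def)
    ultimately show False
      using outer_cycle[of "[c1, b, c2]" C c1 c2 e] e eC CV by simp
  next
    case False
    obtain m where m: "length e = 2 * m" using par by blast
    have m2: "m + 2 \<le> k" using False len m by arith
    define j where "j = k - m - 1"
    have j: "j \<ge> 1" "j \<le> k" using m2 by (auto simp: j_def)
    obtain b where b: "b \<in> B" "adj c1 b" using two_nbs[OF ext_nb[OF L c(1)]] by metis
    obtain b' where b': "b' \<in> B" "adj c2 b'" "b' \<noteq> b" using two_nbs[OF ext_nb[OF L c(2)]] by metis
    have d: "c1 \<notin> B" "c2 \<notin> B" using ext_disjoint[OF L] c ext_subset(2)[of B A] by auto
    have j': "card {c1, c2} + 2 * j + 2 \<le> 2 * k + 4" using j c(3) by simp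
    have "b \<notin> {c1, c2}" "b' \<notin> {c1, c2}" using b b' d by auto
    then obtain p where p: "path p" "p \<noteq> []" "hd p = b" "last p = b'" "length p = 2 * j + 1" "set p \<subseteq> B \<union> A"
       "set p \<inter> {c1, c2} = {}"
      using even_path[OF linked_sym[OF L] b(1) b'(1) b'(3)[symmetric] j(1), of "{c1,c2}"] j' by auto
    have "path (c1 # p @ [c2])"
      using p b b' c(3) by (auto simp: path_Cons path_append insert_commute)
    moreover have "set (c1 # p @ [c2]) \<subseteq> C"
      using p c ext_subset(2)[of A B] ext_subset(2)[of B A] by (auto simp: C_def)
    moreover have "length (c1 # p @ [c2]) + length e = 2 * k + 1" using p(5) m m2 by (simp add: j_def)
    ultimately show False
      using outer_cycle[of "c1 # p @ [c2]" C c1 c2 e] e eC CV by simp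
  qed
qed

text \<open>As in \<open>outer_same\<close>, but the core path has an even number of vertices. It is
  available from six on; the one with four vertices, \<open>c1, b, a, c2\<close>, needs an edge
  between the neighbourhoods of the ends.\<close>

lemma outer_diff:
  assumes L: "linked (2 * k + 4) A B" and c: "c1 \<in> ext A B" "c2 \<in> ext B A"
    and e: "path e" "e \<noteq> []" "set e \<subseteq> V - ext A B - ext B A" "adj c1 (hd e)" "adj (last e) c2"
    and par: "odd (length e)" and len: "length e \<le> 2 * k - 2"
  shows "length e = 2 * k - 3 \<and>
    (\<forall>b\<in>nb c1 (ext B A) - {c2}. \<forall>a\<in>nb c2 (ext A B) - {c1}. \<not> adj a b)"
proof (rule ccontr)
  assume neg: "\<not> ?thesis"
  define C where "C = ext A B \<union> ext B A"
  have CV: "C \<subseteq> V" unfolding C_def using ext_subset(1)[OF L] ext_subset(1)[OF linked_sym[OF L]] by blast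
  have eC: "set e \<inter> C = {}" "set e \<subseteq> V" using e(3) by (auto simp: C_def)
  have dis: "ext A B \<inter> ext B A = {}" by (rule ext_disjoint[OF L])
  have c12: "c1 \<noteq> c2" using c dis by auto
  show False
  proof (cases "length e = 2 * k - 3")
    case True
    with neg obtain a b where ab: "b \<in> ext B A" "adj c1 b" "b \<noteq> c2" "a \<in> ext A B" "adj c2 a" "a \<noteq> c1" "adj a b"
      by (auto simp: nb_def)
    have "path [c1, b, a, c2]" using ab c c12 dis adjD by (auto simp: path_Cons insert_commute)
    moreover have "length [c1, b, a, c2] + length e = 2 * k + 1" using True k2 by simp
    moreover have "set [c1, b, a, c2] \<subseteq> C" using ab c by (simp add: C_def)
    ultimately show False
      using outer_cycle[of "[c1, b, a, c2]" C c1 c2 e] e eC CV by simp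
  next
    case False
    obtain m where m: "length e = 2 * m + 1" using par by (elim oddE)
    have m2: "m + 3 \<le> k" using False len m by arith
    define j where "j = k - m - 2"
    have j: "j \<ge> 1" "j + 1 \<le> k" using m2 by (auto simp: j_def)
    obtain b where b: "b \<in> B" "adj c1 b" "b \<noteq> c2" using two_nbs[OF ext_nb[OF L c(1)]] by metis
    obtain a where a: "a \<in> A" "adj c2 a" "a \<noteq> c1" using two_nbs[OF ext_nb[OF linked_sym[OF L] c(2)]] by metis
    have d: "c1 \<notin> B" "c2 \<notin> A" using dis c ext_subset(2)[of B A] ext_subset(2)[of A B] by auto
    have j': "card {c1, c2} + 2 * j + 3 \<le> 2 * k + 4" using j c12 by simp
    have "b \<notin> {c1, c2}" "a \<notin> {c1, c2}" using b a d by auto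
    then obtain p where p: "path p" "p \<noteq> []" "hd p = b" "last p = a" "length p = 2 * j + 2" "set p \<subseteq> B \<union> A"
       "set p \<inter> {c1, c2} = {}"
      using odd_path[OF linked_sym[OF L] b(1) a(1) j(1), of "{c1,c2}"] j' by auto
    have "path (c1 # p @ [c2])"
      using p b a c12 by (auto simp: path_Cons path_append insert_commute)
    moreover have "set (c1 # p @ [c2]) \<subseteq> C"
      using p c ext_subset(2)[of A B] ext_subset(2)[of B A] by (auto simp: C_def)
    moreover have "length (c1 # p @ [c2]) + length e = 2 * k + 1" using p(5) m m2 by (simp add: j_def)
    ultimately show False
      using outer_cycle[of "c1 # p @ [c2]" C c1 c2 e] e eC CV by simp
  qed
qed

end

section \<open>Ears on a coloured core\<close>

abbreviation alternates :: "('a \<Rightarrow> bool) \<Rightarrow> 'a list \<Rightarrow> bool" where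
  "alternates \<sigma> \<equiv> successively (\<lambda>a b. \<sigma> a \<noteq> \<sigma> b)"

lemma alternates_parity:
  "alternates \<sigma> p \<Longrightarrow> p \<noteq> [] \<Longrightarrow> \<sigma> (hd p) = \<sigma> (last p) \<longleftrightarrow> odd (length p)"
  by (induction p) (auto simp: successively_Cons)

lemma alternates_exists:
  "distinct e \<Longrightarrow> \<exists>\<tau>. alternates \<tau> e \<and> (e \<noteq> [] \<longrightarrow> \<tau> (hd e) = b)"
proof (induction e arbitrary: b)
  case (Cons a e)
  then obtain \<tau> where t: "alternates \<tau> e" "e \<noteq> [] \<longrightarrow> \<tau> (hd e) = (\<not> b)" by auto
  have "alternates (\<tau>(a := b)) e"
    using t(1) Cons.prems by (subst successively_cong[where Q = "\<lambda>x y. \<tau> x \<noteq> \<tau> y" and ys = e]) auto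
  moreover have "hd e \<noteq> a" if "e \<noteq> []" using Cons.prems that hd_in_set[OF that] by auto
  ultimately show ?case
    using t(2) by (intro exI[of _ "\<tau>(a := b)"]) (auto simp: successively_Cons)
qed auto

lemma split_list_two:
  assumes "x \<in> set e" "y \<in> set e" "x \<noteq> y"
  shows "\<exists>e1 e2 e3. e = e1 @ x # e2 @ y # e3 \<or> e = e1 @ y # e2 @ x # e3"
proof -
  obtain f g where fg: "e = f @ x # g" using split_list assms(1) by metis
  show ?thesis
  proof (cases "y \<in> set g")
    case True
    then show ?thesis using split_list[OF True] fg by metis
  next
    case False
    then have "y \<in> set f" using assms fg by auto
    then show ?thesis using split_list[of y f] fg by (metis append.assoc append_Cons)
  qed
qed

text \<open>Ears that return to their starting vertex are left unrestricted, in accordance with the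
  family: what hangs at a single vertex of the bipartite part may contain odd cycles.\<close>

locale coloured_core = fin_graph +
  fixes C :: "'a set" and \<sigma>0 :: "'a \<Rightarrow> bool"
  assumes CV: "C \<subseteq> V" and Cne: "C \<noteq> {}"
    and proper0: "\<And>u v. u \<in> C \<Longrightarrow> v \<in> C \<Longrightarrow> adj u v \<Longrightarrow> \<sigma>0 u \<noteq> \<sigma>0 v"
    and ear0: "\<And>c1 c2 e. c1 \<in> C \<Longrightarrow> c2 \<in> C \<Longrightarrow> c1 \<noteq> c2 \<Longrightarrow> path e \<Longrightarrow> e \<noteq> [] \<Longrightarrow> set e \<subseteq> V - C \<Longrightarrow>
      adj c1 (hd e) \<Longrightarrow> adj (last e) c2 \<Longrightarrow> even (length e) \<longleftrightarrow> \<sigma>0 c1 \<noteq> \<sigma>0 c2"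
begin

text \<open>Instead of using Menger's theorem, the set \<open>D\<close> is built by adding ears to \<open>C\<close>. Any two vertices
  of \<open>D\<close> have disjoint properly coloured legs to \<open>C\<close>, so an edge or an ear of the wrong parity
  extends to a path between two vertices of \<open>C\<close> that contradicts \<open>ear0\<close>.\<close>
definition leg :: "('a \<Rightarrow> bool) \<Rightarrow> 'a set \<Rightarrow> 'a \<Rightarrow> 'a list \<Rightarrow> bool" where
  "leg \<sigma> D u p \<longleftrightarrow> p \<noteq> [] \<and> hd p = u \<and> last p \<in> C \<and> set (butlast p) \<inter> C = {} \<and> path p \<and>
     set p \<subseteq> D \<and> alternates \<sigma> p"

definition fan :: "('a \<Rightarrow> bool) \<Rightarrow> 'a set \<Rightarrow> 'a \<Rightarrow> 'a \<Rightarrow> bool" where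
  "fan \<sigma> D u v \<longleftrightarrow> (\<exists>p q. leg \<sigma> D u p \<and> leg \<sigma> D v q \<and> set p \<inter> set q = {})"

definition fanned :: "('a \<Rightarrow> bool) \<Rightarrow> 'a set \<Rightarrow> bool" where
  "fanned \<sigma> D \<longleftrightarrow> C \<subseteq> D \<and> D \<subseteq> V \<and> (\<forall>c\<in>C. \<sigma> c = \<sigma>0 c) \<and> (\<forall>u\<in>D. \<forall>v\<in>D. u \<noteq> v \<longrightarrow> fan \<sigma> D u v)"

lemma fan_sym: "fan \<sigma> D u v \<Longrightarrow> fan \<sigma> D v u"
  unfolding fan_def by (metis Int_commute)

lemma fanned_C: "fanned \<sigma>0 C"
  unfolding fanned_def fan_def using CV
  by (auto intro!: exI[of _ "[_]"] simp: leg_def)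

lemma leg_mono:
  assumes "leg \<sigma> D u p" "D \<subseteq> D'" "\<And>x. x \<in> D \<Longrightarrow> \<sigma>' x = \<sigma> x"
  shows "leg \<sigma>' D' u p"
proof -
  have "alternates \<sigma>' p \<longleftrightarrow> alternates \<sigma> p"
    using assms by (intro successively_cong) (auto simp: leg_def)
  then show ?thesis using assms by (auto simp: leg_def)
qed

lemma leg_extend:
  assumes "leg \<sigma> D u p" "C \<subseteq> D" "D \<subseteq> D'" "\<And>x. x \<in> D \<Longrightarrow> \<sigma>' x = \<sigma> x"
    and f: "path (f @ [u])" "alternates \<sigma>' (f @ [u])" "f \<noteq> []" "set f \<subseteq> D'" "set f \<inter> D = {}"
  shows "leg \<sigma>' D' (hd f) (f @ p)"
proof -
  have l: "leg \<sigma>' D' u p" using leg_mono[OF assms(1,3,4)] .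
  have p: "set p \<subseteq> D" "p \<noteq> []" "hd p = u" using assms(1) by (auto simp: leg_def)
  have "path (f @ p)" using f p l by (auto simp: path_append leg_def)
  moreover have "alternates \<sigma>' (f @ p)"
    using f p l by (auto simp: successively_append_iff leg_def)
  moreover have "set (butlast (f @ p)) \<inter> C = {}"
    using l f(5) assms(2) p by (auto simp: butlast_append leg_def)
  ultimately show ?thesis using l f p by (auto simp: leg_def)
qed

text \<open>Joining \<open>e\<close> to the two disjoint legs yields a path between distinct
  vertices of \<open>C\<close> with interior outside \<open>C\<close>. Its parity is prescribed by
  \<open>ear0\<close>, or by \<open>proper0\<close> when the interior is empty, and the alternating
  legs transport it to \<open>u\<close> and \<open>v\<close>. The case \<open>e = []\<close> says
  that \<open>\<sigma>\<close> properly colours \<open>D\<close>.\<close>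

lemma fanned_parity:
  assumes D: "fanned \<sigma> D" and uv: "u \<in> D" "v \<in> D" "u \<noteq> v"
    and e: "path e" "set e \<subseteq> V - D" "path (u # e @ [v])"
  shows "even (length e) \<longleftrightarrow> \<sigma> u \<noteq> \<sigma> v"
proof -
  obtain p q where p: "leg \<sigma> D u p" and q: "leg \<sigma> D v q" and pq: "set p \<inter> set q = {}"
    using D uv unfolding fanned_def fan_def by blast
  define c1 where "c1 = last p"
  define c2 where "c2 = last q"
  define p' where "p' = butlast p"
  define q' where "q' = butlast q"
  have p1: "p = p' @ [c1]" and q1: "q = q' @ [c2]"
    using p q by (auto simp: p'_def q'_def c1_def c2_def leg_def)
  have "c1 \<in> set p" "c2 \<in> set q" using p q by (auto simp: c1_def c2_def leg_def)
  then have "c1 \<noteq> c2" using pq by blast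
  moreover have "c1 \<in> C" "c2 \<in> C" using p q by (auto simp: c1_def c2_def leg_def)
  ultimately have c: "c1 \<in> C" "c2 \<in> C" "c1 \<noteq> c2" by blast+
  define f where "f = rev p' @ e @ q'"
  have hdl: "hd p = u" "hd q = v" "p \<noteq> []" "q \<noteq> []" "path p" "path q" "set p \<subseteq> D" "set q \<subseteq> D"
    using p q by (auto simp: leg_def)
  have "path (rev p @ e @ q)"
    using hdl e pq uv(3)
    by (cases "e = []") (auto simp: path_append path_Cons last_rev insert_commute)
  then have full: "path (c1 # f @ [c2])" by (simp add: p1 q1 f_def)
  have l: "\<sigma> u = \<sigma> c1 \<longleftrightarrow> odd (length p)" "\<sigma> v = \<sigma> c2 \<longleftrightarrow> odd (length q)"
    using alternates_parity[of \<sigma> p] alternates_parity[of \<sigma> q] p q hdl(1-4)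
    unfolding leg_def c1_def c2_def by simp_all
  have s: "\<sigma> c1 = \<sigma>0 c1" "\<sigma> c2 = \<sigma>0 c2" using D c by (auto simp: fanned_def)
  have len: "length p + length e + length q = length f + 2"
    by (simp add: f_def p1 q1)
  have "even (length f) \<longleftrightarrow> \<sigma>0 c1 \<noteq> \<sigma>0 c2"
  proof (cases "f = []")
    case True
    then have "adj c1 c2" using full by (simp add: path_Cons)
    then show ?thesis using proper0 c True by simp
  next
    case False
    have "set p' \<inter> C = {}" "set q' \<inter> C = {}" using p q by (auto simp: p'_def q'_def leg_def)
    then have "set f \<subseteq> V - C" using e(2) D hdl by (auto simp: f_def fanned_def p1 q1)
    moreover have "path f" "adj c1 (hd f)" "adj (last f) c2"
      using full False by (auto simp: path_Cons path_append)
    ultimately show ?thesis using ear0[OF c(1,2,3) _ False] by blast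
  qed
  moreover have "even (length f) \<longleftrightarrow> (even (length p) \<longleftrightarrow> even (length e) = even (length q))"
  proof -
    have "even (length f + 2) \<longleftrightarrow> even (length p + length e + length q)" using len by simp
    then show ?thesis by auto
  qed
  ultimately show ?thesis using l s by (cases "\<sigma> u"; cases "\<sigma> v") auto
qed

text \<open>The ear is coloured alternately from \<open>u\<close>; \<open>fanned_parity\<close>
  makes the colour fit at \<open>v\<close> too. New legs run along the ear to an end and continue
  with an old leg, two vertices of the ear leaving it in opposite directions.\<close>

lemma fanned_extend:
  assumes D: "fanned \<sigma> D" and uv: "u \<in> D" "v \<in> D" "u \<noteq> v"
    and e: "e \<noteq> []" "set e \<subseteq> V - D" "path (u # e @ [v])"
  shows "\<exists>\<sigma>'. fanned \<sigma>' (D \<union> set e)"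
proof -
  have pe: "path e" using e(3) by (auto simp: path_Cons path_append)
  obtain \<tau> where \<tau>: "alternates \<tau> e" "\<tau> (hd e) = (\<not> \<sigma> u)"
    using alternates_exists[of e "\<not> \<sigma> u"] pe e(1) by (auto simp: path_def)
  define \<sigma>' where "\<sigma>' x = (if x \<in> set e then \<tau> x else \<sigma> x)" for x
  define D' where "D' = D \<union> set e"
  have agree: "\<sigma>' x = \<sigma> x" if "x \<in> D" for x using that e(2) by (auto simp: \<sigma>'_def)
  have alt: "alternates \<sigma>' e"
    using \<tau>(1) by (subst successively_cong[where Q = "\<lambda>x y. \<tau> x \<noteq> \<tau> y" and ys = e]) (auto simp: \<sigma>'_def)
  have "even (length e) \<longleftrightarrow> \<sigma> u \<noteq> \<sigma> v" by (rule fanned_parity[OF D uv pe e(2,3)])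
  moreover have "\<sigma>' (hd e) = (\<not> \<sigma> u)" using \<tau>(2) e(1) by (simp add: \<sigma>'_def)
  ultimately have "\<sigma>' (last e) = (\<not> \<sigma> v)" using alternates_parity[OF alt e(1)] by blast
  then have altf: "alternates \<sigma>' (u # e @ [v])"
    using alt \<open>\<sigma>' (hd e) = (\<not> \<sigma> u)\<close> e(1) agree uv by (auto simp: successively_Cons successively_append_iff)
  have CD: "C \<subseteq> D" and DV: "D \<subseteq> V" using D by (auto simp: fanned_def)
  have DD': "D \<subseteq> D'" by (simp add: D'_def)
  have dis: "set e \<inter> D = {}" using e(2) by auto
  have backward: "leg \<sigma>' D' w (w # rev e1 @ p)" if "e = e1 @ w # e2" "leg \<sigma> D u p" for w e1 e2 p
  proof -
    have sp: "u # e @ [v] = (u # e1 @ [w]) @ (e2 @ [v])" using that(1) by simp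
    have "path (u # e1 @ [w])" using e(3) path_append unfolding sp by blast
    then have "path (rev (u # e1 @ [w]))" by (simp only: path_rev)
    moreover have "alternates \<sigma>' (u # e1 @ [w])"
      using altf successively_append_iff unfolding sp by blast
    then have "alternates \<sigma>' (rev (u # e1 @ [w]))"
      unfolding successively_rev by (rule successively_mono) auto
    ultimately show ?thesis
      using leg_extend[OF that(2) CD DD' agree, of "w # rev e1"] that(1) dis by (auto simp: D'_def)
  qed
  have forward: "leg \<sigma>' D' w (w # e2 @ q)" if "e = e1 @ w # e2" "leg \<sigma> D v q" for w e1 e2 q
  proof -
    have "path (w # e2 @ [v])" using e(3) that(1) by (auto simp: path_Cons path_append)
    moreover have "alternates \<sigma>' (w # e2 @ [v])"
      using altf that(1) by (auto simp: successively_Cons successively_append_iff)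
    ultimately show ?thesis
      using leg_extend[OF that(2) CD DD' agree, of "w # e2"] that(1) dis by (auto simp: D'_def)
  qed
  have old: "\<exists>p q. leg \<sigma> D x p \<and> leg \<sigma> D y q \<and> set p \<inter> set q = {} \<and> set p \<subseteq> D \<and> set q \<subseteq> D"
    if "x \<in> D" "y \<in> D" "x \<noteq> y" for x y
    using D that unfolding fanned_def fan_def by (metis leg_def)
  \<comment> \<open>The ear is left at an end different from \<open>y\<close>, since disjoint old
    legs exist only for distinct vertices of \<open>D\<close>.\<close>
  have mixed: "fan \<sigma>' D' w y" if w: "w \<in> set e" and y: "y \<in> D" for w y
  proof -
    obtain e1 e2 where sp: "e = e1 @ w # e2" using split_list[OF w] by blast
    show ?thesis
    proof (cases "y = u")
      case False
      obtain p q where pq: "leg \<sigma> D u p" "leg \<sigma> D y q" "set p \<inter> set q = {}" "set p \<subseteq> D" "set q \<subseteq> D"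
        using old[OF uv(1) y] False by blast
      have "leg \<sigma>' D' y q" using leg_mono[OF pq(2) DD' agree] .
      moreover have "set (w # rev e1 @ p) \<inter> set q = {}" using pq sp dis by auto
      ultimately show ?thesis using backward[OF sp pq(1)] unfolding fan_def by blast
    next
      case True
      obtain p q where pq: "leg \<sigma> D v p" "leg \<sigma> D y q" "set p \<inter> set q = {}" "set p \<subseteq> D" "set q \<subseteq> D"
        using old[OF uv(2) y] True uv by blast
      have "leg \<sigma>' D' y q" using leg_mono[OF pq(2) DD' agree] .
      moreover have "set (w # e2 @ p) \<inter> set q = {}" using pq sp dis by auto
      ultimately show ?thesis using forward[OF sp pq(1)] unfolding fan_def by blast
    qed
  qed
  have ordered: "fan \<sigma>' D' x y" if sp: "e = e1 @ x # e2 @ y # e3" for x y e1 e2 e3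
  proof -
    obtain p q where pq: "leg \<sigma> D u p" "leg \<sigma> D v q" "set p \<inter> set q = {}" "set p \<subseteq> D" "set q \<subseteq> D"
      using old[OF uv] by blast
    have "distinct e" using pe by (simp add: path_def)
    then have "set (x # rev e1 @ p) \<inter> set (y # e3 @ q) = {}" using pq sp dis by auto
    moreover have "leg \<sigma>' D' y (y # e3 @ q)" using forward[of "e1 @ x # e2" y e3 q] sp pq by simp
    ultimately show ?thesis using backward[of e1 x "e2 @ y # e3" p] sp pq(1) unfolding fan_def by blast
  qed
  have "fan \<sigma>' D' x y" if xy: "x \<in> D'" "y \<in> D'" "x \<noteq> y" for x y
  proof -
    consider "x \<in> D" "y \<in> D" | "x \<in> set e" "y \<in> D" | "x \<in> D" "y \<in> set e" | "x \<in> set e" "y \<in> set e"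
      using xy by (auto simp: D'_def)
    then show ?thesis
    proof cases
      case 1
      then show ?thesis using old[OF 1 xy(3)] leg_mono[where \<sigma> = \<sigma> and \<sigma>' = \<sigma>', OF _ DD' agree] unfolding fan_def by blast
    next
      case 2 then show ?thesis using mixed by blast
    next
      case 3 then show ?thesis using mixed fan_sym by blast
    next
      case 4
      then show ?thesis using split_list_two[OF 4 xy(3)] ordered fan_sym by blast
    qed
  qed
  moreover have "C \<subseteq> D'" "D' \<subseteq> V" "\<forall>c\<in>C. \<sigma>' c = \<sigma>0 c"
    using CD DV e(2) agree D by (auto simp: D'_def fanned_def)
  ultimately have "fanned \<sigma>' D'" unfolding fanned_def by blast
  then show ?thesis unfolding D'_def by blast
qed

lemma fanned_maximal:
  obtains \<sigma> D where "fanned \<sigma> D"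
    "\<And>u v. u \<in> D \<Longrightarrow> v \<in> D \<Longrightarrow> adj u v \<Longrightarrow> \<sigma> u \<noteq> \<sigma> v"
    "\<And>u v e. u \<in> D \<Longrightarrow> v \<in> D \<Longrightarrow> path e \<Longrightarrow> e \<noteq> [] \<Longrightarrow> set e \<subseteq> V - D \<Longrightarrow> adj u (hd e) \<Longrightarrow> adj (last e) v \<Longrightarrow> u = v"
proof -
  define \<D> where "\<D> = {D. \<exists>\<sigma>. fanned \<sigma> D}"
  have "\<D> \<subseteq> Pow V" by (auto simp: \<D>_def fanned_def)
  then have "finite \<D>" using finV by (meson finite_Pow_iff finite_subset)
  moreover have "C \<in> \<D>" using fanned_C by (auto simp: \<D>_def)
  ultimately obtain D where D: "D \<in> \<D>" "\<And>D'. D' \<in> \<D> \<Longrightarrow> D \<subseteq> D' \<Longrightarrow> D' = D"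
    using finite_has_maximal2[of \<D> C] by metis
  then obtain \<sigma> where s: "fanned \<sigma> D" by (auto simp: \<D>_def)
  show thesis
  proof (rule that[OF s])
    fix u v assume uv: "u \<in> D" "v \<in> D" "adj u v"
    then have "u \<noteq> v" using adjD by blast
    then show "\<sigma> u \<noteq> \<sigma> v"
      using fanned_parity[OF s uv(1,2), of "[]"] uv(3) by (simp add: path_Cons)
  next
    fix u v e assume uv: "u \<in> D" "v \<in> D" and e: "path e" "e \<noteq> []" "set e \<subseteq> V - D" "adj u (hd e)" "adj (last e) v"
    show "u = v"
    proof (rule ccontr)
      assume "u \<noteq> v"
      have "path (u # e @ [v])"
        using uv e \<open>u \<noteq> v\<close> by (auto simp: path_Cons path_append)
      from fanned_extend[OF s uv \<open>u \<noteq> v\<close> e(2,3) this] have "D \<union> set e \<in> \<D>" by (auto simp: \<D>_def)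
      from D(2)[OF this] have "set e \<subseteq> D" by auto
      then show False using e(2,3) by (cases e) auto
    qed
  qed
qed

lemma rtrancl_path:
  assumes "(a, b) \<in> {(x, y). x \<in> S \<and> y \<in> S \<and> adj x y}\<^sup>*" "a \<in> S"
  shows "\<exists>p. path p \<and> p \<noteq> [] \<and> hd p = a \<and> last p = b \<and> set p \<subseteq> S"
  using assms
proof (induction rule: rtrancl_induct)
  case base
  then show ?case by (intro exI[of _ "[a]"]) auto
next
  case (step y z)
  then obtain p where p: "path p" "p \<noteq> []" "hd p = a" "last p = y" "set p \<subseteq> S" by blast
  show ?case
  proof (cases "z \<in> set p")
    case True
    then obtain p1 p2 where sp: "p = p1 @ z # p2" using split_list by metis
    have "path (p1 @ [z])" using p(1) sp by (auto simp: path_append path_Cons)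
    moreover have "hd (p1 @ [z]) = a" using p(3) sp by (cases p1) auto
    ultimately show ?thesis using p sp by (intro exI[of _ "p1 @ [z]"]) auto
  next
    case False
    then have "path (p @ [z])" using p step by (auto simp: path_append)
    then show ?thesis using p step by (intro exI[of _ "p @ [z]"]) auto
  qed
qed

text \<open>The bipartite part is a maximal \<open>D\<close>. No ear joins two vertices of
  \<open>D\<close>, so each component of the rest touches \<open>D\<close> in at most one vertex;
  the suspended graphs collect the components by this vertex, one graph for each vertex of
  \<open>D\<close>.\<close>

theorem in_family:
  assumes "card V = n" "card (V - C) + 2 \<le> r"
  shows "in_family_G n r V E"
proof -
  obtain \<sigma> D where D: "fanned \<sigma> D"
    and proper: "\<And>u v. u \<in> D \<Longrightarrow> v \<in> D \<Longrightarrow> adj u v \<Longrightarrow> \<sigma> u \<noteq> \<sigma> v"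
    and ear: "\<And>u v e. u \<in> D \<Longrightarrow> v \<in> D \<Longrightarrow> path e \<Longrightarrow> e \<noteq> [] \<Longrightarrow> set e \<subseteq> V - D \<Longrightarrow> adj u (hd e) \<Longrightarrow> adj (last e) v \<Longrightarrow> u = v"
    using fanned_maximal by blast
  have CD: "C \<subseteq> D" "D \<subseteq> V" using D by (auto simp: fanned_def)
  have finD: "finite D" using CD finV finite_subset by blast
  define R where "R = {(x, y). x \<in> V - D \<and> y \<in> V - D \<and> adj x y}"
  define att where "att w d \<longleftrightarrow> d \<in> D \<and> (\<exists>w'. (w, w') \<in> R\<^sup>* \<and> w' \<in> V - D \<and> adj w' d)" for w d
  have "sym R" by (auto simp: R_def sym_def insert_commute)
  then have Rs: "sym (R\<^sup>*)" by (rule sym_rtrancl)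
  have att_unique: "d1 = d2" if "w \<in> V - D" and a1: "att w d1" and a2: "att w d2" for w d1 d2
  proof -
    obtain w1 where w1: "(w, w1) \<in> R\<^sup>*" "w1 \<in> V - D" "adj w1 d1" "d1 \<in> D" using a1 by (auto simp: att_def)
    obtain w2 where w2: "(w, w2) \<in> R\<^sup>*" "w2 \<in> V - D" "adj w2 d2" "d2 \<in> D" using a2 by (auto simp: att_def)
    have "(w1, w2) \<in> R\<^sup>*" using w1(1) w2(1) Rs by (meson rtrancl_trans symD)
    from rtrancl_path[OF this[unfolded R_def] w1(2)]
    obtain p where "path p" "p \<noteq> []" "hd p = w1" "last p = w2" "set p \<subseteq> V - D" by blast
    then show ?thesis using ear[of d1 d2 p] w1 w2 by (simp add: insert_commute)
  qed
  have att_cong: "att w d \<longleftrightarrow> att w' d" if "(w, w') \<in> R" for w w' d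
    using that \<open>sym R\<close> unfolding att_def by (meson converse_rtrancl_into_rtrancl symD)
  obtain ds where ds: "set ds = D" "distinct ds" using finite_distinct_list[OF finD] by blast
  have "ds \<noteq> []" using ds Cne CD by auto
  then have s0: "length ds > 0" by simp
  \<comment> \<open>Components without any edge to \<open>D\<close> go to index 0, since every
    suspended graph has to meet the bipartite part in exactly one vertex.\<close>
  define H where "H i = {w \<in> V - D. att w (ds ! i) \<or> (i = 0 \<and> (\<nexists>d. att w d))}" for i
  define Vs where "Vs i = insert (ds ! i) (H i)" for i
  define Es where "Es i = {e \<in> E. e \<subseteq> Vs i}" for i
  define EB where "EB = {e \<in> E. e \<subseteq> D}"
  have HD: "H i \<subseteq> V - D" for i by (auto simp: H_def)
  have dsD: "ds ! i \<in> D" if "i < length ds" for i using ds that by auto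
  have cover: "\<exists>i<length ds. w \<in> H i \<and> (\<forall>d. att w d \<longrightarrow> d = ds ! i)" if "w \<in> V - D" for w
  proof (cases "\<exists>d. att w d")
    case True
    then obtain d where d: "att w d" by blast
    then obtain i where i: "i < length ds" "ds ! i = d" using ds(1) by (auto simp: att_def in_set_conv_nth)
    then show ?thesis using d att_unique[OF that] that by (auto simp: H_def intro!: exI[of _ i])
  next
    case False
    then show ?thesis using that s0 by (auto simp: H_def intro!: exI[of _ 0])
  qed
  have "bipartite D EB"
    unfolding bipartite_def
  proof (intro exI[of _ "{v \<in> D. \<sigma> v}"] conjI ballI)
    fix e assume e: "e \<in> EB"
    then obtain u v where uv: "e = {u, v}" "u \<noteq> v" using edge_cases[of e] unfolding EB_def by blast
    then have "\<sigma> u \<noteq> \<sigma> v" "u \<in> D" "v \<in> D" using proper e by (auto simp: EB_def)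
    then have "e \<inter> {v \<in> D. \<sigma> v} = (if \<sigma> u then {u} else {v})" using uv by auto
    then show "card (e \<inter> {v \<in> D. \<sigma> v}) = 1" by simp
  qed auto
  moreover have "simple_graph D EB"
    using simple finD by (auto simp: simple_graph_def EB_def)
  moreover have "simple_graph (Vs i) (Es i) \<and> (\<exists>w. Vs i \<inter> D = {w})" if "i < length ds" for i
  proof
    have "finite (Vs i)" using HD[of i] finV by (auto simp: Vs_def intro: finite_subset)
    then show "simple_graph (Vs i) (Es i)" using simple by (auto simp: simple_graph_def Es_def)
    show "\<exists>w. Vs i \<inter> D = {w}" using dsD[OF that] HD[of i] by (intro exI[of _ "ds ! i"]) (auto simp: Vs_def)
  qed
  moreover have "V = D \<union> (\<Union>i<length ds. Vs i)"
  proof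
    show "V \<subseteq> D \<union> (\<Union>i<length ds. Vs i)" using cover by (fastforce simp: Vs_def)
    show "D \<union> (\<Union>i<length ds. Vs i) \<subseteq> V" using CD dsD HD by (fastforce simp: Vs_def)
  qed
  moreover have "E = EB \<union> (\<Union>i<length ds. Es i)"
  proof
    show "EB \<union> (\<Union>i<length ds. Es i) \<subseteq> E" by (auto simp: EB_def Es_def)
    have outer: "\<exists>i<length ds. {w, x} \<subseteq> Vs i" if w: "w \<in> V - D" "adj w x" for w x
    proof -
      obtain i where i: "i < length ds" "w \<in> H i" "\<And>d. att w d \<Longrightarrow> d = ds ! i" using cover[OF w(1)] by blast
      have "x \<in> Vs i"
      proof (cases "x \<in> D")
        case True
        then have "att w x" using w by (auto simp: att_def)
        then show ?thesis using i by (simp add: Vs_def)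
      next
        case False
        then have "(w, x) \<in> R" "x \<in> V - D" using w adjD by (auto simp: R_def)
        then have "x \<in> H i" using i(2) att_cong[of w x] by (auto simp: H_def)
        then show ?thesis by (simp add: Vs_def)
      qed
      then show ?thesis using i by (auto simp: Vs_def)
    qed
    show "E \<subseteq> EB \<union> (\<Union>i<length ds. Es i)"
    proof
      fix e assume e: "e \<in> E"
      then obtain u v where uv: "e = {u, v}" "u \<in> V" "v \<in> V" using edge_cases by metis
      show "e \<in> EB \<union> (\<Union>i<length ds. Es i)"
      proof (cases "u \<in> D \<and> v \<in> D")
        case True then show ?thesis using e uv by (auto simp: EB_def)
      next
        case False
        then have "\<exists>i<length ds. e \<subseteq> Vs i"
          using outer[of u v] outer[of v u] uv e by (auto simp: insert_commute)
        then show ?thesis using e by (auto simp: Es_def)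
      qed
    qed
  qed
  moreover have "(\<Sum>i<length ds. card (Vs i - D)) + 2 \<le> r"
  proof -
    have "Vs i - D = H i" if "i < length ds" for i using dsD[OF that] HD[of i] by (auto simp: Vs_def)
    then have "(\<Sum>i<length ds. card (Vs i - D)) = (\<Sum>i<length ds. card (H i))" by simp
    also have "\<dots> = card (\<Union>i<length ds. H i)"
    proof (rule card_UN_disjoint[symmetric])
      show "\<forall>i\<in>{..<length ds}. finite (H i)" using HD finV by (meson finite_Diff finite_subset)
      show "\<forall>i\<in>{..<length ds}. \<forall>j\<in>{..<length ds}. i \<noteq> j \<longrightarrow> H i \<inter> H j = {}"
      proof (intro ballI impI)
        fix i j assume ij: "i \<in> {..<length ds}" "j \<in> {..<length ds}" "i \<noteq> j"
        then have "ds ! i \<noteq> ds ! j" using ds(2) by (simp add: nth_eq_iff_index_eq)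
        then show "H i \<inter> H j = {}" using att_unique ij(3) unfolding H_def by blast
      qed
    qed simp
    also have "\<dots> \<le> card (V - C)"
    proof (rule card_mono)
      show "finite (V - C)" using finV by simp
      show "(\<Union>i<length ds. H i) \<subseteq> V - C" using HD CD by blast
    qed
    finally show ?thesis using assms(2) by simp
  qed
  ultimately show ?thesis
    unfolding in_family_G_def using assms(1) by blast
qed

end

section \<open>Spectral and counting estimates\<close>

context fin_graph
begin

lemma sum_adjm: "w \<in> V \<Longrightarrow> S \<subseteq> V \<Longrightarrow> (\<Sum>u\<in>S. adjm E w u * x u) = (\<Sum>u\<in>nb w S. x u)"
  unfolding nb_def using finV
  by (subst sum.inter_filter) (auto intro!: sum.cong intro: finite_subset)

lemma sum_card_nb_swap:
  assumes "finite A" "finite B"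
  shows "(\<Sum>a\<in>A. \<Sum>b\<in>nb a B. f a b) = (\<Sum>b\<in>B. \<Sum>a\<in>nb b A. f a b :: real)"
  unfolding nb_def using sum.swap_restrict[OF assms, of f "\<lambda>a b. adj a b"]
  by (simp add: insert_commute)

lemma card_nb_swap:
  assumes "finite A" "finite B"
  shows "(\<Sum>a\<in>A. real (card (nb a B))) = (\<Sum>b\<in>B. real (card (nb b A)))"
  using sum_card_nb_swap[OF assms, of "\<lambda>a b. 1"] by simp

text \<open>The square of the spectral radius of a bipartite graph is at most the number of its edges.\<close>
lemma bipartite_plus_rest:
  fixes \<mu> :: real
  assumes AB: "A \<inter> B = {}" "A \<subseteq> V" "B \<subseteq> V"
    and indep: "\<And>u v. u \<in> A \<Longrightarrow> v \<in> A \<Longrightarrow> \<not> adj u v" "\<And>u v. u \<in> B \<Longrightarrow> v \<in> B \<Longrightarrow> \<not> adj u v"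
    and nn: "\<And>v. x v \<ge> 0" and l0: "\<mu> \<ge> 0"
    and eig: "\<And>v. v \<in> V \<Longrightarrow> (\<Sum>u\<in>nb v V. x u) = \<mu> * x v"
  shows "(\<mu>\<^sup>2 - (\<Sum>a\<in>A. real (card (nb a B)))) * sqnorm (A \<union> B) x \<le> 2 * (\<Sum>w\<in>V-(A\<union>B). (\<mu> * x w)\<^sup>2)"
proof -
  define C where "C = A \<union> B"
  define T where "T = V - C"
  define e where "e = (\<Sum>a\<in>A. real (card (nb a B)))"
  define F where "F S S' = (\<Sum>u\<in>S. \<Sum>v\<in>nb u S'. x u * x v)" for S S'
  have fin: "finite A" "finite B" "finite C" "finite T"
    using AB finV by (auto simp: C_def T_def intro: finite_subset)
  have F_eig: "F S V = \<mu> * sqnorm S x" if "S \<subseteq> V" for S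
  proof -
    have "F S V = (\<Sum>u\<in>S. x u * (\<Sum>v\<in>nb u V. x v))" by (simp add: F_def sum_distrib_left)
    also have "\<dots> = (\<Sum>u\<in>S. x u * (\<mu> * x u))" using eig that by (intro sum.cong) auto
    finally show ?thesis by (simp add: sqnorm_def sum_distrib_left power2_eq_square mult_ac)
  qed
  have F_split: "F S (S1 \<union> S2) = F S S1 + F S S2" if "S1 \<inter> S2 = {}" for S S1 S2
  proof -
    have "(\<Sum>v\<in>nb u (S1 \<union> S2). x u * x v) = (\<Sum>v\<in>nb u S1. x u * x v) + (\<Sum>v\<in>nb u S2. x u * x v)" for u
      unfolding nb_Un
    proof (rule sum.union_disjoint)
      show "nb u S1 \<inter> nb u S2 = {}" using that by (auto simp: nb_def)
    qed auto
    then show ?thesis by (simp add: F_def sum.distrib)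
  qed
  have F_swap: "F S S' = F S' S" if "finite S" "finite S'" for S S'
    unfolding F_def using sum_card_nb_swap[OF that, of "\<lambda>a b. x a * x b"] by (simp add: mult.commute)
  have F_nn: "F S S' \<ge> 0" for S S' unfolding F_def using nn by (intro sum_nonneg) auto
  have CT: "C \<union> T = V" "C \<inter> T = {}" "C \<subseteq> V" "T \<subseteq> V" using AB by (auto simp: C_def T_def)
  have "F C V = F C C + F C T" using F_split[of C T C] CT by simp
  moreover have "F T V = F T C + F T T" using F_split[of C T T] CT by simp
  \<comment> \<open>Symmetry moves the mixed terms into the rows of \<open>T\<close>:
    \<open>F C T = F T C \<le> F T V\<close>, and the last term is
    \<open>\<mu> * sqnorm T x\<close>.\<close>
  ultimately have low: "F C C \<ge> \<mu> * sqnorm C x - \<mu> * sqnorm T x"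
    using F_swap[of C T] fin F_nn[of T T] F_eig CT by simp
  have "F S S = 0" if ind: "\<And>u v. u \<in> S \<Longrightarrow> v \<in> S \<Longrightarrow> \<not> adj u v" for S
  proof -
    have "nb u S = {}" if "u \<in> S" for u using ind that by (auto simp: nb_def)
    then show ?thesis by (simp add: F_def)
  qed
  then have zero: "F A A = 0" "F B B = 0" using indep by blast+
  have "F C C = F A C + F B C"
    unfolding F_def C_def using AB fin by (intro sum.union_disjoint) auto
  then have FCC: "F C C = 2 * F A B"
    using F_split[OF AB(1), of A] F_split[OF AB(1), of B] F_swap[OF fin(1,2)] zero by (simp add: C_def)
  have FAB: "F A B = (\<Sum>p\<in>Sigma A (\<lambda>a. nb a B). 1 * (x (fst p) * x (snd p)))"
    unfolding F_def using fin by (subst sum.Sigma) (auto simp: split_def)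
  have "(F A B)\<^sup>2 \<le> (\<Sum>p\<in>Sigma A (\<lambda>a. nb a B). 1\<^sup>2) * (\<Sum>p\<in>Sigma A (\<lambda>a. nb a B). (x (fst p) * x (snd p))\<^sup>2)"
    unfolding FAB by (rule Cauchy_Schwarz_ineq_sum)
  also have "(\<Sum>p\<in>Sigma A (\<lambda>a. nb a B). 1\<^sup>2) = e" using fin by (simp add: e_def)
  also have "(\<Sum>p\<in>Sigma A (\<lambda>a. nb a B). (x (fst p) * x (snd p))\<^sup>2) \<le> (\<Sum>p\<in>A \<times> B. (x (fst p) * x (snd p))\<^sup>2)"
    using fin nb_subset(1) by (intro sum_mono2) auto
  also have "\<dots> = sqnorm A x * sqnorm B x"
    unfolding sqnorm_def sum_product by (subst sum.cartesian_product) (simp add: split_def power_mult_distrib)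
  finally have cs: "(F A B)\<^sup>2 \<le> e * (sqnorm A x * sqnorm B x)" by (simp add: e_def sum_nonneg mult_left_mono)
  have e0: "e \<ge> 0" by (simp add: e_def sum_nonneg)
  have nC: "sqnorm C x = sqnorm A x + sqnorm B x"
    unfolding sqnorm_def C_def using fin AB by (intro sum.union_disjoint) auto
  have "(2 * F A B)\<^sup>2 \<le> (sqrt e * sqnorm C x)\<^sup>2"
  proof -
    have "4 * (sqnorm A x * sqnorm B x) \<le> (sqnorm C x)\<^sup>2"
      unfolding nC using sum_squares_bound[of "sqnorm A x" "sqnorm B x"] by (simp add: power2_sum)
    then have "e * (4 * (sqnorm A x * sqnorm B x)) \<le> e * (sqnorm C x)\<^sup>2"
      using e0 by (rule mult_left_mono)
    then show ?thesis using cs e0 by (simp add: power_mult_distrib)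
  qed
  then have "2 * F A B \<le> sqrt e * sqnorm C x"
    by (rule power2_le_imp_le) (use e0 in simp)
  then have key: "(\<mu> - sqrt e) * sqnorm C x \<le> \<mu> * sqnorm T x"
    using low FCC by (simp add: algebra_simps)
  have rhs: "2 * \<mu>\<^sup>2 * sqnorm T x = 2 * (\<Sum>w\<in>T. (\<mu> * x w)\<^sup>2)"
    by (simp add: sqnorm_def sum_distrib_left power_mult_distrib mult.assoc)
  have "(\<mu>\<^sup>2 - e) * sqnorm C x \<le> 2 * \<mu>\<^sup>2 * sqnorm T x"
  proof (cases "\<mu> \<le> sqrt e")
    case True
    then have "\<mu>\<^sup>2 \<le> e" using l0 e0 by (metis power_mono real_sqrt_pow2)
    then have "(\<mu>\<^sup>2 - e) * sqnorm C x \<le> 0" by (simp add: mult_nonpos_nonneg)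
    also have "0 \<le> 2 * \<mu>\<^sup>2 * sqnorm T x" by simp
    finally show ?thesis .
  next
    case False
    have "(\<mu>\<^sup>2 - e) * sqnorm C x = (\<mu> + sqrt e) * ((\<mu> - sqrt e) * sqnorm C x)"
      using e0 by (simp add: algebra_simps power2_eq_square)
    also have "\<dots> \<le> (\<mu> + sqrt e) * (\<mu> * sqnorm T x)"
      using key l0 e0 by (intro mult_left_mono) auto
    also have "\<dots> \<le> (2 * \<mu>) * (\<mu> * sqnorm T x)"
      using False l0 by (intro mult_right_mono) auto
    finally show ?thesis by (simp add: power2_eq_square mult_ac)
  qed
  then show ?thesis using rhs unfolding e_def C_def T_def by simp
qed

lemma entries_bound:
  fixes \<mu> D :: real
  assumes T: "T \<subseteq> V" and D: "\<And>w. w \<in> T \<Longrightarrow> real (card (nb w (V - T))) \<le> D"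
    and nn: "\<And>v. x v \<ge> 0" and le1: "\<And>v. v \<in> V \<Longrightarrow> x v \<le> 1"
    and eig: "\<And>v. v \<in> V \<Longrightarrow> (\<Sum>u\<in>nb v V. x u) = \<mu> * x v"
    and l: "\<mu> > card T" and w: "w \<in> T"
  shows "x w \<le> D / (\<mu> - card T)"
proof -
  have finT: "finite T" using T finV finite_subset by blast
  obtain m where m: "m \<in> T" "\<And>u. u \<in> T \<Longrightarrow> x u \<le> x m"
  proof -
    have "Max (x ` T) \<in> x ` T" using finT w by (intro Max_in) auto
    then obtain m where "m \<in> T" "x m = Max (x ` T)" by auto
    then show ?thesis using that finT by simp
  qed
  have "\<mu> * x m = (\<Sum>u\<in>nb m V. x u)" using eig m T by auto
  also have "nb m V = nb m (V - T) \<union> nb m T" using T by (auto simp: nb_def)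
  also have "(\<Sum>u\<in>nb m (V - T) \<union> nb m T. x u) = (\<Sum>u\<in>nb m (V - T). x u) + (\<Sum>u\<in>nb m T. x u)"
  proof (rule sum.union_disjoint)
    show "nb m (V - T) \<inter> nb m T = {}" by (auto simp: nb_def)
  qed auto
  also have "(\<Sum>u\<in>nb m (V - T). x u) \<le> (\<Sum>u\<in>nb m (V - T). 1)" using le1 by (intro sum_mono) (auto simp: nb_def)
  also have "\<dots> \<le> D" using D m(1) by simp
  also have "(\<Sum>u\<in>nb m T. x u) \<le> (\<Sum>u\<in>nb m T. x m)" using m by (intro sum_mono) (auto simp: nb_def)
  also have "\<dots> = card (nb m T) * x m" by simp
  also have "\<dots> \<le> card T * x m" using nn finT by (intro mult_right_mono) (auto simp: nb_def intro!: card_mono)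
  finally have "(\<mu> - card T) * x m \<le> D" by (simp add: algebra_simps)
  then have "x m \<le> D / (\<mu> - card T)" using l by (simp add: field_simps)
  then show ?thesis using m(2)[OF w] by linarith
qed

section \<open>Edges of a graph without long paths, and exceptional vertices\<close>

lemma long_path_exists:
  assumes "S \<noteq> {}" "\<And>u. u \<in> S \<Longrightarrow> D < card (nb u S)"
  shows "j \<le> D + 1 \<Longrightarrow> \<exists>p. path p \<and> length p = Suc j \<and> set p \<subseteq> S"
proof (induction j)
  case 0
  obtain u where "u \<in> S" using assms by blast
  then show ?case by (intro exI[of _ "[u]"]) auto
next
  case (Suc j)
  then obtain p where p: "path p" "length p = Suc j" "set p \<subseteq> S" by auto
  then obtain h q where h: "p = h # q" by (cases p) auto
  have "card (set q) \<le> D" using card_length[of q] p h Suc.prems by simp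
  then have "card (set q) < card (nb h S)" using assms(2)[of h] p h by simp
  from ex_not_in_smaller[OF _ this] obtain w where w: "w \<in> S" "adj h w" "w \<notin> set q" by (auto simp: nb_def)
  have "w \<noteq> h" using adjD w by blast
  then have "path (w # p)" using w p h by (auto simp: path_Cons insert_commute)
  then show ?case using p w by (intro exI[of _ "w # p"]) auto
qed

text \<open>Induction by deleting a vertex of degree at most \<open>D\<close>, which exists since
  larger minimum degree gives a greedy path. The bound is twice that of Erdos and Gallai, a loss
  absorbed by the constant 712.\<close>

lemma edges_without_long_path:
  assumes "finite S" "\<And>p. path p \<Longrightarrow> set p \<subseteq> S \<Longrightarrow> length p \<noteq> D + 2"
  shows "(\<Sum>u\<in>S. card (nb u S)) \<le> 2 * D * card S"
  using assms
proof (induction "card S" arbitrary: S)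
  case 0
  then show ?case by simp
next
  case (Suc c)
  have "\<exists>u\<in>S. card (nb u S) \<le> D"
  proof (rule ccontr)
    assume "\<not> ?thesis"
    then have "\<And>u. u \<in> S \<Longrightarrow> D < card (nb u S)" by (simp add: not_le)
    moreover have "S \<noteq> {}" using Suc.hyps(2) by auto
    ultimately obtain p where "path p" "length p = Suc (D + 1)" "set p \<subseteq> S"
      using long_path_exists[of S D "D + 1"] by blast
    then show False using Suc.prems(2)[of p] by simp
  qed
  then obtain u where u: "u \<in> S" "card (nb u S) \<le> D" by blast
  have IH: "(\<Sum>v\<in>S-{u}. card (nb v (S - {u}))) \<le> 2 * D * card (S - {u})"
  proof (rule Suc.hyps(1))
    show "c = card (S - {u})" using Suc.hyps(2) Suc.prems(1) u(1) by simp
    show "length p \<noteq> D + 2" if "path p" "set p \<subseteq> S - {u}" for p using Suc.prems(2) that by blast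
  qed (use Suc.prems in auto)
  have step: "card (nb v S) = card (nb v (S - {u})) + (if adj u v then 1 else 0)" for v
  proof -
    have "nb v S = nb v (S - {u}) \<union> (if adj u v then {u} else {})" using u(1) by (auto simp: nb_def insert_commute)
    moreover have "u \<notin> nb v (S - {u})" by (simp add: nb_def)
    ultimately show ?thesis by simp
  qed
  have "(\<Sum>v\<in>S. card (nb v S)) = card (nb u S) + (\<Sum>v\<in>S-{u}. card (nb v S))"
    using u(1) Suc.prems(1) by (rule sum.remove[rotated])
  also have "(\<Sum>v\<in>S-{u}. card (nb v S)) = (\<Sum>v\<in>S-{u}. card (nb v (S - {u}))) + (\<Sum>v\<in>S-{u}. if adj u v then 1 else 0)"
    by (subst sum.distrib[symmetric], intro sum.cong refl step)
  also have "(\<Sum>v\<in>S-{u}. if adj u v then 1 else 0) = card {v \<in> S - {u}. adj u v}"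
    using Suc.prems(1) by (subst sum.inter_filter[symmetric]) auto
  also have "{v \<in> S - {u}. adj u v} = nb u S" using adjD by (auto simp: nb_def)
  finally have "(\<Sum>v\<in>S. card (nb v S)) \<le> 2 * D + 2 * D * card (S - {u})" using IH u(2) by linarith
  also have "\<dots> = 2 * D * card S" using u(1) Suc.prems(1) Suc.hyps(2) by (simp add: algebra_simps flip: Suc.hyps(2))
  finally show ?case .
qed

lemma card_few_bad:
  fixes c :: real
  assumes "finite A" "c > 0" "\<And>a. f a \<ge> 0" "(\<Sum>a\<in>A. f a) \<le> s"
  shows "c * card {a \<in> A. f a > c} \<le> s"
proof -
  have "c * card {a \<in> A. f a > c} = (\<Sum>a\<in>{a \<in> A. f a > c}. c)" by simp
  also have "\<dots> \<le> (\<Sum>a\<in>{a \<in> A. f a > c}. f a)" by (intro sum_mono) auto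
  also have "\<dots> \<le> (\<Sum>a\<in>A. f a)" using assms by (intro sum_mono2) auto
  finally show ?thesis using assms(4) by simp
qed

lemma card_common_nb:
  fixes c :: real
  assumes "finite B" "real (card (B - nb u B)) \<le> c" "real (card (B - nb w B)) \<le> c"
  shows "card (nb u B \<inter> nb w B) \<ge> card B - 2 * c"
proof -
  have "card B \<le> card ((nb u B \<inter> nb w B) \<union> ((B - nb u B) \<union> (B - nb w B)))"
    using assms(1) by (intro card_mono) auto
  also have "\<dots> \<le> card (nb u B \<inter> nb w B) + (card (B - nb u B) + card (B - nb w B))"
    by (meson card_Un_le add_left_mono order_trans)
  finally show ?thesis using assms by linarith
qed

end

section \<open>The dense core\<close>

text \<open>\<open>mu_low\<close> is the only lower bound on \<open>\<mu>\<close> used in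
  constructing the core. It follows from \<open>(n - r) / 2 \<le> \<mu>\<close> and
  \<open>r \<le> 2 * k\<close>; sharper bounds on \<open>\<mu>\<^sup>2\<close> enter later as
  separate hypotheses.\<close>

locale spectral_graph = odd_cycle_free +
  fixes x :: "'a \<Rightarrow> real" and \<mu> :: real and v0 :: 'a
  assumes nn: "\<And>v. x v \<ge> 0" and le1: "\<And>v. v \<in> V \<Longrightarrow> x v \<le> 1" and v0: "v0 \<in> V" "x v0 = 1"
    and eig: "\<And>v. v \<in> V \<Longrightarrow> (\<Sum>u\<in>nb v V. x u) = \<mu> * x v"
    and large: "card V \<ge> 712 * k" and mu_low: "\<mu> \<ge> real (card V) / 2 - real k"
begin

abbreviation N :: real where "N \<equiv> real (card V)"
abbreviation \<kappa> :: real where "\<kappa> \<equiv> real k"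

definition NA :: "'a set" where "NA = nb v0 V"
definition NB :: "'a set" where "NB = V - NA"
abbreviation d :: real where "d \<equiv> real (card NA)"

lemma kN: "712 * \<kappa> \<le> N" "\<kappa> \<ge> 2"
  using large k2 by (simp_all flip: of_nat_mult)

text \<open>1/2 - 1/712 = 0.498595..., rounded down.\<close>

lemma muN: "\<mu> \<ge> (49859 / 100000) * N"
  using kN mu_low by linarith

section \<open>Size and density of the pair \<open>NA\<close>, \<open>NB\<close>\<close>

lemma subAB: "NA \<subseteq> V" "NB \<subseteq> V"
  using nb_subset(2) by (auto simp: NA_def NB_def)

lemma finAB [simp]: "finite NA" "finite NB"
  using subAB finV finite_subset by auto

lemma card_NB: "real (card NB) = N - d"
  using card_Diff_subset[of NA V] card_mono[of V NA] finV subAB by (simp add: NB_def)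

lemma edges_in_NA: "(\<Sum>u\<in>NA. real (card (nb u NA))) \<le> 4 * \<kappa> * d"
proof -
  have "(\<Sum>u\<in>NA. card (nb u NA)) \<le> 2 * (2 * k - 2) * card NA"
  proof (rule edges_without_long_path)
    fix p assume p: "path p" "set p \<subseteq> NA"
    show "length p \<noteq> 2 * k - 2 + 2"
    proof
      assume len: "length p = 2 * k - 2 + 2"
      then have ne: "p \<noteq> []" by auto
      have nbp: "adj v0 u" if "u \<in> set p" for u using that p(2) by (auto simp: NA_def nb_def)
      then have "v0 \<notin> set p" using adjD by blast
      then have "path (v0 # p)" using p(1) nbp ne by (auto simp: path_Cons)
      moreover have "set (v0 # p) \<subseteq> V" using p(2) v0 subAB(1) by auto
      moreover have "length (v0 # p) = 2 * k + 1" using len k2 by simp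
      moreover have "adj (last (v0 # p)) (hd (v0 # p))" using nbp[of "last p"] ne by (simp add: insert_commute)
      ultimately show False by (rule no_cycle_path)
    qed
  qed simp
  also have "\<dots> \<le> 4 * k * card NA" by simp
  finally have "real (\<Sum>u\<in>NA. card (nb u NA)) \<le> real (4 * k * card NA)" by (simp only: of_nat_le_iff)
  then show ?thesis by simp
qed

lemma sum_NA: "(\<Sum>u\<in>NA. x u) = \<mu>"
  using eig[OF v0(1)] v0(2) by (simp add: NA_def)

lemma mu_sq: "\<mu>\<^sup>2 = (\<Sum>u\<in>NA. \<Sum>w\<in>nb u NA. x w) + (\<Sum>u\<in>NA. \<Sum>w\<in>nb u NB. x w)"
proof -
  have "\<mu>\<^sup>2 = (\<Sum>u\<in>NA. \<mu> * x u)" by (simp add: sum_NA power2_eq_square flip: sum_distrib_left)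
  also have "\<dots> = (\<Sum>u\<in>NA. \<Sum>w\<in>nb u V. x w)" using eig subAB(1) by (intro sum.cong) auto
  also have "\<dots> = (\<Sum>u\<in>NA. (\<Sum>w\<in>nb u NA. x w) + (\<Sum>w\<in>nb u NB. x w))"
  proof (rule sum.cong[OF refl])
    fix u
    have "nb u V = nb u NA \<union> nb u NB" using subAB(1) by (auto simp: nb_def NB_def)
    moreover have "nb u NA \<inter> nb u NB = {}" by (auto simp: nb_def NB_def)
    ultimately show "(\<Sum>w\<in>nb u V. x w) = (\<Sum>w\<in>nb u NA. x w) + (\<Sum>w\<in>nb u NB. x w)"
      by (simp add: sum.union_disjoint)
  qed
  finally show ?thesis by (simp add: sum.distrib)
qed

lemma sum_inner_NA: "(\<Sum>u\<in>NA. \<Sum>w\<in>nb u NA. x w) \<le> 4 * \<kappa> * d"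
proof -
  have "(\<Sum>u\<in>NA. \<Sum>w\<in>nb u NA. x w) \<le> (\<Sum>u\<in>NA. \<Sum>w\<in>nb u NA. 1)"
    using le1 nb_subset(2) by (intro sum_mono) blast
  then show ?thesis using edges_in_NA by simp
qed

lemma cross_edges: "\<mu>\<^sup>2 - 4 * \<kappa> * d \<le> (\<Sum>u\<in>NA. real (card (nb u NB)))"
proof -
  have "(\<Sum>u\<in>NA. \<Sum>w\<in>nb u NB. x w) \<le> (\<Sum>u\<in>NA. \<Sum>w\<in>nb u NB. 1)"
    using le1 nb_subset(2) by (intro sum_mono) blast
  then show ?thesis using mu_sq sum_inner_NA by simp
qed

text \<open>The double sum of \<open>mu_sq\<close> is read from the side of \<open>NB\<close>, each
  entry being counted at most \<open>d\<close> times. This keeps the entries that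
  \<open>cross_edges\<close> estimates by 1, and shows in \<open>sqnorm_low\<close> that their sum
  over \<open>NB\<close> is large.\<close>

lemma mu_sq_sum_NB: "\<mu>\<^sup>2 - 4 * \<kappa> * d \<le> d * (\<Sum>w\<in>NB. x w)"
proof -
  have "(\<Sum>u\<in>NA. \<Sum>w\<in>nb u NB. x w) = (\<Sum>w\<in>NB. \<Sum>u\<in>nb w NA. x w)"
    by (rule sum_card_nb_swap) auto
  also have "\<dots> \<le> (\<Sum>w\<in>NB. d * x w)"
  proof (rule sum_mono)
    fix w
    have "card (nb w NA) \<le> card NA" by (intro card_mono) (auto simp: nb_def)
    then show "(\<Sum>u\<in>nb w NA. x w) \<le> d * x w" using nn by (simp add: mult_right_mono)
  qed
  finally show ?thesis using mu_sq sum_inner_NA by (simp add: sum_distrib_left)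
qed

lemma missing_NA: "(\<Sum>a\<in>NA. real (card (NB - nb a NB))) = d * (N - d) - (\<Sum>u\<in>NA. real (card (nb u NB)))"
proof -
  have "real (card (NB - nb a NB)) = (N - d) - real (card (nb a NB))" for a
    using card_Diff_subset[of "nb a NB" NB] card_mono[of NB "nb a NB"] nb_subset(1) card_NB by simp
  then show ?thesis by (simp add: sum_subtractf)
qed

lemma missing_NB: "(\<Sum>b\<in>NB. real (card (NA - nb b NA))) = d * (N - d) - (\<Sum>u\<in>NA. real (card (nb u NB)))"
proof -
  have "real (card (NA - nb b NA)) = d - real (card (nb b NA))" for b
    using card_Diff_subset[of "nb b NA" NA] card_mono[of NA "nb b NA"] nb_subset(1) by simp
  then show ?thesis using card_nb_swap[of NA NB] card_NB by (simp add: sum_subtractf mult.commute)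
qed

lemma mu_sq_low: "\<mu>\<^sup>2 \<ge> (24859 / 100000) * N\<^sup>2" "\<mu>\<^sup>2 \<ge> N\<^sup>2 / 4 - \<kappa> * N"
proof -
  have "((49859 / 100000) * N)\<^sup>2 \<le> \<mu>\<^sup>2" using muN by (intro power_mono) auto
  moreover have "(24859 / 100000) * N\<^sup>2 \<le> ((49859 / 100000) * N)\<^sup>2" by (simp add: power_mult_distrib power2_eq_square)
  ultimately show "\<mu>\<^sup>2 \<ge> (24859 / 100000) * N\<^sup>2" by linarith
  have "(N / 2 - \<kappa>)\<^sup>2 \<le> \<mu>\<^sup>2" using mu_low kN by (intro power_mono) auto
  moreover have "(N / 2 - \<kappa>)\<^sup>2 = N\<^sup>2 / 4 - \<kappa> * N + \<kappa>\<^sup>2" by (simp add: power2_eq_square field_simps)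
  moreover have "\<kappa>\<^sup>2 \<ge> 0" by simp
  ultimately show "\<mu>\<^sup>2 \<ge> N\<^sup>2 / 4 - \<kappa> * N" by linarith
qed

lemma kappa_N: "\<kappa> * N \<le> N\<^sup>2 / 712"
  using mult_right_mono[OF kN(1), of N] by (simp add: power2_eq_square)

text \<open>As the number of missing edges is nonnegative,
  \<open>\<mu>\<^sup>2 \<le> d * (N + 4 * \<kappa> - d)\<close>, a concave function of
  \<open>d\<close>. At 0.43 N and 0.57 N it is already below the lower bound on
  \<open>\<mu>\<^sup>2\<close>, and further out it is no larger.\<close>

lemma d_bounds: "(43 / 100) * N \<le> d" "d \<le> (57 / 100) * N"
proof -
  have "(\<Sum>u\<in>NA. real (card (NB - nb u NB))) \<ge> 0" by (intro sum_nonneg) simp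
  then have up: "\<mu>\<^sup>2 \<le> d * (N + 4 * \<kappa> - d)"
    using cross_edges missing_NA by (simp add: algebra_simps)
  have Npos: "N > 0" using kN by linarith
  have quad: "d * (N + 4 * \<kappa> - d) = c * N * (N + 4 * \<kappa> - c * N) + (d - c * N) * (N + 4 * \<kappa> - d - c * N)" for c
    by (simp add: algebra_simps)
  have c: "c * N * (N + 4 * \<kappa> - c * N) < (24859 / 100000) * N\<^sup>2" if "c = (43 / 100) \<or> c = (57 / 100)" for c :: real
  proof -
    have "c * N * (N + 4 * \<kappa> - c * N) = c * (1 - c) * N\<^sup>2 + 4 * c * (\<kappa> * N)"
      by (simp add: algebra_simps power2_eq_square)
    also have "\<dots> \<le> c * (1 - c) * N\<^sup>2 + 4 * c * (N\<^sup>2 / 712)"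
      using kappa_N that by (intro add_left_mono mult_left_mono) auto
    also have "\<dots> = (c * (1 - c) + 4 * c / 712) * N\<^sup>2" by (simp add: algebra_simps)
    also have "\<dots> < (24859 / 100000) * N\<^sup>2"     proof (rule mult_strict_right_mono)
      show "c * (1 - c) + 4 * c / 712 < (24859 / 100000)"
        using that by (elim disjE; hypsubst) simp_all
    qed (use Npos in simp)
    finally show ?thesis .
  qed
  show "(43 / 100) * N \<le> d"
  proof (rule ccontr)
    assume "\<not> ?thesis"
    then have "(d - (43 / 100) * N) * (N + 4 * \<kappa> - d - (43 / 100) * N) \<le> 0"
      using kN by (intro mult_nonpos_nonneg) auto
    then show False using quad[of "43 / 100"] c[of "43 / 100"] up mu_sq_low by linarith
  qed
  show "d \<le> (57 / 100) * N"
  proof (rule ccontr)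
    assume "\<not> ?thesis"
    then have "(d - (57 / 100) * N) * (N + 4 * \<kappa> - d - (57 / 100) * N) \<le> 0"
      using kN by (intro mult_nonneg_nonpos) auto
    then show False using quad[of "(57 / 100)"] c[of "(57 / 100)"] up mu_sq_low by linarith
  qed
qed

text \<open>The factor is 1 + 4 * 0.57: the defect of \<open>\<mu>\<^sup>2\<close> from
  \<open>N\<^sup>2 / 4\<close> costs \<open>\<kappa> * N\<close>, and the edges inside
  \<open>NA\<close> cost \<open>4 * \<kappa> * d\<close>.\<close>

lemma missing_bound: "d * (N - d) - (\<Sum>u\<in>NA. real (card (nb u NB))) \<le> (328 / 100) * \<kappa> * N"
proof -
  have "d * (N - d) = N\<^sup>2 / 4 - (d - N / 2)\<^sup>2" by (simp add: power2_eq_square field_simps)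
  then have "d * (N - d) \<le> N\<^sup>2 / 4" by simp
  moreover have "4 * \<kappa> * d \<le> 4 * \<kappa> * ((57 / 100) * N)" using d_bounds by (intro mult_left_mono) auto
  ultimately show ?thesis using cross_edges mu_sq_low(2) by simp
qed

text \<open>The entries sum to at least 0.49859 N on \<open>NA\<close>, by the eigenvalue equation
  at \<open>v0\<close>, and to at least 0.43 N on \<open>NB\<close>; Cauchy-Schwarz and 0.92859^2 >
  0.86 finish. A norm of order \<open>N\<close> is what makes the error terms in \<open>gain\<close>
  small.\<close>

lemma sqnorm_low: "sqnorm V x \<ge> (86 / 100) * N"
proof -
  have Npos: "N > 0" using kN by linarith
  have sB: "(\<Sum>w\<in>NB. x w) \<ge> (43 / 100) * N"
  proof -
    have "(57 / 100) * N * (\<Sum>w\<in>NB. x w) \<ge> d * (\<Sum>w\<in>NB. x w)"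
      using d_bounds nn by (intro mult_right_mono sum_nonneg) auto
    moreover have "4 * \<kappa> * d \<le> 4 * \<kappa> * ((57 / 100) * N)" using d_bounds by (intro mult_left_mono) auto
    ultimately have "(24859 / 100000) * N\<^sup>2 - (228 / 100) * (\<kappa> * N) \<le> (57 / 100) * N * (\<Sum>w\<in>NB. x w)"
      using mu_sq_sum_NB mu_sq_low by simp
    moreover have "(57 / 100) * N * ((43 / 100) * N) \<le> (24859 / 100000) * N\<^sup>2 - (228 / 100) * (N\<^sup>2 / 712)"
      by (simp add: power2_eq_square)
    ultimately have "(57 / 100) * N * ((43 / 100) * N) \<le> (57 / 100) * N * (\<Sum>w\<in>NB. x w)"
      using kappa_N by linarith
    then show ?thesis using Npos by simp
  qed
  have "(\<Sum>w\<in>V. x w) = (\<Sum>w\<in>NA. x w) + (\<Sum>w\<in>NB. x w)"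
  proof -
    have "V = NA \<union> NB" "NA \<inter> NB = {}" using subAB(1) by (auto simp: NB_def)
    then show ?thesis by (metis finAB(1,2) sum.union_disjoint)
  qed
  then have s: "(\<Sum>w\<in>V. x w) \<ge> (92859 / 100000) * N" using sum_NA muN sB by simp
  have "(\<Sum>w\<in>V. 1 * x w)\<^sup>2 \<le> (\<Sum>w\<in>V. 1\<^sup>2) * (\<Sum>w\<in>V. (x w)\<^sup>2)" by (rule Cauchy_Schwarz_ineq_sum)
  then have "(\<Sum>w\<in>V. x w)\<^sup>2 \<le> N * sqnorm V x" by (simp add: sqnorm_def)
  moreover have "((92859 / 100000) * N)\<^sup>2 \<le> (\<Sum>w\<in>V. x w)\<^sup>2" using s Npos by (intro power_mono) auto
  moreover have "N * ((86 / 100) * N) \<le> ((92859 / 100000) * N)\<^sup>2" by (simp add: power2_eq_square)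
  ultimately have "N * ((86 / 100) * N) \<le> N * sqnorm V x" by linarith
  then show ?thesis using Npos by simp
qed

text \<open>Two rounds: \<open>A00\<close> and \<open>B00\<close> discard the vertices with too many
  non-neighbours, then \<open>A0\<close> and \<open>B0\<close> take in every vertex of the graph
  that is dense towards them. After that a vertex outside both sides has more than 0.15 N
  non-neighbours in each of \<open>B00\<close> and \<open>A00\<close>.\<close>

definition A00 :: "'a set" where "A00 = {a \<in> NA. real (card (NB - nb a NB)) \<le> (15 / 100) * N}"
definition B00 :: "'a set" where "B00 = {b \<in> NB. real (card (NA - nb b NA)) \<le> (15 / 100) * N}"
definition A0 :: "'a set" where "A0 = {w \<in> V. real (card (B00 - nb w B00)) \<le> (15 / 100) * N}"
definition B0 :: "'a set" where "B0 = {w \<in> V. real (card (A00 - nb w A00)) \<le> (15 / 100) * N}"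

text \<open>3.28 / (712 * 0.15) = 0.03071..., the fraction lost in the first round; hence 0.399 <
  0.43 - 0.03072 in \<open>core_sizes\<close>.\<close>

lemma few_bad:
  assumes "finite S" "(\<Sum>a\<in>S. f a) \<le> (328 / 100) * \<kappa> * N" "\<And>a. f a \<ge> 0"
  shows "card {a \<in> S. f a > (15 / 100) * N} \<le> (3072 / 100000) * N"
proof -
  have Npos: "N > 0" using kN by linarith
  have "(15 / 100) * N * card {a \<in> S. f a > (15 / 100) * N} \<le> (328 / 100) * \<kappa> * N"
    using assms Npos by (intro card_few_bad) auto
  also have "\<dots> = (328 / 100) * (\<kappa> * N)" by simp
  also have "\<dots> \<le> (328 / 100) * (N\<^sup>2 / 712)" using kappa_N by (intro mult_left_mono) auto
  also have "\<dots> \<le> (15 / 100) * N * ((3072 / 100000) * N)" by (simp add: power2_eq_square)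
  finally show ?thesis using Npos by simp
qed

lemma core_sizes:
  "real (card (NA - A00)) \<le> (3072 / 100000) * N" "real (card (NB - B00)) \<le> (3072 / 100000) * N"
  "real (card A00) \<ge> (399 / 1000) * N" "real (card B00) \<ge> (399 / 1000) * N"
proof -
  have "NA - A00 = {a \<in> NA. real (card (NB - nb a NB)) > (15 / 100) * N}" by (auto simp: A00_def)
  then show 1: "real (card (NA - A00)) \<le> (3072 / 100000) * N"
    using few_bad[of NA "\<lambda>a. real (card (NB - nb a NB))"] missing_NA missing_bound by simp
  have "NB - B00 = {a \<in> NB. real (card (NA - nb a NA)) > (15 / 100) * N}" by (auto simp: B00_def)
  then show 2: "real (card (NB - B00)) \<le> (3072 / 100000) * N"
    using few_bad[of NB "\<lambda>a. real (card (NA - nb a NA))"] missing_NB missing_bound by simp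
  have "A00 \<subseteq> NA" "B00 \<subseteq> NB" by (auto simp: A00_def B00_def)
  then have "card (NA - A00) = card NA - card A00" "card A00 \<le> card NA"
    "card (NB - B00) = card NB - card B00" "card B00 \<le> card NB"
    using finite_subset[OF _ finAB(1)] finite_subset[OF _ finAB(2)] finAB
    by (auto intro: card_Diff_subset card_mono)
  then have "real (card (NA - A00)) = d - card A00" "real (card (NB - B00)) = card NB - real (card B00)" by auto
  then show "real (card A00) \<ge> (399 / 1000) * N" "real (card B00) \<ge> (399 / 1000) * N"
    using 1 2 d_bounds card_NB by linarith+
qed

text \<open>Common neighbours are found already in the reference sets \<open>A'\<close> and
  \<open>B'\<close>: each of two vertices misses at most 0.15 N of them, so 0.399 - 0.30 = 0.099 of
  \<open>N\<close> remains, and 0.099 * 712 k exceeds \<open>2 * k + 4\<close>.\<close>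

lemma linkedI:
  assumes "A \<subseteq> V" "B \<subseteq> V" "A \<inter> B = {}" "A' \<subseteq> A" "B' \<subseteq> B"
    and "real (card A') \<ge> (399 / 1000) * N" "real (card B') \<ge> (399 / 1000) * N"
    and "\<And>a. a \<in> A \<Longrightarrow> real (card (B' - nb a B')) \<le> (15 / 100) * N"
    and "\<And>b. b \<in> B \<Longrightarrow> real (card (A' - nb b A')) \<le> (15 / 100) * N"
  shows "linked (2 * k + 4) A B"
proof -
  have fin: "finite A" "finite B" "finite A'" "finite B'" using assms finV by (meson finite_subset)+
  have big: "m \<ge> 2 * k + 4" if "real m \<ge> (99 / 1000) * N" for m
  proof -
    have "real m \<ge> real (2 * k + 4)" using that kN by simp
    then show ?thesis by (simp only: of_nat_le_iff)
  qed
  have "2 * k + 4 \<le> card A" "2 * k + 4 \<le> card B"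
    using assms(6,7) card_mono[OF fin(1) assms(4)] card_mono[OF fin(2) assms(5)] kN
    by (auto intro!: big)
  moreover have "2 * k + 4 \<le> card (nb a B \<inter> nb a' B)" if "a \<in> A" "a' \<in> A" for a a'
  proof -
    have "real (card (nb a B' \<inter> nb a' B')) \<ge> (99 / 1000) * N"
      using card_common_nb[OF fin(4) assms(8)[OF that(1)] assms(8)[OF that(2)]] assms(7) by simp
    moreover have "card (nb a B' \<inter> nb a' B') \<le> card (nb a B \<inter> nb a' B)"
      using nb_mono[OF assms(5)] by (intro card_mono) auto
    ultimately show ?thesis using big[of "card (nb a B' \<inter> nb a' B')"] by linarith
  qed
  moreover have "2 * k + 4 \<le> card (nb b A \<inter> nb b' A)" if "b \<in> B" "b' \<in> B" for b b'
  proof -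
    have "real (card (nb b A' \<inter> nb b' A')) \<ge> (99 / 1000) * N"
      using card_common_nb[OF fin(3) assms(9)[OF that(1)] assms(9)[OF that(2)]] assms(6) by simp
    moreover have "card (nb b A' \<inter> nb b' A') \<le> card (nb b A \<inter> nb b' A)"
      using nb_mono[OF assms(4)] by (intro card_mono) auto
    ultimately show ?thesis using big[of "card (nb b A' \<inter> nb b' A')"] by linarith
  qed
  ultimately show ?thesis unfolding linked_def using assms(1-3) by blast
qed

lemma sub00: "A00 \<subseteq> V" "B00 \<subseteq> V" "A00 \<inter> B00 = {}" "finite A00" "finite B00"
  using subAB finV by (auto simp: A00_def B00_def NB_def intro: finite_subset)

lemma miss00:
  "a \<in> A00 \<Longrightarrow> real (card (B00 - nb a B00)) \<le> (15 / 100) * N"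
  "b \<in> B00 \<Longrightarrow> real (card (A00 - nb b A00)) \<le> (15 / 100) * N"
proof -
  assume a: "a \<in> A00"
  have "card (B00 - nb a B00) \<le> card (NB - nb a NB)"
    by (rule card_mono) (auto simp: B00_def nb_def)
  then show "real (card (B00 - nb a B00)) \<le> (15 / 100) * N" using a by (simp add: A00_def)
next
  assume b: "b \<in> B00"
  have "card (A00 - nb b A00) \<le> card (NA - nb b NA)"
    by (intro card_mono) (auto simp: A00_def nb_def)
  then show "real (card (A00 - nb b A00)) \<le> (15 / 100) * N" using b by (simp add: B00_def)
qed

lemma linked00: "linked (2 * k + 4) A00 B00"
  using sub00 core_sizes miss00 by (intro linkedI[of A00 B00 A00 B00]) auto

lemma sub0: "A00 \<subseteq> A0" "B00 \<subseteq> B0" "A0 \<subseteq> V" "B0 \<subseteq> V"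
  using miss00 sub00 by (auto simp: A0_def B0_def)

lemma has_nb:
  assumes "real (card S) \<ge> (399 / 1000) * N" "real (card (S - nb w S)) \<le> (15 / 100) * N"
  shows "\<exists>b\<in>S. adj w b"
proof (rule ccontr)
  assume "\<not> ?thesis"
  then have "S - nb w S = S" by (auto simp: nb_def)
  then show False using assms kN by simp
qed

lemma disjoint0: "A0 \<inter> B0 = {}"
proof (rule ccontr)
  assume "\<not> ?thesis"
  then obtain w where w: "w \<in> A0" "w \<in> B0" by blast
  obtain b where b: "b \<in> B00" "adj w b" using has_nb[OF core_sizes(4), of w] w by (auto simp: A0_def)
  obtain a where a: "a \<in> A00" "adj w a" using has_nb[OF core_sizes(3), of w] w by (auto simp: B0_def)
  have "w \<notin> A00" using linked_indep[OF linked00] a by blast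
  moreover have "w \<notin> B00" using linked_indep[OF linked_sym[OF linked00]] b by blast
  ultimately show False using linked_outside[OF linked00 _ a(1) b(1) a(2) b(2)] by blast
qed

lemma linked0: "linked (2 * k + 4) A0 B0"
  using sub0 disjoint0 core_sizes by (intro linkedI[of A0 B0 A00 B00]) (auto simp: A0_def B0_def)

end

section \<open>The extremal graph\<close>

text \<open>The extremal graph without a fixed vertex set or fixed part sizes, so that one predicate
  serves the concrete graph on numbers and the completion of G, whose parts are not yet known to be
  balanced.\<close>

definition TKadj :: "'a set \<Rightarrow> 'a set \<Rightarrow> 'a set \<Rightarrow> 'a \<Rightarrow> 'a \<Rightarrow> 'a \<Rightarrow> bool" where
  "TKadj A B T c u v \<longleftrightarrow> (u \<in> A \<and> v \<in> B) \<or> (u \<in> B \<and> v \<in> A) \<or> (u \<noteq> v \<and> u \<in> insert c T \<and> v \<in> insert c T)"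

lemma TKadj_sym: "TKadj A B T c u v = TKadj A B T c v u"
  by (auto simp: TKadj_def)

lemma TKadj_rows:
  assumes "A \<inter> B = {}" "A \<inter> T = {}" "B \<inter> T = {}" "c \<in> A"
  shows "{u \<in> A \<union> B \<union> T. TKadj A B T c c u} = B \<union> T"
    and "v \<in> A - {c} \<Longrightarrow> {u \<in> A \<union> B \<union> T. TKadj A B T c v u} = B"
    and "v \<in> B \<Longrightarrow> {u \<in> A \<union> B \<union> T. TKadj A B T c v u} = A"
    and "v \<in> T \<Longrightarrow> {u \<in> A \<union> B \<union> T. TKadj A B T c v u} = insert c (T - {v})"
  using assms by (auto simp: TKadj_def)

lemma TK_edges_TKadj:
  "{i, j} \<in> TK_edges n r \<longleftrightarrow>
     TKadj {0..<(n - r + 1) div 2} {(n - r + 1) div 2..<n - r + 1} {n - r + 1..<n} 0 i j"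
  unfolding TK_edges_def TKadj_def Let_def by (auto simp: doubleton_eq_iff)

lemma TK_simple:
  assumes "3 \<le> r" "r + 1 \<le> n"
  shows "simple_graph {0..<n} (TK_edges n r)"
proof -
  have "0 < n" "n - r + 1 \<le> n" using assms by auto
  then show ?thesis
    unfolding simple_graph_def TK_edges_def Let_def by (auto simp: card_insert_if)
qed

context fin_graph
begin

lemma qform_adj: "qform V (adjm E) y = (\<Sum>u\<in>V. y u * (\<Sum>v\<in>nb u V. y v))"
proof -
  have "qform V (adjm E) y = (\<Sum>u\<in>V. y u * (\<Sum>v\<in>V. adjm E u v * y v))"
    unfolding qform_def sum_distrib_left by (intro sum.cong refl) simp
  then show ?thesis by (simp add: sum_adjm cong: sum.cong)
qed

lemma complete_bipartite_low:
  fixes \<mu> :: real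
  assumes AB: "A \<subseteq> V" "B \<subseteq> V" "A \<inter> B = {}" "A \<noteq> {}" "B \<noteq> {}"
    and full: "\<And>a b. a \<in> A \<Longrightarrow> b \<in> B \<Longrightarrow> adj a b"
    and ray: "\<And>y. qform V (adjm E) y \<le> \<mu> * sqnorm V y"
  shows "sqrt (real (card A) * real (card B)) \<le> \<mu>"
proof -
  define a b where "a = real (card A)" and "b = real (card B)"
  have fin: "finite A" "finite B" using AB finV by (auto intro: finite_subset)
  have pos: "a > 0" "b > 0" using AB fin by (auto simp: a_def b_def card_gt_0_iff)
  \<comment> \<open>Perron vector of the complete bipartite graph with parts \<open>A\<close> and
    \<open>B\<close>, extended by zero.\<close>
  define y where "y u = (if u \<in> A then sqrt b else if u \<in> B then sqrt a else 0)" for u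
  have full': "adj u v" if "u \<in> B" "v \<in> A" for u v using full[OF that(2,1)] adj_sym by blast
  have y0: "y u \<ge> 0" for u using pos by (simp add: y_def)
  have sA: "(\<Sum>v\<in>A. y v) = a * sqrt b" by (simp add: y_def a_def)
  have sB: "(\<Sum>v\<in>B. y v) = b * sqrt a"
    using AB(3) by (subst sum.cong[where h = "\<lambda>_. sqrt a", OF refl]) (auto simp: y_def b_def)
  have "(\<Sum>u\<in>A\<union>B. y u * (\<Sum>v\<in>nb u V. y v)) \<le> qform V (adjm E) y"
    unfolding qform_adj using AB finV y0 by (intro sum_mono2) (auto intro!: mult_nonneg_nonneg sum_nonneg)
  moreover have "(\<Sum>u\<in>A\<union>B. y u * (\<Sum>v\<in>nb u V. y v)) = (\<Sum>u\<in>A. y u * (\<Sum>v\<in>nb u V. y v)) + (\<Sum>u\<in>B. y u * (\<Sum>v\<in>nb u V. y v))"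
    using fin AB by (intro sum.union_disjoint) auto
  moreover have "(\<Sum>u\<in>A. y u * (\<Sum>v\<in>B. y v)) \<le> (\<Sum>u\<in>A. y u * (\<Sum>v\<in>nb u V. y v))"
    using AB full y0 by (intro sum_mono mult_left_mono sum_mono2) (auto simp: nb_def finV)
  moreover have "(\<Sum>u\<in>B. y u * (\<Sum>v\<in>A. y v)) \<le> (\<Sum>u\<in>B. y u * (\<Sum>v\<in>nb u V. y v))"
    using AB full' y0 by (intro sum_mono mult_left_mono sum_mono2) (auto simp: nb_def finV)
  ultimately have "(\<Sum>u\<in>A. y u) * (\<Sum>v\<in>B. y v) + (\<Sum>u\<in>B. y u) * (\<Sum>v\<in>A. y v) \<le> qform V (adjm E) y"
    by (simp add: sum_distrib_right)
  then have "2 * (a * b) * (sqrt a * sqrt b) \<le> \<mu> * sqnorm V y" using ray[of y] by (simp add: sA sB mult_ac)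
  moreover have "sqnorm V y = 2 * (a * b)"
  proof -
    have "sqnorm V y = (\<Sum>u\<in>A \<union> B. (y u)\<^sup>2)"
      unfolding sqnorm_def using AB finV by (intro sum.mono_neutral_right) (auto simp: y_def)
    also have "\<dots> = (\<Sum>u\<in>A. (y u)\<^sup>2) + (\<Sum>u\<in>B. (y u)\<^sup>2)" using fin AB by (intro sum.union_disjoint) auto
    also have "(\<Sum>u\<in>A. (y u)\<^sup>2) = a * b" using pos by (simp add: y_def a_def)
    also have "(\<Sum>u\<in>B. (y u)\<^sup>2) = (\<Sum>u\<in>B. a)" using pos AB(3) by (intro sum.cong) (auto simp: y_def)
    finally show ?thesis by (simp add: b_def)
  qed
  ultimately have "2 * (a * b) * (sqrt a * sqrt b) \<le> 2 * (a * b) * \<mu>" by (simp add: mult.commute)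
  then show ?thesis using pos by (simp add: real_sqrt_mult a_def b_def)
qed

text \<open>The rows of \<open>T\<close> give \<open>ST = g * x c\<close>, so the clique acts on
  \<open>c\<close> like a loop of weight \<open>g\<close>, and the remaining rows collapse to one
  scalar equation. It is implicit, as \<open>g\<close> depends on \<open>\<mu>\<close>, but the
  comparison needs it only as an identity.\<close>

lemma TK_eigen:
  fixes \<mu> :: real
  assumes V: "V = A \<union> B \<union> T" and dis: "A \<inter> B = {}" "A \<inter> T = {}" "B \<inter> T = {}" and c: "c \<in> A"
    and adj: "\<And>u v. u \<in> V \<Longrightarrow> v \<in> V \<Longrightarrow> adj u v \<longleftrightarrow> TKadj A B T c u v"
    and nn: "\<And>v. x v \<ge> 0" and ne: "\<exists>v\<in>V. x v > 0"
    and eig: "\<And>v. v \<in> V \<Longrightarrow> (\<Sum>u\<in>nb v V. x u) = \<mu> * x v"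
    and g: "g = card T / (\<mu> - card T + 1)" and big: "\<mu> > card T" "\<mu> > g"
  shows "\<mu>\<^sup>2 = card B * (card A + g / (\<mu> - g))"
proof -
  have fin: "finite A" "finite B" "finite T" using V finV by auto
  define SA SB ST where "SA = (\<Sum>u\<in>A-{c}. x u)" and "SB = (\<Sum>u\<in>B. x u)" and "ST = (\<Sum>u\<in>T. x u)"
  have nbV: "nb v V = {u \<in> A \<union> B \<union> T. TKadj A B T c v u}" if "v \<in> V" for v
    using adj that V by (auto simp: nb_def)
  have mem: "A \<subseteq> V" "B \<subseteq> V" "T \<subseteq> V" "c \<in> V" using V c by auto
  have "(\<Sum>u\<in>B\<union>T. x u) = SB + ST" unfolding SB_def ST_def using fin dis by (intro sum.union_disjoint) auto
  then have row_c: "\<mu> * x c = SB + ST"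
    using eig[OF mem(4)] nbV[OF mem(4)] TKadj_rows(1)[OF dis c] by simp
  have row_A: "\<mu> * x v = SB" if "v \<in> A - {c}" for v
    using eig[of v] nbV[of v] TKadj_rows(2)[OF dis c that] that mem by (auto simp: SB_def)
  have SAc: "(\<Sum>u\<in>A. x u) = x c + SA" unfolding SA_def using fin c by (intro sum.remove) auto
  have row_B: "\<mu> * x v = x c + SA" if "v \<in> B" for v
    using eig[of v] nbV[of v] TKadj_rows(3)[OF dis c that] that mem SAc by auto
  have row_T: "(\<mu> + 1) * x v = x c + ST" if "v \<in> T" for v
  proof -
    have "c \<notin> T" using dis c by auto
    then have "(\<Sum>u\<in>insert c (T - {v}). x u) = x c + (\<Sum>u\<in>T-{v}. x u)" using fin by simp
    moreover have "ST = x v + (\<Sum>u\<in>T-{v}. x u)" unfolding ST_def using fin that by (intro sum.remove) auto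
    ultimately show ?thesis
      using eig[of v] nbV[of v] TKadj_rows(4)[OF dis c that] that mem by (auto simp: algebra_simps)
  qed
  have "(\<mu> + 1) * ST = card T * (x c + ST)"
    unfolding ST_def sum_distrib_left using row_T by (simp add: ST_def)
  then have "(\<mu> - card T + 1) * ST = card T * x c" by (simp add: algebra_simps)
  then have ST: "ST = g * x c" unfolding g using big by (simp add: field_simps)
  have SB: "SB = (\<mu> - g) * x c" using row_c ST by (simp add: algebra_simps)
  have "\<mu> * SA = card (A - {c}) * SB" unfolding SA_def sum_distrib_left using row_A by simp
  moreover have "real (card (A - {c})) = real (card A) - 1"
    using card_Suc_Diff1[OF fin(1) c] by linarith
  ultimately have SA: "\<mu> * SA = (real (card A) - 1) * SB" by simp
  have SBB: "\<mu> * SB = card B * (x c + SA)" unfolding SB_def sum_distrib_left using row_B by (simp add: SB_def)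
  have mu0: "\<mu> > 0" using big by (meson le_less_trans of_nat_0_le_iff)
  \<comment> \<open>Connectivity by hand: if \<open>x c\<close> vanished, so would all
    entries.\<close>
  have xc: "x c > 0"
  proof (rule ccontr)
    assume "\<not> ?thesis"
    then have xc0: "x c = 0" using nn[of c] by linarith
    then have z: "SB = 0" "ST = 0" using SB ST by auto
    then have "SA = 0" using SA mu0 by simp
    have "x v = 0" if vV: "v \<in> V" for v
    proof -
      consider "v = c" | "v \<in> A - {c}" | "v \<in> B" | "v \<in> T" using vV V by blast
      then show ?thesis
      proof cases
        case 1 then show ?thesis using xc0 by simp
      next
        case 2 then show ?thesis using row_A[OF 2] z mu0 by simp
      next
        case 3 then show ?thesis using row_B[OF 3] xc0 \<open>SA = 0\<close> mu0 by simp
      next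
        case 4 then show ?thesis using row_T[OF 4] xc0 z mu0 by simp
      qed
    qed
    then show False using ne by auto
  qed
  have "\<mu> * (\<mu> * SB) = card B * (\<mu> * x c + \<mu> * SA)" using SBB by (simp add: algebra_simps)
  then have "\<mu>\<^sup>2 * ((\<mu> - g) * x c) = card B * (\<mu> + (real (card A) - 1) * (\<mu> - g)) * x c"
    unfolding SA unfolding SB by (simp add: algebra_simps power2_eq_square)
  then have "\<mu>\<^sup>2 * (\<mu> - g) = card B * (\<mu> + (real (card A) - 1) * (\<mu> - g))" using xc by simp
  also have "\<dots> = card B * (card A + g / (\<mu> - g)) * (\<mu> - g)"
    using big by (simp add: field_simps)
  finally show ?thesis using big by simp
qed

text \<open>Moving all the edges between \<open>T\<close> and \<open>A \<union> B\<close> to a vertex \<open>c\<close> where the Perron vector \<open>x\<close>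
  is maximal and adding all admissible edges does not decrease the quadratic form at \<open>x\<close>; the
  resulting graph is treated with the Schur test.\<close>
lemma exact_comparison:
  fixes \<mu> \<nu> g h :: real
  assumes V: "V = A \<union> B \<union> T" and dis: "A \<inter> B = {}" "A \<inter> T = {}" "B \<inter> T = {}" and c: "c \<in> A"
    and indep: "\<And>u v. u \<in> A \<Longrightarrow> v \<in> A \<Longrightarrow> \<not> adj u v" "\<And>u v. u \<in> B \<Longrightarrow> v \<in> B \<Longrightarrow> \<not> adj u v"
    and T1: "\<And>w. w \<in> T \<Longrightarrow> card (nb w (A \<union> B)) \<le> 1"
    and nn: "\<And>v. x v \<ge> 0" and max: "\<And>v. v \<in> V \<Longrightarrow> x v \<le> x c" and xc: "x c > 0"
    and eig: "\<And>v. v \<in> V \<Longrightarrow> (\<Sum>u\<in>nb v V. x u) = \<mu> * x v"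
    and cB: "\<exists>b\<in>B. adj c b" and le: "\<nu> \<le> \<mu>"
    and g: "g = card T / (\<nu> - card T + 1)" and h: "h = g / (\<nu> - g)" and big: "\<nu> > card T" "\<nu> > g"
    and up: "card B * (card A + h) \<le> \<nu>\<^sup>2"
  shows "card B * (card A + h) = \<nu>\<^sup>2 \<and> (\<forall>u\<in>V. \<forall>v\<in>V. adj u v \<longleftrightarrow> TKadj A B T c u v)"
proof -
  have fin: "finite A" "finite B" "finite T" using V finV by auto
  have cT: "c \<notin> T" "c \<notin> B" using dis c by auto
  have nu0: "\<nu> > 0" using big by (meson le_less_trans of_nat_0_le_iff)
  have mu0: "\<mu> > 0" using nu0 le by linarith
  have g0: "g \<ge> 0" unfolding g using big by simp
  define b where "b = real (card B)"
  have bpos: "b > 0" using cB fin by (auto simp: b_def card_gt_0_iff)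
  define a' where "a' u v = (if TKadj A B T c u v then 1 else 0 :: real)" for u v
  have a'_sym: "a' u v = a' v u" for u v by (simp add: a'_def TKadj_sym[of A B T c u v])
  have a'_nn: "a' u v \<ge> 0" for u v by (simp add: a'_def)
  define nb' where "nb' v = {u \<in> A \<union> B \<union> T. TKadj A B T c v u}" for v
  have a'_row: "(\<Sum>u\<in>V. a' v u * f u) = (\<Sum>u\<in>nb' v. f u)" for v and f :: "'a \<Rightarrow> real"
    unfolding nb'_def a'_def V using fin by (subst sum.inter_filter) (auto intro!: sum.cong)
  note rows = TKadj_rows[OF dis c, folded nb'_def]
  \<comment> \<open>\<open>y\<close> is built to satisfy the rows of \<open>c\<close>,
    \<open>A - {c}\<close> and \<open>T\<close> of the completed graph exactly, with eigenvalue
    \<open>\<nu>\<close>. The whole discrepancy is pushed into the rows of \<open>B\<close>, where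
    the quotient is at most \<open>\<nu>\<close> precisely by \<open>up\<close>.\<close>
  define z0 where "z0 = 1 / (\<nu> - card T + 1)"
  define \<alpha> where "\<alpha> = (\<nu> - g) / \<nu>"
  define \<beta> where "\<beta> = (\<nu> - g) / b"
  define y where "y v = (if v = c then 1 else if v \<in> T then z0 else if v \<in> A then \<alpha> else \<beta>)" for v
  have pos: "z0 > 0" "\<alpha> > 0" "\<beta> > 0" using big nu0 bpos by (auto simp: z0_def \<alpha>_def \<beta>_def)
  then have ypos: "y v > 0" for v by (simp add: y_def)
  have yT: "(\<Sum>u\<in>T. y u) = g"
  proof -
    have "(\<Sum>u\<in>T. y u) = (\<Sum>u\<in>T. z0)" using cT by (intro sum.cong) (auto simp: y_def)
    then show ?thesis by (simp add: z0_def g)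
  qed
  have yB: "(\<Sum>u\<in>B. y u) = \<nu> - g"
  proof -
    have "(\<Sum>u\<in>B. y u) = (\<Sum>u\<in>B. \<beta>)" using cT dis by (intro sum.cong) (auto simp: y_def)
    then show ?thesis using bpos by (simp add: \<beta>_def b_def)
  qed
  have yA: "(\<Sum>u\<in>A. y u) = 1 + (real (card A) - 1) * \<alpha>"
  proof -
    have "(\<Sum>u\<in>A. y u) = y c + (\<Sum>u\<in>A-{c}. y u)" using fin c by (intro sum.remove) auto
    also have "(\<Sum>u\<in>A-{c}. y u) = (\<Sum>u\<in>A-{c}. \<alpha>)" using dis by (intro sum.cong) (auto simp: y_def)
    also have "\<dots> = (real (card A) - 1) * \<alpha>"
    proof -
      have "real (card (A - {c})) = real (card A) - 1" using card_Suc_Diff1[OF fin(1) c] by linarith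
      then show ?thesis by simp
    qed
    finally show ?thesis by (simp add: y_def)
  qed
  define R where "R v = (\<Sum>u\<in>V. a' v u * y u) / y v" for v
  have Rc: "R c = \<nu>"
  proof -
    have "(\<Sum>u\<in>B\<union>T. y u) = \<nu>" using fin dis yT yB by (subst sum.union_disjoint) auto
    then show ?thesis unfolding R_def a'_row rows(1) by (simp add: y_def)
  qed
  have RA: "R v = \<nu>" if "v \<in> A - {c}" for v
  proof -
    have "y v = \<alpha>" using that dis by (auto simp: y_def)
    then show ?thesis unfolding R_def a'_row rows(2)[OF that] yB using nu0 big by (simp add: \<alpha>_def)
  qed
  have RT: "R v = \<nu>" if "v \<in> T" for v
  proof -
    have yv: "y v = z0" using that cT by (auto simp: y_def)
    have "(\<Sum>u\<in>insert c (T - {v}). y u) = 1 + (g - z0)"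
      using fin cT yT that yv by (simp add: sum_diff1 y_def)
    moreover have "1 + (g - z0) = \<nu> * z0"
    proof -
      have "(\<nu> - card T + 1) * z0 = 1" "g = card T * z0" using big by (simp_all add: z0_def g)
      then show ?thesis by (simp add: algebra_simps)
    qed
    ultimately show ?thesis unfolding R_def a'_row rows(4)[OF that] yv using pos by simp
  qed
  have RB_eq: "\<nu> - R v = (\<nu>\<^sup>2 - b * (card A + h)) / \<nu>" if "v \<in> B" for v
  proof -
    have yv: "y v = \<beta>" using that cT dis by (auto simp: y_def)
    have "R v = (1 + (real (card A) - 1) * \<alpha>) / \<beta>" unfolding R_def a'_row rows(3)[OF that] yv yA ..
    also have "\<dots> = b * (card A + h) / \<nu>"
      unfolding \<alpha>_def \<beta>_def h using big nu0 bpos by (simp add: field_simps)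
    finally show ?thesis using nu0 by (simp add: field_simps power2_eq_square)
  qed
  have R_le: "R v \<le> \<nu>" if vV: "v \<in> V" for v
  proof -
    consider "v = c" | "v \<in> A - {c}" | "v \<in> B" | "v \<in> T" using vV V by blast
    then show ?thesis
    proof cases
      case 3
      have "\<nu> - R v \<ge> 0" using RB_eq[OF 3] up nu0 by (simp add: b_def)
      then show ?thesis by simp
    qed (use Rc RA RT in auto)
  qed
  have schur: "qform V a' f \<le> (\<Sum>v\<in>V. R v * (f v)\<^sup>2)" for f
    unfolding R_def by (rule schur_test) (use a'_sym a'_nn ypos in auto)
  have schur': "(\<Sum>v\<in>V. R v * (f v)\<^sup>2) \<le> \<nu> * sqnorm V f" for f
    unfolding sqnorm_def sum_distrib_left using R_le by (intro sum_mono mult_right_mono) auto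
  define F where "F a S S' = (\<Sum>u\<in>S. \<Sum>v\<in>S'. a u v * x u * x v)" for a :: "'a \<Rightarrow> 'a \<Rightarrow> real" and S S'
  define C where "C = A \<union> B"
  have VC: "V = C \<union> T" "C \<inter> T = {}" "finite C" "C \<subseteq> V" "T \<subseteq> V" using V dis fin by (auto simp: C_def)
  have F_split: "qform V a x = F a C C + 2 * F a T C + F a T T" if "\<And>u v. a u v = a v u" for a
  proof -
    have row: "F a S V = F a S C + F a S T" for S
    proof -
      have "(\<Sum>v\<in>C\<union>T. a u v * x u * x v) = (\<Sum>v\<in>C. a u v * x u * x v) + (\<Sum>v\<in>T. a u v * x u * x v)" for u
        using VC(2,3) fin by (intro sum.union_disjoint) auto
      then show ?thesis unfolding F_def VC(1) by (simp add: sum.distrib)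
    qed
    have "qform V a x = F a V V" by (simp add: qform_def F_def)
    also have "\<dots> = F a C V + F a T V" unfolding F_def VC(1) using VC(2,3) fin by (intro sum.union_disjoint) auto
    also have "\<dots> = F a C C + F a C T + (F a T C + F a T T)" unfolding row ..
    also have "F a C T = F a T C" unfolding F_def by (subst sum.swap) (simp add: that mult_ac)
    finally show ?thesis by simp
  qed
  have adjm_le: "adjm E u v \<le> a' u v" if "u \<in> C \<and> v \<in> C \<or> u \<in> T \<and> v \<in> T" for u v
    using that indep adjD by (auto simp: a'_def TKadj_def C_def)
  have "F (adjm E) C C \<le> F a' C C" "F (adjm E) T T \<le> F a' T T"
    unfolding F_def using adjm_le nn by (intro sum_mono mult_right_mono; simp)+
  moreover have "F (adjm E) T C \<le> F a' T C"
    unfolding F_def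
  proof (rule sum_mono)
    fix w assume w: "w \<in> T"
    have "(\<Sum>v\<in>C. adjm E w v * x w * x v) = (\<Sum>v\<in>nb w C. x w * x v)"
      using sum_adjm[of w C "\<lambda>v. x w * x v"] w VC(4,5) by (auto simp: mult.assoc)
    also have "\<dots> \<le> (\<Sum>v\<in>nb w C. x w * x c)"
      using max nb_subset(2) nn by (intro sum_mono mult_left_mono) auto
    also have "\<dots> = card (nb w C) * (x w * x c)" by simp
    also have "\<dots> \<le> 1 * (x w * x c)" using T1[OF w] nn by (intro mult_right_mono) (auto simp: C_def)
    also have "\<dots> = (\<Sum>v\<in>{c}. a' w v * x w * x v)" 
    proof -
      have "w \<noteq> c" using w cT by blast
      then have "a' w c = 1" using w by (simp add: a'_def TKadj_def)
      then show ?thesis by simp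
    qed
    also have "\<dots> \<le> (\<Sum>v\<in>C. a' w v * x w * x v)"
      using c VC(3) a'_nn nn by (intro sum_mono2) (auto simp: C_def)
    finally show "(\<Sum>v\<in>C. adjm E w v * x w * x v) \<le> (\<Sum>v\<in>C. a' w v * x w * x v)" .
  qed
  ultimately have rewire: "qform V (adjm E) x \<le> qform V a' x"
    using F_split[of "adjm E"] F_split[of a'] a'_sym by (simp add: insert_commute)
  have "qform V (adjm E) x = \<mu> * sqnorm V x"
    by (rule qform_eigen) (use eig sum_adjm in simp)
  moreover have "\<nu> * sqnorm V x \<le> \<mu> * sqnorm V x" using le by (intro mult_right_mono) auto
  ultimately have eqs: "qform V a' x = \<nu> * sqnorm V x" "(\<Sum>v\<in>V. R v * (x v)\<^sup>2) = \<nu> * sqnorm V x"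
    "\<mu> * sqnorm V x = \<nu> * sqnorm V x"
    using rewire schur[of x] schur'[of x] by linarith+
  have cV: "c \<in> V" using V c by blast
  have "sqnorm V x > 0" using sqnorm_pos[OF finV cV] xc by force
  then have mu_nu: "\<mu> = \<nu>" using eqs(3) by simp
  have first: "card B * (card A + h) = \<nu>\<^sup>2"
  proof (rule ccontr)
    assume "\<not> ?thesis"
    then have lt: "b * (card A + h) < \<nu>\<^sup>2" using up by (simp add: b_def)
    \<comment> \<open>A neighbour of \<open>c\<close> in \<open>B\<close> has a positive entry, so
      strictness in the rows of \<open>B\<close> would show in the sum.\<close>
    obtain b0 where b0: "b0 \<in> B" "adj c b0" using cB by blast
    have b0V: "b0 \<in> V" using b0 V by blast
    have "x c \<le> (\<Sum>u\<in>nb b0 V. x u)"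
    proof (rule member_le_sum)
      show "c \<in> nb b0 V" using b0 cV by (simp add: nb_def insert_commute)
    qed (use nn in auto)
    then have xb: "x b0 > 0" using eig[OF b0V] xc mu0 by (smt (verit) mult_nonneg_nonpos nn)
    have "(\<Sum>v\<in>V. (\<nu> - R v) * (x v)\<^sup>2) = 0"
      using eqs(2) by (simp add: left_diff_distrib sum_subtractf sqnorm_def sum_distrib_left)
    moreover have "(\<nu> - R b0) * (x b0)\<^sup>2 \<le> (\<Sum>v\<in>V. (\<nu> - R v) * (x v)\<^sup>2)"
      using R_le finV b0V by (intro member_le_sum) auto
    moreover have "(\<nu> - R b0) * (x b0)\<^sup>2 > 0"
      unfolding RB_eq[OF b0(1)] using lt nu0 xb by simp
    ultimately show False by linarith
  qed
  have eig': "(\<Sum>u\<in>nb' v. x u) = (\<Sum>u\<in>nb v V. x u)" if "v \<in> V" for v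
  proof -
    have "(\<Sum>u\<in>V. a' v u * x u) = \<nu> * x v"
      using finV a'_sym _ eqs(1) that
      by (rule qform_max_imp_eigen) (meson schur schur' order_trans)
    then show ?thesis using eig[OF that] mu_nu by (simp add: a'_row)
  qed
  \<comment> \<open>The completed graph is connected: positivity spreads from \<open>c\<close> to
    \<open>B\<close> and \<open>T\<close>, and from \<open>B\<close> to the rest of
    \<open>A\<close>.\<close>
  have xpos: "x v > 0" if vV: "v \<in> V" for v
  proof -
    have *: "x w > 0" if "w \<in> V" "u \<in> nb' w" "x u > 0" for w u
    proof -
      have "x u \<le> (\<Sum>u\<in>nb' w. x u)" using that nn fin by (intro member_le_sum) (auto simp: nb'_def)
      then have "\<mu> * x w > 0" using eig'[OF that(1)] eig[OF that(1)] that(3) by simp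
      then show ?thesis using mu0 by (simp add: zero_less_mult_iff)
    qed
    have xB: "x b0 > 0" if "b0 \<in> B" for b0 using *[of b0 c] that rows(3)[OF that] c xc V by auto
    obtain b0 where b0: "b0 \<in> B" using cB by blast
    consider "v = c" | "v \<in> A - {c}" | "v \<in> B" | "v \<in> T" using vV V by blast
    then show ?thesis
    proof cases
      case 1 then show ?thesis using xc by simp
    next
      case 2 then show ?thesis using *[OF vV, of b0] rows(2)[OF 2] b0 xB by simp
    next
      case 3 then show ?thesis using xB by simp
    next
      case 4 then show ?thesis using *[OF vV, of c] rows(4)[OF 4] xc by simp
    qed
  qed
  have sub_eq: "nb v V = nb' v" if vv: "v \<in> V" "nb v V \<subseteq> nb' v" for v
  proof (rule ccontr)
    assume "nb v V \<noteq> nb' v"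
    then obtain w where w: "w \<in> nb' v - nb v V" using vv by blast
    have "finite (nb' v)" using fin by (simp add: nb'_def)
    then have "(\<Sum>u\<in>nb v V. x u) < (\<Sum>u\<in>nb' v. x u)"
      using vv(2) w xpos[of w] V nn by (intro sum_strict_mono2[of _ _ w]) (auto simp: nb'_def)
    then show False using eig'[OF vv(1)] by simp
  qed
  \<comment> \<open>The row of \<open>c\<close> has to come first: its equality makes every vertex
    of \<open>T\<close> adjacent to \<open>c\<close>, which uses up the single neighbour that
    \<open>T1\<close> permits. Only then is the inclusion available for the other rows.\<close>
  have "nb c V \<subseteq> nb' c"
    unfolding rows(1) using indep c V by (auto simp: nb_def)
  then have "nb c V = B \<union> T" using sub_eq[OF cV] rows(1) by simp
  then have Tc: "nb w (A \<union> B) = {c}" if "w \<in> T" for w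
  proof -
    have "c \<in> nb w (A \<union> B)" using that \<open>nb c V = B \<union> T\<close> c by (auto simp: nb_def insert_commute)
    then show ?thesis using T1[OF that]
      by (metis One_nat_def card_1_singletonE card_gt_0_iff empty_iff finite_nb le_antisym less_eq_Suc_le singletonD)
  qed
  have "nb v V = nb' v" if v: "v \<in> V" for v
  proof (rule sub_eq[OF v], rule subsetI)
    fix u assume u: "u \<in> nb v V"
    then have uv: "u \<in> V" "adj v u" "v \<noteq> u" using adjD by (auto simp: nb_def)
    have "u = c" if "u \<in> A \<union> B" "v \<in> T"
    proof -
      have "u \<in> nb v (A \<union> B)" using that(1) uv(2) by (simp add: nb_def)
      then show ?thesis using Tc[OF that(2)] by blast
    qed
    moreover have "v = c" if "v \<in> A \<union> B" "u \<in> T"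
    proof -
      have "v \<in> nb u (A \<union> B)" using that(1) uv(2) by (simp add: nb_def insert_commute)
      then show ?thesis using Tc[OF that(2)] by blast
    qed
    ultimately show "u \<in> nb' v"
      using uv indep v unfolding nb'_def TKadj_def V by blast
  qed
  then have "adj u v \<longleftrightarrow> TKadj A B T c u v" if "u \<in> V" "v \<in> V" for u v
    using that V by (auto simp: nb_def nb'_def)
  then show ?thesis using first by blast
qed

end

lemma ex_bij_betw_card:
  assumes "finite A" "finite B" "card A = card B"
  obtains f where "bij_betw f A B"
  using assms finite_same_card_bij by blast

lemma TKadj_iso:
  assumes fin: "finite A" "finite B" "finite T" "finite A'" "finite B'" "finite T'"
    and card: "card A = card A'" "card B = card B'" "card T = card T'"
    and dis: "A \<inter> B = {}" "A \<inter> T = {}" "B \<inter> T = {}" "A' \<inter> B' = {}" "A' \<inter> T' = {}" "B' \<inter> T' = {}"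
    and c: "c \<in> A" "c' \<in> A'"
  shows "\<exists>f. bij_betw f (A \<union> B \<union> T) (A' \<union> B' \<union> T') \<and>
    (\<forall>u\<in>A \<union> B \<union> T. \<forall>v\<in>A \<union> B \<union> T. TKadj A B T c u v \<longleftrightarrow> TKadj A' B' T' c' (f u) (f v))"
proof -
  have "card (A - {c}) = card (A' - {c'})" using c card fin by (simp add: card_Diff_singleton)
  then obtain f1 where f1: "bij_betw f1 (A - {c}) (A' - {c'})" using fin ex_bij_betw_card by blast
  obtain f2 where f2: "bij_betw f2 B B'" using fin card ex_bij_betw_card by blast
  obtain f3 where f3: "bij_betw f3 T T'" using fin card ex_bij_betw_card by blast
  define f where "f v = (if v = c then c' else if v \<in> A then f1 v else if v \<in> B then f2 v else f3 v)" for v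
  have fc: "f c = c'" by (simp add: f_def)
  have b1: "bij_betw f (A - {c}) (A' - {c'})"
    using f1 by (rule bij_betw_cong[THEN iffD1, rotated]) (simp add: f_def)
  have bA: "bij_betw f A A'"
    using notIn_Un_bij_betw[OF _ _ b1, of c] fc c by (simp add: insert_absorb)
  have bB: "bij_betw f B B'"
    using f2 by (rule bij_betw_cong[THEN iffD1, rotated]) (use dis c in \<open>auto simp: f_def\<close>)
  have bT: "bij_betw f T T'"
    using f3 by (rule bij_betw_cong[THEN iffD1, rotated]) (use dis c in \<open>auto simp: f_def\<close>)
  have bAB: "bij_betw f (A \<union> B) (A' \<union> B')" using bij_betw_combine[OF bA bB] dis by blast
  have bV: "bij_betw f (A \<union> B \<union> T) (A' \<union> B' \<union> T')"
    using bij_betw_combine[OF bAB bT] dis by blast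
  have im: "f ` A = A'" "f ` B = B'" "f ` T = T'" using bA bB bT by (auto simp: bij_betw_def)
  have mem: "f v \<in> A' \<longleftrightarrow> v \<in> A" "f v \<in> B' \<longleftrightarrow> v \<in> B" "f v \<in> T' \<longleftrightarrow> v \<in> T" if "v \<in> A \<union> B \<union> T" for v
    using that im dis by blast+
  have inj: "f u = f v \<longleftrightarrow> u = v" if "u \<in> A \<union> B \<union> T" "v \<in> A \<union> B \<union> T" for u v
    using bV that unfolding bij_betw_def inj_on_def by blast
  have "f v = c' \<longleftrightarrow> v = c" if "v \<in> A \<union> B \<union> T" for v
    using inj[of v c] that c fc by auto
  then show ?thesis
    using bV by (intro exI[of _ f]) (simp add: TKadj_def mem inj)
qed

text \<open>With \<open>j\<close> the deviation of \<open>b\<close> from the optimum and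
  \<open>e\<close> the parity of \<open>m\<close>, the defect equals \<open>j * (j + e - h)\<close>.
  For odd \<open>m\<close>, \<open>h > 0\<close> breaks the tie between the two balanced splits in
  favour of a smaller part \<open>A\<close>; for even \<open>m\<close>, \<open>h < 1\<close>
  excludes \<open>j = 1\<close>.\<close>

lemma balanced_opt:
  fixes h :: real and a b m :: nat
  assumes "a + b = m" "0 < h" "h < 1"
  shows "real b * (real a + h) \<le> real (m - m div 2) * (real (m div 2) + h)"
    and "real b * (real a + h) = real (m - m div 2) * (real (m div 2) + h) \<Longrightarrow> b = m - m div 2"
proof -
  define j where "j = int b - int (m - m div 2)"
  define e where "e = 2 * int (m - m div 2) - int m"
  have e: "e = 0 \<or> e = 1" unfolding e_def by presburger
  have bj: "real b = real (m - m div 2) + j" by (simp add: j_def)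
  have aj: "real a = real (m div 2) - j"
  proof -
    have "int a = int (m div 2) - j" using assms(1) unfolding j_def by presburger
    then show ?thesis by linarith
  qed
  have em: "real (m div 2) = real (m - m div 2) - e"
  proof -
    have "int (m div 2) = int (m - m div 2) - e" unfolding e_def by presburger
    then show ?thesis by linarith
  qed
  have diff: "real (m - m div 2) * (real (m div 2) + h) - real b * (real a + h) = j * (j + e - h)"
    unfolding bj aj em by (simp add: algebra_simps)
  have pos: "real_of_int j * (j + e - h) > 0" if "j \<noteq> 0"
  proof (cases "j > 0")
    case True
    then have "real_of_int j \<ge> 1" "real_of_int e \<ge> 0" using e by auto
    then show ?thesis using assms by (intro mult_pos_pos) auto
  next
    case False
    then have "real_of_int j \<le> -1" "real_of_int e \<le> 1" using that e by auto
    then show ?thesis using assms by (intro mult_neg_neg) auto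
  qed
  show "real b * (real a + h) \<le> real (m - m div 2) * (real (m div 2) + h)"
    using diff pos by (cases "j = 0") auto
  show "b = m - m div 2" if "real b * (real a + h) = real (m - m div 2) * (real (m div 2) + h)"
  proof -
    have "j = 0" using diff pos that by force
    then show ?thesis by (simp add: j_def)
  qed
qed

section \<open>Vertices outside the core\<close>

context fin_graph
begin

lemma edges_missing_block:
  assumes fin: "finite A" "finite B" and D: "D \<subseteq> A" "D' \<subseteq> B" "\<And>a b. a \<in> D \<Longrightarrow> b \<in> D' \<Longrightarrow> \<not> adj a b"
  shows "(\<Sum>a\<in>A. real (card (nb a B))) \<le> real (card A) * real (card B) - real (card D) * real (card D')"
proof -
  have f: "finite D" "finite D'" using D fin finite_subset by blast+
  have "real (card (nb a B)) \<le> real (card B) - (if a \<in> D then real (card D') else 0)" for a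
  proof -
    have "card (nb a B) \<le> card B" using fin by (intro card_mono) (auto simp: nb_def)
    moreover have "card (nb a B) + card D' \<le> card B" if "a \<in> D"
    proof -
      have "nb a B \<inter> D' = {}" using D(3)[OF that] by (auto simp: nb_def)
      then have "card (nb a B) + card D' = card (nb a B \<union> D')" using f by (simp add: card_Un_disjoint)
      also have "\<dots> \<le> card B" using fin D(2) by (intro card_mono) (auto simp: nb_def)
      finally show ?thesis .
    qed
    ultimately show ?thesis by (auto simp flip: of_nat_add)
  qed
  then have "(\<Sum>a\<in>A. real (card (nb a B))) \<le> (\<Sum>a\<in>A. real (card B) - (if a \<in> D then real (card D') else 0))"
    by (rule sum_mono)
  also have "\<dots> = real (card A) * real (card B) - (\<Sum>a\<in>A. if a \<in> D then real (card D') else 0)"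
    by (simp add: sum_subtractf)
  also have "(\<Sum>a\<in>A. if a \<in> D then real (card D') else 0) = real (card D) * real (card D')"
    using D(1) fin(1) by (simp add: sum.If_cases Int_absorb1)
  finally show ?thesis .
qed

end

context spectral_graph
begin

text \<open>Abstracts \<open>A0\<close>, \<open>B0\<close> and their reference sets
  \<open>A00\<close>, \<open>B00\<close> into a predicate invariant under exchanging the sides, so
  that \<open>v0\<close> or an end of an ear may be taken in \<open>A\<close>. The bound 0.0615 is
  twice 0.03072, rounded up.\<close>

definition core :: "'a set \<Rightarrow> 'a set \<Rightarrow> 'a set \<Rightarrow> 'a set \<Rightarrow> bool" where
  "core A B A' B' \<longleftrightarrow> linked (2 * k + 4) A B \<and> A' \<subseteq> A \<and> B' \<subseteq> B \<and>
     real (card A') \<ge> (399 / 1000) * N \<and> real (card B') \<ge> (399 / 1000) * N \<and>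
     real (card (V - A' - B')) \<le> (615 / 10000) * N \<and>
     (\<forall>w\<in>V. w \<in> A \<longleftrightarrow> real (card (B' - nb w B')) \<le> (15 / 100) * N) \<and>
     (\<forall>w\<in>V. w \<in> B \<longleftrightarrow> real (card (A' - nb w A')) \<le> (15 / 100) * N)"

lemma core_sym: "core A B A' B' \<Longrightarrow> core B A B' A'"
  unfolding core_def using linked_sym by (simp add: Diff_eq Int_ac)

lemma core_exists: "core A0 B0 A00 B00"
proof -
  have "card (V - A00 - B00) \<le> card ((NA - A00) \<union> (NB - B00))"
    using finV by (intro card_mono) (auto simp: NB_def)
  also have "\<dots> \<le> card (NA - A00) + card (NB - B00)" by (rule card_Un_le)
  finally have "real (card (V - A00 - B00)) \<le> (615 / 10000) * N" using core_sizes(1,2) by linarith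
  then show ?thesis
    unfolding core_def using linked0 sub0 core_sizes(3,4) by (auto simp: A0_def B0_def)
qed

lemma coreD:
  assumes "core A B A' B'"
  shows "linked (2 * k + 4) A B" "A' \<subseteq> A" "B' \<subseteq> B" "A \<subseteq> V" "B \<subseteq> V" "A \<inter> B = {}"
    "A \<subseteq> ext A B" "B \<subseteq> ext B A" "ext A B \<subseteq> V" "ext B A \<subseteq> V" "ext A B \<inter> ext B A = {}"
    "finite A'" "finite B'" "finite (ext A B)" "finite (ext B A)"
proof -
  show L: "linked (2 * k + 4) A B" and "A' \<subseteq> A" "B' \<subseteq> B" using assms by (auto simp: core_def)
  then show "A \<subseteq> V" "B \<subseteq> V" "A \<inter> B = {}" by (auto simp: linked_def)
  show "A \<subseteq> ext A B" "B \<subseteq> ext B A" by (auto simp: ext_def)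
  show V: "ext A B \<subseteq> V" "ext B A \<subseteq> V" using ext_subset(1)[OF L] ext_subset(1)[OF linked_sym[OF L]] by auto
  show "ext A B \<inter> ext B A = {}" by (rule ext_disjoint[OF L])
  show "finite A'" "finite B'" using \<open>A' \<subseteq> A\<close> \<open>B' \<subseteq> B\<close> \<open>A \<subseteq> V\<close> \<open>B \<subseteq> V\<close> finV by (meson finite_subset)+
  show "finite (ext A B)" "finite (ext B A)" using V finV by (meson finite_subset)+
qed

text \<open>Outside the core, \<open>mid\<close> collects the vertices that can still be coloured, and those in
  \<open>rest\<close> have at most one neighbour in the core.\<close>
definition rest :: "'a set \<Rightarrow> 'a set \<Rightarrow> 'a set" where "rest A B = V - ext A B - ext B A"
definition mid :: "'a set \<Rightarrow> 'a set \<Rightarrow> 'a set" where "mid A B = (ext A B - A) \<union> (ext B A - B)"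

lemma rest_sym: "rest A B = rest B A" and mid_sym: "mid A B = mid B A"
  by (auto simp: rest_def mid_def)

lemma mid_rest:
  assumes C: "core A B A' B'"
  shows "card (mid A B) + card (rest A B) \<le> card (V - A' - B')" "finite (mid A B)" "finite (rest A B)"
    "V - rest A B = A \<union> B \<union> mid A B" "ext A B \<union> ext B A = V - rest A B"
    "real (card (ext A B)) + real (card (ext B A)) = N - real (card (rest A B))"
proof -
  note c = coreD[OF C]
  show f: "finite (mid A B)" "finite (rest A B)" using c(14,15) finV by (auto simp: mid_def rest_def)
  have "mid A B \<inter> rest A B = {}" by (auto simp: mid_def rest_def)
  then have "card (mid A B) + card (rest A B) = card (mid A B \<union> rest A B)" using f by (simp add: card_Un_disjoint)
  also have "\<dots> \<le> card (V - A' - B')"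
    using finV c by (intro card_mono) (auto simp: mid_def rest_def)
  finally show "card (mid A B) + card (rest A B) \<le> card (V - A' - B')" .
  show "V - rest A B = A \<union> B \<union> mid A B" using c by (auto simp: mid_def rest_def)
  show u: "ext A B \<union> ext B A = V - rest A B" using c by (auto simp: rest_def)
  have "card (ext A B) + card (ext B A) = card (V - rest A B)" using c u by (metis card_Un_disjoint)
  also have "\<dots> = card V - card (rest A B)" using f by (intro card_Diff_subset) (auto simp: rest_def)
  finally have tot: "card (ext A B) + card (ext B A) = card V - card (rest A B)" .
  then show "real (card (ext A B)) + real (card (ext B A)) = N - real (card (rest A B))"
  proof -
    have "card (rest A B) \<le> card V" using finV by (intro card_mono) (auto simp: rest_def)
    then show ?thesis using tot by linarith
  qed
qed

lemma mid_rest_small: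
  assumes "core A B A' B'"
  shows "real (card (mid A B)) + real (card (rest A B)) \<le> (615 / 10000) * N"
  using mid_rest(1)[OF assms] assms unfolding core_def by linarith

text \<open>A vertex of \<open>rest\<close> has at most one neighbour in \<open>A \<union> B\<close>
  and arbitrary ones in \<open>mid\<close>, hence \<open>1 + q\<close> as the degree bound for
  \<open>entries_bound\<close>. The constants are 0.437 < 0.49859 - 0.0615 and 1.142 > 0.49859 /
  0.437.\<close>

lemma rest_entries:
  assumes C: "core A B A' B'" and w: "w \<in> rest A B"
  shows "x w \<le> (1 + real (card (mid A B))) / ((437 / 1000) * N)"
    and "\<mu> * x w \<le> (1142 / 1000) * (1 + real (card (mid A B)))" and "\<mu> > card (rest A B)"
    and "x w \<le> (1 + real (card (mid A B))) / (\<mu> - card (rest A B))"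
proof -
  note c = coreD[OF C]
  define q t where "q = real (card (mid A B))" and "t = real (card (rest A B))"
  have q0: "q \<ge> 0" by (simp add: q_def)
  have t: "t \<le> (615 / 10000) * N" using mid_rest_small[OF C] q0 by (simp add: q_def t_def)
  have Npos: "N > 0" using kN by linarith
  have low: "\<mu> - t \<ge> (437 / 1000) * N" using t muN by linarith
  show big: "\<mu> > card (rest A B)" using low Npos unfolding t_def by linarith
  have D: "real (card (nb w (V - rest A B))) \<le> 1 + q" if "w \<in> rest A B" for w
  proof -
    have "card (nb w (A \<union> B)) \<le> 1" using card_nb_rest[OF c(1)] that by (auto simp: rest_def)
    moreover have "card (nb w (mid A B)) \<le> card (mid A B)"
      using mid_rest(2)[OF C] by (intro card_mono) (auto simp: nb_def)
    moreover have "card (nb w (V - rest A B)) \<le> card (nb w (A \<union> B)) + card (nb w (mid A B))"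
      unfolding mid_rest(4)[OF C] nb_Un[of w "A \<union> B"] by (rule card_Un_le)
    ultimately show ?thesis by (simp add: q_def)
  qed
  show xw: "x w \<le> (1 + real (card (mid A B))) / (\<mu> - card (rest A B))"
    using entries_bound[of "rest A B" "1 + q" x \<mu> w] D nn le1 eig big w unfolding q_def
    by (auto simp: rest_def)
  then have xw: "x w \<le> (1 + q) / (\<mu> - t)" by (simp add: q_def t_def)
  also have "\<dots> \<le> (1 + q) / ((437 / 1000) * N)" using low q0 Npos by (intro divide_left_mono) auto
  finally show "x w \<le> (1 + real (card (mid A B))) / ((437 / 1000) * N)" by (simp add: q_def)
  have "1142 * t \<le> 142 * \<mu>" using t muN Npos by linarith
  then have "\<mu> \<le> (1142 / 1000) * (\<mu> - t)" by (simp add: field_simps)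
  then have "\<mu> * x w \<le> (1142 / 1000) * (\<mu> - t) * x w" using nn by (intro mult_right_mono) auto
  also have "\<dots> = (1142 / 1000) * ((\<mu> - t) * x w)" by simp
  also have "(\<mu> - t) * x w \<le> 1 + q" using xw big by (simp add: t_def field_simps)
  finally show "\<mu> * x w \<le> (1142 / 1000) * (1 + real (card (mid A B)))" by (simp add: q_def)
qed

lemma rest_sum:
  assumes C: "core A B A' B'"
  shows "(\<Sum>w\<in>rest A B. (\<mu> * x w)\<^sup>2) \<le> (131 / 100) * real (card (rest A B)) * (1 + real (card (mid A B)))\<^sup>2"
proof -
  define q where "q = real (card (mid A B))"
  have "(\<mu> * x w)\<^sup>2 \<le> (131 / 100) * (1 + q)\<^sup>2" if "w \<in> rest A B" for w
  proof -
    have "\<mu> \<ge> 0" using muN kN by linarith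
    then have "(\<mu> * x w)\<^sup>2 \<le> ((1142 / 1000) * (1 + q))\<^sup>2"
      using rest_entries(2)[OF C that] nn by (intro power_mono) (auto simp: q_def)
    also have "\<dots> \<le> (131 / 100) * (1 + q)\<^sup>2"
      unfolding power_mult_distrib by (intro mult_right_mono) (auto simp: power2_eq_square)
    finally show ?thesis .
  qed
  then have "(\<Sum>w\<in>rest A B. (\<mu> * x w)\<^sup>2) \<le> (\<Sum>w\<in>rest A B. (131 / 100) * (1 + q)\<^sup>2)" by (rule sum_mono)
  then show ?thesis by (simp add: q_def mult_ac)
qed

text \<open>Entries are at most 1, so by \<open>sqnorm_low\<close> the part
  \<open>S \<union> S'\<close> keeps norm at least 0.86 N minus the number of vertices left out. The
  excess of \<open>\<mu>\<^sup>2\<close> over the edge count is thus of the order of the squared row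
  sums outside, divided by \<open>N\<close>.\<close>

lemma gain:
  assumes C: "core A B A' B'" and S: "S \<subseteq> ext A B" "S' \<subseteq> ext B A" and small: "real (card (V - (S \<union> S'))) \<le> (86 / 100) * N"
    and e: "(\<Sum>a\<in>S. real (card (nb a S'))) \<le> e"
  shows "(\<mu>\<^sup>2 - e) * ((86 / 100) * N - real (card (V - (S \<union> S')))) \<le> 2 * (\<Sum>w\<in>V-(S\<union>S'). (\<mu> * x w)\<^sup>2)"
proof -
  note c = coreD[OF C]
  have mu0: "\<mu> \<ge> 0" using muN kN by linarith
  have g: "(\<mu>\<^sup>2 - (\<Sum>a\<in>S. real (card (nb a S')))) * sqnorm (S \<union> S') x \<le> 2 * (\<Sum>w\<in>V-(S\<union>S'). (\<mu> * x w)\<^sup>2)"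
  proof (rule bipartite_plus_rest)
    show "\<not> adj u v" if "u \<in> S" "v \<in> S" for u v using ext_indep[OF c(1)] S that by blast
    show "\<not> adj u v" if "u \<in> S'" "v \<in> S'" for u v using ext_indep[OF linked_sym[OF c(1)]] S that by blast
  qed (use c S mu0 nn eig in auto)
  have "sqnorm V x = sqnorm (S \<union> S') x + sqnorm (V - (S \<union> S')) x"
    unfolding sqnorm_def using sum.subset_diff[of "S \<union> S'" V] finV subset_trans[OF S(1) c(9)] subset_trans[OF S(2) c(10)]
    by (simp add: add.commute)
  moreover have "sqnorm (V - (S \<union> S')) x \<le> (\<Sum>w\<in>V - (S \<union> S'). 1)"
    unfolding sqnorm_def using nn le1 by (intro sum_mono) (auto simp: power_le_one)
  ultimately have low: "(86 / 100) * N - real (card (V - (S \<union> S'))) \<le> sqnorm (S \<union> S') x"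
    using sqnorm_low by simp
  have rhs: "0 \<le> 2 * (\<Sum>w\<in>V-(S\<union>S'). (\<mu> * x w)\<^sup>2)" by (simp add: sum_nonneg)
  show ?thesis
  proof (cases "\<mu>\<^sup>2 \<le> e")
    case True
    then have "(\<mu>\<^sup>2 - e) * ((86 / 100) * N - real (card (V - (S \<union> S')))) \<le> 0"
      using small by (intro mult_nonpos_nonneg) auto
    then show ?thesis using rhs by linarith
  next
    case False
    then have "(\<mu>\<^sup>2 - e) * ((86 / 100) * N - real (card (V - (S \<union> S')))) \<le> (\<mu>\<^sup>2 - e) * sqnorm (S \<union> S') x"
      using low by (intro mult_left_mono) auto
    also have "\<dots> \<le> (\<mu>\<^sup>2 - (\<Sum>a\<in>S. real (card (nb a S')))) * sqnorm (S \<union> S') x"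
      using e by (intro mult_right_mono) auto
    finally show ?thesis using g by linarith
  qed
qed

text \<open>The non-edges counted at different vertices of \<open>mid A B\<close> are distinct because their other
  endpoints lie in \<open>A'\<close> or \<open>B'\<close>.\<close>
lemma edges_missing_mid:
  assumes C: "core A B A' B'" and S: "S \<subseteq> ext A B" "S' \<subseteq> ext B A" "A' \<subseteq> S" "B' \<subseteq> S'"
  shows "(\<Sum>a\<in>S. real (card (nb a S'))) \<le> real (card S) * real (card S') - (15 / 100) * N * real (card (mid A B \<inter> (S \<union> S')))"
proof -
  note c = coreD[OF C]
  have fin: "finite S" "finite S'" using S c finite_subset by blast+
  define m where "m a X = real (card (X - nb a X))" for a X
  have m_mono: "m a X \<le> m a Y" if "X \<subseteq> Y" "finite Y" for a X Y
    unfolding m_def using that by (intro of_nat_mono card_mono) (auto simp: nb_def)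
  have nbm: "real (card (nb a S')) = real (card S') - m a S'" for a
    unfolding m_def using fin card_mono[of S' "nb a S'"] nb_subset(1) by (subst card_Diff_subset) auto
  then have e: "(\<Sum>a\<in>S. real (card (nb a S'))) = real (card S) * real (card S') - (\<Sum>a\<in>S. m a S')"
    by (simp add: sum_subtractf)
  have dis: "A \<inter> ext B A = {}" "B \<inter> ext A B = {}" using c by auto
  have swap: "(\<Sum>a\<in>X. m a Y) = (\<Sum>b\<in>Y. m b X)" if "finite X" "finite Y" for X Y
  proof -
    have "m a Y = real (card Y) - real (card (nb a Y))" if "finite Y" for a Y
      unfolding m_def using that card_mono[of Y "nb a Y"] nb_subset(1) by (subst card_Diff_subset) auto
    then show ?thesis using that card_nb_swap[OF that] by (simp add: sum_subtractf mult.commute)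
  qed
  have "(\<Sum>a\<in>S. m a S') = (\<Sum>a\<in>S-A. m a S') + (\<Sum>a\<in>S\<inter>A. m a S')"
    using sum.Int_Diff[OF fin(1), of "\<lambda>a. m a S'" A] by simp
  moreover have "(\<Sum>a\<in>S-A. (15 / 100) * N) \<le> (\<Sum>a\<in>S-A. m a S')"
  proof (rule sum_mono)
    fix a assume a: "a \<in> S - A"
    then have "\<not> m a B' \<le> (15 / 100) * N" using C S c(9) unfolding core_def m_def by blast
    then show "(15 / 100) * N \<le> m a S'" using m_mono[OF S(4) fin(2), of a] by linarith
  qed
  moreover have "(\<Sum>b\<in>S'-B. (15 / 100) * N) \<le> (\<Sum>a\<in>S\<inter>A. m a S')"
  proof -
    have "(\<Sum>b\<in>S'-B. (15 / 100) * N) \<le> (\<Sum>b\<in>S'-B. m b (S \<inter> A))"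
    proof (rule sum_mono)
      fix b assume b: "b \<in> S' - B"
      then have "\<not> m b A' \<le> (15 / 100) * N" using C S c(10) unfolding core_def m_def by blast
      moreover have "m b A' \<le> m b (S \<inter> A)" using S c fin by (intro m_mono) auto
      ultimately show "(15 / 100) * N \<le> m b (S \<inter> A)" by linarith
    qed
    also have "\<dots> = (\<Sum>a\<in>S\<inter>A. m a (S' - B))" using fin by (intro swap) auto
    also have "\<dots> \<le> (\<Sum>a\<in>S\<inter>A. m a S')" using fin by (intro sum_mono m_mono) auto
    finally show ?thesis .
  qed
  moreover have "real (card (mid A B \<inter> (S \<union> S'))) = real (card (S - A)) + real (card (S' - B))"
  proof -
    have "mid A B \<inter> (S \<union> S') = (S - A) \<union> (S' - B)" using S c dis by (auto simp: mid_def)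
    moreover have "(S - A) \<inter> (S' - B) = {}" using S c by auto
    ultimately show ?thesis using fin by (simp add: card_Un_disjoint)
  qed
  ultimately show ?thesis unfolding e by (simp add: algebra_simps)
qed

lemma prod_le_sq4: "(a::real) \<ge> 0 \<Longrightarrow> b \<ge> 0 \<Longrightarrow> a + b \<le> s \<Longrightarrow> a * b \<le> s\<^sup>2 / 4"
proof -
  assume ab: "a \<ge> 0" "b \<ge> 0" "a + b \<le> s"
  have "4 * (a * b) \<le> (a + b)\<^sup>2" using sum_squares_bound[of a b] by (simp add: power2_sum)
  also have "\<dots> \<le> s\<^sup>2" using ab by (intro power_mono) auto
  finally show ?thesis by simp
qed

text \<open>By \<open>gain\<close> the excess \<open>X\<close> is at most 0.2042 (1 + q)^2. With
  \<open>mid\<close> empty the core has at most \<open>M - 1\<close> vertices, which costs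
  \<open>(M - 1) / 2\<close> edges; otherwise each vertex of \<open>mid\<close> costs 0.15 N edges,
  and (1 + q)^2 \<le> 4 q^2 with q \<le> 0.0615 N is too small to compensate.\<close>

lemma many_rest_contradiction:
  assumes C: "core A B A' B'" and M: "\<mu>\<^sup>2 \<ge> (M\<^sup>2 - 1) / 4" "M \<ge> N - 2 * \<kappa>"
    and t: "N - real (card (rest A B)) \<le> M"
    and alt: "mid A B \<noteq> {} \<or> N - real (card (rest A B)) \<le> M - 1"
  shows False
proof -
  note c = coreD[OF C]
  define q t where "q = real (card (mid A B))" and "t = real (card (rest A B))"
  define a b where "a = real (card (ext A B))" and "b = real (card (ext B A))"
  have N: "N \<ge> 1424" using kN by linarith
  have q0: "q \<ge> 0" "t \<ge> 0" "a \<ge> 0" "b \<ge> 0" by (auto simp: q_def t_def a_def b_def)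
  have qt: "q + t \<le> (615 / 10000) * N" using mid_rest_small[OF C] by (simp add: q_def t_def)
  have ab: "a + b = N - t" using mid_rest(6)[OF C] by (simp add: a_def b_def t_def)
  have "V - (ext A B \<union> ext B A) = rest A B" by (auto simp: rest_def)
  note T = this
  have "mid A B \<inter> (ext A B \<union> ext B A) = mid A B" by (auto simp: mid_def)
  then have e: "(\<Sum>u\<in>ext A B. real (card (nb u (ext B A)))) \<le> a * b - (15 / 100) * N * q"
    using edges_missing_mid[OF C order_refl order_refl] c by (auto simp: a_def b_def q_def)
  have "(\<mu>\<^sup>2 - (a * b - (15 / 100) * N * q)) * ((86 / 100) * N - t) \<le> 2 * (\<Sum>w\<in>rest A B. (\<mu> * x w)\<^sup>2)"
    using gain[OF C order_refl order_refl _ e] qt q0 N unfolding T t_def[symmetric] by linarith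
  also have "\<dots> \<le> 2 * ((131 / 100) * t * (1 + q)\<^sup>2)" using rest_sum[OF C] by (simp add: q_def t_def)
  also have "\<dots> \<le> 2 * ((131 / 100) * ((615 / 10000) * N) * (1 + q)\<^sup>2)"
    using qt q0 by (intro mult_left_mono mult_right_mono) auto
  finally have g0: "(\<mu>\<^sup>2 - (a * b - (15 / 100) * N * q)) * ((86 / 100) * N - t)
      \<le> 2 * ((131 / 100) * ((615 / 10000) * N) * (1 + q)\<^sup>2)" .
  have g: "(\<mu>\<^sup>2 - (a * b - (15 / 100) * N * q)) * ((86 / 100) * N - t) \<le> (1612 / 10000) * N * (1 + q)\<^sup>2"
  proof -
    have "0 \<le> N * (1 + q)\<^sup>2" using N by simp
    moreover have "2 * ((131 / 100) * ((615 / 10000) * N) * (1 + q)\<^sup>2) = (16113 / 100000) * (N * (1 + q)\<^sup>2)"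
      "(1612 / 10000) * N * (1 + q)\<^sup>2 = (1612 / 10000) * (N * (1 + q)\<^sup>2)" by simp_all
    ultimately show ?thesis using g0 by linarith
  qed
  define X where "X = \<mu>\<^sup>2 - (a * b - (15 / 100) * N * q)"
  have X: "X \<le> (2042 / 10000) * (1 + q)\<^sup>2" 
  proof (cases "X \<le> 0")
    case True
    also have "0 \<le> (2042 / 10000) * (1 + q)\<^sup>2" by simp
    finally show ?thesis .
  next
    case False
    then have "X * ((79 / 100) * N) \<le> X * ((86 / 100) * N - t)"
      using qt q0 by (intro mult_left_mono) auto
    also have "\<dots> \<le> (1612 / 10000) * N * (1 + q)\<^sup>2" using g by (simp add: X_def)
    finally have "N * ((79 / 100) * X) \<le> N * ((1612 / 10000) * (1 + q)\<^sup>2)"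
      by (simp add: mult_ac)
    then have "(79 / 100) * X \<le> (1612 / 10000) * (1 + q)\<^sup>2" using N by simp
    moreover have "(1612 / 10000) * (1 + q)\<^sup>2 \<le> (79 / 100) * ((2042 / 10000) * (1 + q)\<^sup>2)" by simp
    ultimately show ?thesis by linarith
  qed
  show False
  proof (cases "mid A B = {}")
    case True
    then have "q = 0" by (simp add: q_def)
    have "a * b \<le> (M - 1)\<^sup>2 / 4" using alt True ab q0 by (intro prod_le_sq4) (auto simp: t_def)
    also have "\<dots> = (M\<^sup>2 - 1) / 4 - (M - 1) / 2" by (simp add: power2_eq_square field_simps)
    finally have "a * b \<le> (M\<^sup>2 - 1) / 4 - (M - 1) / 2" .
    moreover have "X = \<mu>\<^sup>2 - a * b" using \<open>q = 0\<close> by (simp add: X_def)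
    ultimately have "X \<ge> (M - 1) / 2" using M(1) by linarith
    then show False using X \<open>q = 0\<close> M(2) kN by simp
  next
    case False
    then have q1: "q \<ge> 1" using mid_rest(2)[OF C] by (simp add: q_def Suc_leI card_gt_0_iff)
    have "a * b \<le> M\<^sup>2 / 4" using t ab q0 by (intro prod_le_sq4) (auto simp: t_def)
    then have low: "X \<ge> (15 / 100) * N * q - 1 / 4" using M(1) by (simp add: X_def)
    have "(1 + q)\<^sup>2 \<le> (2 * q)\<^sup>2" using q1 by (intro power_mono) auto
    also have "\<dots> = 4 * q * q" by (simp add: power2_eq_square)
    also have "\<dots> \<le> 4 * q * ((615 / 10000) * N)" using qt q0 by (intro mult_left_mono) auto
    finally have "X \<le> (2042 / 10000) * (4 * q * ((615 / 10000) * N))" using X by linarith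
    moreover have "(2042 / 10000) * (4 * q * ((615 / 10000) * N)) = (502332 / 10000000) * (N * q)" by simp
    moreover have "N * q \<ge> 1424 * 1" using N q1 by (intro mult_mono) auto
    moreover have "(15 / 100) * N * q = (15 / 100) * (N * q)" by simp
    ultimately show False using low by linarith
  qed
qed

text \<open>Common part of the two exceptional configurations: after removing the set \<open>P\<close> of one or two
  vertices of \<open>mid A B\<close>, a complete block \<open>D \<times> D'\<close> of non-edges remains.\<close>
lemma few_rest_gain:
  assumes C: "core A B A' B'" and M: "\<mu>\<^sup>2 \<ge> (M\<^sup>2 - 1) / 4"
    and t: "card (rest A B) \<le> 2 * k - 2"
    and P: "P \<subseteq> mid A B" "1 \<le> card P" "card P \<le> 2" and sz: "N - real (card (rest A B)) - real (card P) \<le> M"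
    and D: "D \<subseteq> ext A B - P" "D' \<subseteq> ext B A - P" "\<And>a b. a \<in> D \<Longrightarrow> b \<in> D' \<Longrightarrow> \<not> adj a b"
    and F: "\<And>w. w \<in> P \<Longrightarrow> real (card (nb w (V - rest A B))) \<le> f w" "\<And>w. w \<in> P \<Longrightarrow> 0 \<le> f w"
  defines "q \<equiv> real (card (mid A B))"
  shows "max ((15 / 100) * N * (q - real (card P))) (real (card D) * real (card D')) - 1 / 4
      \<le> (234 / 100) * (\<Sum>w\<in>P. (f w + (644 / 100000) * (1 + q))\<^sup>2) / N + (87 / 10000) * (1 + q)\<^sup>2"
proof -
  note c = coreD[OF C]
  define t where "t = real (card (rest A B))"
  define S S' where "S = ext A B - P" and "S' = ext B A - P"
  define a b where "a = real (card S)" and "b = real (card S')"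
  define s where "s = (644 / 100000) * (1 + q)"
  have N: "N \<ge> 1424" using kN by linarith
  have q0: "q \<ge> 0" "t \<ge> 0" "a \<ge> 0" "b \<ge> 0" "s \<ge> 0" by (auto simp: q_def t_def a_def b_def s_def)
  \<comment> \<open>Here \<open>t + 2 \<le> 2 * k\<close>, and 2 / 712 < 0.00281: far below the
    general bound 0.0615 N for \<open>rest\<close>, which makes the constants below small.\<close>
  have tk: "t + 2 \<le> (281 / 100000) * N" using t k2 kN by (simp add: t_def)
  have PV: "P \<subseteq> V" "finite P" "P \<inter> rest A B = {}" "P \<subseteq> ext A B \<union> ext B A"
    using P c mid_rest(2)[OF C] finite_subset by (auto simp: mid_def rest_def)
  have VS: "V - (S \<union> S') = P \<union> rest A B" using PV by (auto simp: S_def S'_def rest_def)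
  have cVS: "real (card (V - (S \<union> S'))) = real (card P) + t"
    unfolding VS t_def using PV mid_rest(3)[OF C] by (simp add: card_Un_disjoint)
  have ab: "a + b \<le> M"
  proof -
    have SS: "S \<inter> S' = {}" "finite S" "finite S'" "S \<subseteq> V" "S' \<subseteq> V" using c by (auto simp: S_def S'_def)
    have "card (V - (S \<union> S')) = card V - card (S \<union> S')" using SS by (intro card_Diff_subset) auto
    moreover have "card (S \<union> S') \<le> card V" using SS finV by (intro card_mono) auto
    moreover have "card (S \<union> S') = card S + card S'" using SS by (simp add: card_Un_disjoint)
    ultimately show ?thesis using cVS sz by (simp add: a_def b_def t_def)
  qed
  have abM: "a * b \<le> M\<^sup>2 / 4" using ab q0 by (intro prod_le_sq4) auto
  have "A \<inter> mid A B = {}" "B \<inter> mid A B = {}" using c(6,7,8,11) unfolding mid_def by blast+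
  then have "A' \<subseteq> S" "B' \<subseteq> S'" using P(1) c(2,3,7,8) unfolding S_def S'_def by blast+
  then have e1: "(\<Sum>u\<in>S. real (card (nb u S'))) \<le> a * b - (15 / 100) * N * real (card (mid A B \<inter> (S \<union> S')))"
    using edges_missing_mid[OF C] by (simp add: a_def b_def S_def S'_def)
  have "mid A B \<inter> (S \<union> S') = mid A B - P" by (auto simp: mid_def S_def S'_def)
  moreover have "real (card (mid A B - P)) = q - real (card P)"
    using card_Diff_subset[OF PV(2) P(1)] card_mono[OF mid_rest(2)[OF C] P(1)] by (simp add: q_def)
  ultimately have e1': "(\<Sum>u\<in>S. real (card (nb u S'))) \<le> a * b - (15 / 100) * N * (q - real (card P))"
    using e1 by simp
  have e2: "(\<Sum>u\<in>S. real (card (nb u S'))) \<le> a * b - real (card D) * real (card D')"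
    unfolding a_def b_def using D c by (intro edges_missing_block) (auto simp: S_def S'_def)
  \<comment> \<open>The non-edges at \<open>mid\<close> and those of the block may overlap, so only
    the larger of the two numbers is subtracted.\<close>
  define L where "L = max ((15 / 100) * N * (q - real (card P))) (real (card D) * real (card D'))"
  have e: "(\<Sum>u\<in>S. real (card (nb u S'))) \<le> a * b - L" using e1' e2 by (simp add: L_def)
  define X where "X = \<mu>\<^sup>2 - (a * b - L)"
  have small: "real (card P) + t \<le> (281 / 100000) * N" using P(3) tk by simp
  have Ss: "S \<subseteq> ext A B" "S' \<subseteq> ext B A" by (auto simp: S_def S'_def)
  have small': "real (card (V - (S \<union> S'))) \<le> (86 / 100) * N" using small N unfolding cVS by linarith
  have g: "X * ((86 / 100) * N - (real (card P) + t)) \<le> 2 * (\<Sum>w\<in>P \<union> rest A B. (\<mu> * x w)\<^sup>2)"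
    using gain[OF C Ss small' e] unfolding cVS unfolding VS X_def .
  \<comment> \<open>0.00281 / 0.437 < 0.00644: all of \<open>rest\<close> together adds at most
    \<open>s\<close> to the row sum of a vertex of \<open>P\<close>.\<close>
  have sumT: "(\<Sum>w\<in>rest A B. x w) \<le> s"
  proof -
    have "(\<Sum>w\<in>rest A B. x w) \<le> (\<Sum>w\<in>rest A B. (1 + q) / ((437 / 1000) * N))"
      using rest_entries(1)[OF C] by (intro sum_mono) (simp add: q_def)
    also have "\<dots> = t / ((437 / 1000) * N) * (1 + q)" by (simp add: t_def)
    also have "\<dots> \<le> (644 / 100000) * (1 + q)"
      using tk q0 N by (intro mult_right_mono) (auto simp: field_simps)
    finally show ?thesis by (simp add: s_def)
  qed
  have P_entry: "(\<mu> * x w)\<^sup>2 \<le> (f w + s)\<^sup>2" if w: "w \<in> P" for w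
  proof -
    have wV: "w \<in> V" using w PV by auto
    have "\<mu> * x w = (\<Sum>u\<in>nb w V. x u)" using eig[OF wV] by simp
    also have "nb w V = nb w (V - rest A B) \<union> nb w (rest A B)" by (auto simp: nb_def rest_def)
    also have "(\<Sum>u\<in>nb w (V - rest A B) \<union> nb w (rest A B). x u) = (\<Sum>u\<in>nb w (V - rest A B). x u) + (\<Sum>u\<in>nb w (rest A B). x u)"
    proof (rule sum.union_disjoint)
      show "nb w (V - rest A B) \<inter> nb w (rest A B) = {}" by (auto simp: nb_def)
    qed auto
    also have "(\<Sum>u\<in>nb w (V - rest A B). x u) \<le> (\<Sum>u\<in>nb w (V - rest A B). 1)"
      using le1 nb_subset(2) by (intro sum_mono) blast
    also have "\<dots> \<le> f w" using F(1)[OF w] by simp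
    also have "(\<Sum>u\<in>nb w (rest A B). x u) \<le> (\<Sum>u\<in>rest A B. x u)"
      using nn mid_rest(3)[OF C] nb_subset(1) by (intro sum_mono2) auto
    finally have "\<mu> * x w \<le> f w + s" using sumT by linarith
    moreover have "0 \<le> \<mu> * x w" using nn muN N by (intro mult_nonneg_nonneg) linarith+
    ultimately show ?thesis by (intro power_mono)
  qed
  define Z where "Z = (\<Sum>w\<in>P. (f w + s)\<^sup>2)"
  have split: "(\<Sum>w\<in>P \<union> rest A B. (\<mu> * x w)\<^sup>2) = (\<Sum>w\<in>P. (\<mu> * x w)\<^sup>2) + (\<Sum>w\<in>rest A B. (\<mu> * x w)\<^sup>2)"
    using PV mid_rest(3)[OF C] by (intro sum.union_disjoint) auto
  have "(\<Sum>w\<in>P. (\<mu> * x w)\<^sup>2) \<le> Z" unfolding Z_def by (intro sum_mono P_entry)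
  moreover have "(\<Sum>w\<in>rest A B. (\<mu> * x w)\<^sup>2) \<le> (131 / 100) * t * (1 + q)\<^sup>2"
    using rest_sum[OF C] by (simp add: q_def t_def)
  moreover have "(131 / 100) * t * (1 + q)\<^sup>2 \<le> (131 / 100) * ((281 / 100000) * N) * (1 + q)\<^sup>2"
    using tk by (intro mult_right_mono) auto
  ultimately have "(\<Sum>w\<in>P \<union> rest A B. (\<mu> * x w)\<^sup>2) \<le> Z + (131 / 100) * ((281 / 100000) * N) * (1 + q)\<^sup>2"
    unfolding split by (meson add_mono order_trans)
  then have g': "X * ((86 / 100) * N - (real (card P) + t)) \<le> 2 * (Z + (131 / 100) * ((281 / 100000) * N) * (1 + q)\<^sup>2)"
    using g by (meson mult_left_mono order_trans zero_le_numeral)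
  have Z0: "Z \<ge> 0" unfolding Z_def by (intro sum_nonneg) auto
  have "X \<le> (234 / 100) * Z / N + (87 / 10000) * (1 + q)\<^sup>2"
  proof (cases "X \<le> 0")
    case True
    have "0 \<le> (234 / 100) * Z / N + (87 / 10000) * (1 + q)\<^sup>2" using Z0 by simp
    then show ?thesis using True by linarith
  next
    case False
    then have "X * ((857 / 1000) * N) \<le> X * ((86 / 100) * N - (real (card P) + t))"
      using small N by (intro mult_left_mono) auto
    then have "X * ((857 / 1000) * N) \<le> 2 * (Z + (131 / 100) * ((281 / 100000) * N) * (1 + q)\<^sup>2)" using g' by linarith
    then have "X \<le> 2 * (Z + (131 / 100) * ((281 / 100000) * N) * (1 + q)\<^sup>2) / ((857 / 1000) * N)"
      using N by (subst pos_le_divide_eq) auto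
    also have "\<dots> = (2000 / 857) * (Z / N) + (2000 / 857) * (131 / 100) * (281 / 100000) * (1 + q)\<^sup>2"
      using N by (simp add: field_simps)
    also have "\<dots> \<le> (234 / 100) * (Z / N) + (87 / 10000) * (1 + q)\<^sup>2"
      using Z0 N by (intro add_mono mult_right_mono) auto
    finally show ?thesis by simp
  qed
  moreover have "X \<ge> L - 1 / 4" using abM M by (simp add: X_def)
  ultimately show ?thesis by (simp add: L_def Z_def s_def)
qed

end

section \<open>Numerical contradictions for the two exceptional configurations\<close>

lemma square_div_le:
  fixes y c N :: real
  assumes "0 \<le> y" "y \<le> c * N" "N > 0"
  shows "y\<^sup>2 / N \<le> c * y"
proof -
  have "y * y \<le> c * N * y" using assms by (intro mult_right_mono) auto
  then show ?thesis using assms by (simp add: power2_eq_square field_simps)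
qed

text \<open>The split in \<open>q\<close> reflects that it counts vertices. For
  \<open>q \<ge> 3\<close> the term 0.15 N (q - 1) beats the main term on the right, at most 2.34 *
  0.302^2 N; for \<open>q \<le> 2\<close> the right side grows with \<open>d\<close> only at rate
  2.34 * 0.301 < 1.\<close>

lemma same_side_numeric:
  fixes N q d :: real
  assumes N: "N \<ge> 1424" and q: "q \<ge> 3 \<or> q \<le> 2" "0 \<le> q" "q \<le> (615 / 10000) * N" and d: "2 \<le> d" "d \<le> (3005 / 10000) * N"
    and le: "max ((15 / 100) * N * (q - 1)) d - 1 / 4
      \<le> (234 / 100) * (d + (644 / 100000) * (1 + q))\<^sup>2 / N + (87 / 10000) * (1 + q)\<^sup>2"
  shows False
proof (cases "q \<ge> 3")
  case True
  define y where "y = d + (644 / 100000) * (1 + q)"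
  then have y_eq: "y = d + 644 / 100000 + 644 / 100000 * q" by (simp add: algebra_simps)
  have le': "max ((15 / 100) * N * (q - 1)) d - 1 / 4 \<le> (234 / 100) * (y\<^sup>2 / N) + (87 / 10000) * (1 + q)\<^sup>2"
    using le by (simp only: y_def times_divide_eq_right)
  have y: "0 \<le> y" "y \<le> (302 / 1000) * N" unfolding y_eq using q d N by linarith+
  have "y\<^sup>2 / N \<le> (302 / 1000) * y" by (rule square_div_le) (use y N in auto)
  also have "\<dots> \<le> (302 / 1000) * ((302 / 1000) * N)" using y by (intro mult_left_mono) auto
  finally have s: "y\<^sup>2 / N \<le> (91204 / 1000000) * N" by simp
  have "(1 + q)\<^sup>2 \<le> ((625 / 10000) * N) * (1 + q)"
    unfolding power2_eq_square using q N by (intro mult_right_mono) auto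
  moreover have "(15 / 100) * N * (q - 1) - 1 / 4 \<le> (234 / 100) * (y\<^sup>2 / N) + (87 / 10000) * (1 + q)\<^sup>2"
    using le' by linarith
  moreover have "(15 / 100) * N * (q - 1) = (15 / 100) * (N * q) - (15 / 100) * N"
    "((625 / 10000) * N) * (1 + q) = (625 / 10000) * N + (625 / 10000) * (N * q)"
    by (simp_all add: field_simps)
  moreover have "N * q \<ge> N * 3" using N True by (intro mult_left_mono) auto
  ultimately show False using s N by linarith
next
  case False
  then have q2: "q \<le> 2" using q by auto
  define y where "y = d + (644 / 100000) * (1 + q)"
  then have y_eq: "y = d + 644 / 100000 + 644 / 100000 * q" by (simp add: algebra_simps)
  have le': "max ((15 / 100) * N * (q - 1)) d - 1 / 4 \<le> (234 / 100) * (y\<^sup>2 / N) + (87 / 10000) * (1 + q)\<^sup>2"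
    using le by (simp only: y_def times_divide_eq_right)
  have y: "0 \<le> y" "y \<le> (301 / 1000) * N" "y \<le> d + 2 / 100" unfolding y_eq using q q2 d N by linarith+
  have "y\<^sup>2 / N \<le> (301 / 1000) * y" by (rule square_div_le) (use y N in auto)
  moreover have "(1 + q)\<^sup>2 \<le> 3\<^sup>2" using q q2 by (intro power_mono) auto
  moreover have "d \<le> max ((15 / 100) * N * (q - 1)) d" by simp
  moreover have "(3::real)\<^sup>2 = 9" by simp
  ultimately show False using le' y(3) d by linarith
qed

text \<open>For \<open>q \<ge> 4\<close> as in \<open>same_side_numeric\<close>. For
  \<open>q \<le> 3\<close> the right side is at most about half of \<open>d + d'\<close> plus a
  constant, whereas (d - 2)(d' - 2) \<ge> 0 bounds \<open>d + d'\<close> by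
  \<open>d * d' / 2 + 2\<close>.\<close>

lemma opposite_sides_numeric:
  fixes N q d d' :: real
  assumes N: "N \<ge> 1424" and q: "q \<ge> 4 \<or> q \<le> 3" "0 \<le> q" "q \<le> (615 / 10000) * N"
    and d: "2 \<le> d" "d \<le> (2115 / 10000) * N" and d': "2 \<le> d'" "d' \<le> (2115 / 10000) * N"
    and le: "max ((15 / 100) * N * (q - 2)) (d * d') - 1 / 4
      \<le> (234 / 100) * ((d' + 1 + (644 / 100000) * (1 + q))\<^sup>2 + (d + 1 + (644 / 100000) * (1 + q))\<^sup>2) / N + (87 / 10000) * (1 + q)\<^sup>2"
  shows False
proof (cases "q \<ge> 4")
  case True
  define y y' where "y = d + 1 + (644 / 100000) * (1 + q)" and "y' = d' + 1 + (644 / 100000) * (1 + q)"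
  then have y_eq: "y = d + 100644 / 100000 + 644 / 100000 * q" and y'_eq: "y' = d' + 100644 / 100000 + 644 / 100000 * q"
    by (simp_all add: field_simps)
  have le': "max ((15 / 100) * N * (q - 2)) (d * d') - 1 / 4
      \<le> (234 / 100) * (y'\<^sup>2 / N) + (234 / 100) * (y\<^sup>2 / N) + (87 / 10000) * (1 + q)\<^sup>2"
    using le by (simp only: y_def y'_def times_divide_eq_right distrib_left add_divide_distrib)
  have y: "0 \<le> y" "y \<le> (213 / 1000) * N" unfolding y_eq using q d N by linarith+
  have y': "0 \<le> y'" "y' \<le> (213 / 1000) * N" unfolding y'_eq using q d' N by linarith+
  have "y\<^sup>2 / N \<le> (213 / 1000) * y" by (rule square_div_le) (use y N in auto)
  also have "\<dots> \<le> (213 / 1000) * ((213 / 1000) * N)" using y by (intro mult_left_mono) auto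
  finally have s: "y\<^sup>2 / N \<le> (45369 / 1000000) * N" by simp
  have "y'\<^sup>2 / N \<le> (213 / 1000) * y'" by (rule square_div_le) (use y' N in auto)
  also have "\<dots> \<le> (213 / 1000) * ((213 / 1000) * N)" using y' by (intro mult_left_mono) auto
  finally have s': "y'\<^sup>2 / N \<le> (45369 / 1000000) * N" by simp
  have "(1 + q)\<^sup>2 \<le> ((625 / 10000) * N) * (1 + q)"
    unfolding power2_eq_square using q N by (intro mult_right_mono) auto
  moreover have "(15 / 100) * N * (q - 2) - 1 / 4
      \<le> (234 / 100) * (y\<^sup>2 / N) + (234 / 100) * (y'\<^sup>2 / N) + (87 / 10000) * (1 + q)\<^sup>2"
    using le' by linarith
  moreover have "(15 / 100) * N * (q - 2) = (15 / 100) * (N * q) - (30 / 100) * N"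
    "((625 / 10000) * N) * (1 + q) = (625 / 10000) * N + (625 / 10000) * (N * q)"
    by (simp_all add: field_simps)
  moreover have "N * q \<ge> N * 4" using N True by (intro mult_left_mono) auto
  ultimately show False using s s' N by linarith
next
  case False
  then have q2: "q \<le> 3" using q by auto
  define y y' where "y = d + 1 + (644 / 100000) * (1 + q)" and "y' = d' + 1 + (644 / 100000) * (1 + q)"
  then have y_eq: "y = d + 100644 / 100000 + 644 / 100000 * q" and y'_eq: "y' = d' + 100644 / 100000 + 644 / 100000 * q"
    by (simp_all add: field_simps)
  have le': "max ((15 / 100) * N * (q - 2)) (d * d') - 1 / 4
      \<le> (234 / 100) * (y'\<^sup>2 / N) + (234 / 100) * (y\<^sup>2 / N) + (87 / 10000) * (1 + q)\<^sup>2"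
    using le by (simp only: y_def y'_def times_divide_eq_right distrib_left add_divide_distrib)
  have y: "0 \<le> y" "y \<le> (2125 / 10000) * N" "y \<le> d + 103 / 100" unfolding y_eq using q q2 d N by linarith+
  have y': "0 \<le> y'" "y' \<le> (2125 / 10000) * N" "y' \<le> d' + 103 / 100" unfolding y'_eq using q q2 d' N by linarith+
  have "y\<^sup>2 / N \<le> (2125 / 10000) * y" "y'\<^sup>2 / N \<le> (2125 / 10000) * y'" by (rule square_div_le; use y y' N in simp)+
  moreover have "(1 + q)\<^sup>2 \<le> 4\<^sup>2" using q q2 by (intro power_mono) auto
  moreover have "0 \<le> (d - 2) * (d' - 2)" using d d' by (intro mult_nonneg_nonneg) auto
  then have "2 * d + 2 * d' \<le> d * d' + 4" by (simp add: algebra_simps)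
  moreover have "2 * 2 \<le> d * d'" using d d' by (intro mult_mono) auto
  moreover have "d * d' \<le> max ((15 / 100) * N * (q - 2)) (d * d')" by simp
  moreover have "(4::real)\<^sup>2 = 16" by simp
  ultimately show False using le' y(3) y'(3) by linarith
qed

context spectral_graph
begin

section \<open>Excluding ears of the wrong parity\<close>

lemma N_large: "N \<ge> 1424"
  using kN by linarith

text \<open>0.2115 = 0.15 + 0.0615: outside \<open>B'\<close>, only vertices in neither reference
  set can be such neighbours.\<close>

lemma ext_nb_bound:
  assumes C: "core A B A' B'" and c: "real (card (nb c B')) \<le> (15 / 100) * N"
  shows "real (card (nb c (ext B A))) \<le> (2115 / 10000) * N"
proof -
  note cc = coreD[OF C]
  have "card (nb c (ext B A)) \<le> card (nb c B' \<union> (V - A' - B'))"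
    using cc finV by (intro card_mono) (auto simp: nb_def)
  also have "\<dots> \<le> card (nb c B') + card (V - A' - B')" by (rule card_Un_le)
  finally have "real (card (nb c (ext B A))) \<le> real (card (nb c B')) + real (card (V - A' - B'))"
    by (simp flip: of_nat_add)
  then show ?thesis using c C unfolding core_def by linarith
qed

lemma nb_outside_rest:
  assumes "core A B A' B'" "c \<in> ext A B"
  shows "nb c (V - rest A B) = nb c (ext B A)"
proof -
  have "V - rest A B = ext A B \<union> ext B A" using mid_rest(5)[OF assms(1)] by simp
  moreover have "nb c (ext A B) = {}"
    using ext_indep[OF coreD(1)[OF assms(1)] assms(2)] by (auto simp: nb_def)
  ultimately show ?thesis by (simp add: nb_Un)
qed

text \<open>Of two vertices without common neighbours the one of smaller degree is removed, after
  which \<open>sz\<close> leaves at most \<open>M\<close> vertices. The other one misses all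
  neighbours of the first, which gives the block of non-edges.\<close>

lemma same_side_contradiction:
  assumes C: "core A B A' B'" and M: "\<mu>\<^sup>2 \<ge> (M\<^sup>2 - 1) / 4"
    and t: "card (rest A B) \<le> 2 * k - 2" and sz: "N - real (card (rest A B)) - 1 \<le> M"
    and c: "c1 \<in> ext A B" "c2 \<in> ext A B" "c1 \<noteq> c2" and no: "nb c1 (ext B A) \<inter> nb c2 (ext B A) = {}"
  shows False
proof -
  have main: False
    if c: "c1 \<in> ext A B" "c2 \<in> ext A B" "c1 \<noteq> c2" and no: "nb c1 (ext B A) \<inter> nb c2 (ext B A) = {}"
      and deg: "card (nb c2 (ext B A)) \<le> card (nb c1 (ext B A))" for c1 c2
  proof -
    note cc = coreD[OF C]
    define d1 d2 where "d1 = real (card (nb c1 (ext B A)))" and "d2 = real (card (nb c2 (ext B A)))"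
    have B'e: "B' \<subseteq> ext B A" using cc by auto
    \<comment> \<open>In \<open>A\<close>, \<open>c2\<close> would have at least 0.399 - 0.15 of
      \<open>N\<close> neighbours, and \<open>c1\<close>, confined to its non-neighbours, at most
      0.2115 N, against the order of the degrees.\<close>
    have c2: "c2 \<notin> A"
    proof
      assume c2A: "c2 \<in> A"
      then have m: "real (card (B' - nb c2 B')) \<le> (15 / 100) * N" using C cc unfolding core_def by blast
      have "nb c1 B' \<subseteq> B' - nb c2 B'" using no B'e by (auto simp: nb_def)
      then have "card (nb c1 B') \<le> card (B' - nb c2 B')" using cc by (intro card_mono) auto
      then have "d1 \<le> (2115 / 10000) * N" unfolding d1_def using m by (intro ext_nb_bound[OF C]) linarith
      moreover have "(249 / 1000) * N \<le> d2"
      proof -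
        have "card B' = card (nb c2 B') + card (B' - nb c2 B')"
          using cc(13) nb_subset(1) by (metis card_Diff_subset card_mono finite_nb le_add_diff_inverse)
        moreover have "card (nb c2 B') \<le> card (nb c2 (ext B A))" using B'e by (intro card_mono nb_mono) auto
        moreover have "real (card B') \<ge> (399 / 1000) * N" using C by (simp add: core_def)
        ultimately show ?thesis using m unfolding d2_def by linarith
      qed
      moreover have "d2 \<le> d1" using deg by (simp add: d1_def d2_def)
      ultimately show False using N_large by linarith
    qed
    define q where "q = real (card (mid A B))"
    have P: "{c2} \<subseteq> mid A B" using c c2 by (auto simp: mid_def)
    have "2 \<le> card (nb c2 B)" using ext_nb[OF cc(1) c(2)] .
    also have "\<dots> \<le> card (nb c2 (ext B A))" using cc(8) by (intro card_mono nb_mono) auto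
    finally have d2: "2 \<le> d2" by (simp add: d2_def)
    have "d1 + d2 = real (card (nb c1 (ext B A) \<union> nb c2 (ext B A)))"
      using no by (simp add: d1_def d2_def card_Un_disjoint)
    also have "\<dots> \<le> real (card (V - A'))"
      using cc finV by (intro of_nat_mono card_mono) (auto simp: nb_def)
    also have "\<dots> = N - real (card A')"
    proof -
      have "A' \<subseteq> V" using cc by auto
      then show ?thesis using card_Diff_subset[OF cc(12)] card_mono[OF finV] by (simp add: of_nat_diff)
    qed
    also have "\<dots> \<le> (601 / 1000) * N" using C by (simp add: core_def)
    finally have d2': "d2 \<le> (3005 / 10000) * N" using deg by (simp add: d1_def d2_def)
    have e: "nb c2 (ext A B) = {}" using ext_indep[OF cc(1) c(2)] by (auto simp: nb_def)
    have "max ((15 / 100) * N * (q - real (card {c2}))) (real (card {c1}) * real (card (nb c2 (ext B A)))) - 1 / 4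
      \<le> (234 / 100) * (\<Sum>w\<in>{c2}. (d2 + (644 / 100000) * (1 + q))\<^sup>2) / N + (87 / 10000) * (1 + q)\<^sup>2"
      unfolding q_def
    proof (rule few_rest_gain[OF C M t P])
      show "{c1} \<subseteq> ext A B - {c2}" using c by auto
      show "nb c2 (ext B A) \<subseteq> ext B A - {c2}" using nb_subset(1) adjD by (auto simp: nb_def)
      show "\<not> adj a b" if "a \<in> {c1}" "b \<in> nb c2 (ext B A)" for a b
        using that no by (auto simp: nb_def)
      show "real (card (nb w (V - rest A B))) \<le> d2" if "w \<in> {c2}" for w
        using that nb_outside_rest[OF C c(2)] by (simp add: d2_def)
    qed (use sz d2 in auto)
    then have le: "max ((15 / 100) * N * (q - 1)) d2 - 1 / 4
      \<le> (234 / 100) * (d2 + (644 / 100000) * (1 + q))\<^sup>2 / N + (87 / 10000) * (1 + q)\<^sup>2"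
      by (simp add: d2_def)
    have "q \<le> (615 / 10000) * N" "0 \<le> q" using mid_rest_small[OF C] by (auto simp: q_def)
    moreover have "q \<ge> 3 \<or> q \<le> 2" unfolding q_def by (cases "card (mid A B) \<ge> 3") auto
    ultimately show False using same_side_numeric[OF N_large _ _ _ d2 d2' le] by blast
  qed
  show False using main[OF c no] main[OF c(2,1) c(3)[symmetric]] no by (metis Int_commute nat_le_linear)
qed

text \<open>A vertex \<open>c1\<close> of \<open>A\<close> would share many neighbours in
  \<open>B\<close> with some neighbour \<open>a \<noteq> c1\<close> of \<open>c2\<close>; one
  different from \<open>c2\<close> gives the excluded edge.\<close>

lemma opposite_not_core:
  assumes C: "core A B A' B'" and c: "c1 \<in> ext A B" "c2 \<in> ext B A"
    and no: "\<And>a b. a \<in> nb c2 (ext A B) - {c1} \<Longrightarrow> b \<in> nb c1 (ext B A) - {c2} \<Longrightarrow> \<not> adj a b"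
  shows "c1 \<notin> A"
proof
  assume c1: "c1 \<in> A"
  note cc = coreD[OF C]
  obtain a where a: "a \<in> A" "adj c2 a" "a \<noteq> c1"
    using two_nbs[OF ext_nb[OF linked_sym[OF cc(1)] c(2)]] by metis
  have "2 * k + 4 \<le> card (nb c1 B \<inter> nb a B)" using cc(1) c1 a(1) unfolding linked_def by blast
  then have "card {c2} < card (nb c1 B \<inter> nb a B)" by simp
  from ex_not_in_smaller[OF _ this] obtain b where "b \<in> B" "adj c1 b" "adj a b" "b \<noteq> c2" by (auto simp: nb_def)
  then show False using no[of a b] a cc(7,8) by (auto simp: nb_def)
qed

lemma opposite_degree:
  assumes C: "core A B A' B'" and c: "c1 \<in> ext A B" "c2 \<in> ext B A" "c2 \<notin> B"
    and no: "\<And>a b. a \<in> nb c2 (ext A B) - {c1} \<Longrightarrow> b \<in> nb c1 (ext B A) - {c2} \<Longrightarrow> \<not> adj a b"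
  shows "2 \<le> card (nb c1 (ext B A) - {c2})" "real (card (nb c1 (ext B A) - {c2})) \<le> (2115 / 10000) * N"
proof -
  note cc = coreD[OF C]
  have "2 \<le> card (nb c1 B)" by (rule ext_nb[OF cc(1) c(1)])
  also have "\<dots> \<le> card (nb c1 (ext B A) - {c2})"
    using cc(8) c(3) by (intro card_mono) (auto simp: nb_def finV intro: finite_subset[OF _ cc(15)])
  finally show "2 \<le> card (nb c1 (ext B A) - {c2})" .
  obtain a where a: "a \<in> A" "adj c2 a" "a \<noteq> c1"
    using two_nbs[OF ext_nb[OF linked_sym[OF cc(1)] c(2)]] by metis
  have "nb c1 B' \<subseteq> B' - nb a B'"
  proof
    fix b assume b: "b \<in> nb c1 B'"
    then have "b \<in> nb c1 (ext B A) - {c2}" using c(3) cc(3,8) by (auto simp: nb_def)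
    moreover have "a \<in> nb c2 (ext A B) - {c1}" using a cc(7) by (auto simp: nb_def)
    ultimately have "\<not> adj a b" using no by blast
    then show "b \<in> B' - nb a B'" using b by (auto simp: nb_def)
  qed
  then have "card (nb c1 B') \<le> card (B' - nb a B')" using cc by (intro card_mono) auto
  moreover have "real (card (B' - nb a B')) \<le> (15 / 100) * N" using C a(1) cc(4) unfolding core_def by blast
  ultimately have "real (card (nb c1 (ext B A))) \<le> (2115 / 10000) * N"
    by (intro ext_nb_bound[OF C]) linarith
  moreover have "card (nb c1 (ext B A) - {c2}) \<le> card (nb c1 (ext B A))" by (intro card_mono) auto
  ultimately show "real (card (nb c1 (ext B A) - {c2})) \<le> (2115 / 10000) * N" by linarith
qed

text \<open>Both ends lie in \<open>mid\<close> and are removed together; the block of non-edges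
  lies between their remaining neighbourhoods. The extra 1 in \<open>f\<close> allows for an edge
  between \<open>c1\<close> and \<open>c2\<close>.\<close>

lemma opposite_sides_contradiction:
  assumes C: "core A B A' B'" and M: "\<mu>\<^sup>2 \<ge> (M\<^sup>2 - 1) / 4"
    and t: "card (rest A B) \<le> 2 * k - 2" and sz: "N - real (card (rest A B)) - 2 \<le> M"
    and c: "c1 \<in> ext A B" "c2 \<in> ext B A"
    and no: "\<And>a b. a \<in> nb c2 (ext A B) - {c1} \<Longrightarrow> b \<in> nb c1 (ext B A) - {c2} \<Longrightarrow> \<not> adj a b"
  shows False
proof -
  note cc = coreD[OF C] and cc' = coreD[OF core_sym[OF C]]
  have no': "\<not> adj a b" if "a \<in> nb c1 (ext B A) - {c2}" "b \<in> nb c2 (ext A B) - {c1}" for a b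
    using no[OF that(2,1)] by (simp add: insert_commute)
  have c1: "c1 \<notin> A" by (rule opposite_not_core[OF C c no])
  have c2: "c2 \<notin> B" by (rule opposite_not_core[OF core_sym[OF C] c(2,1) no'])
  define d d' where "d = real (card (nb c2 (ext A B) - {c1}))" and "d' = real (card (nb c1 (ext B A) - {c2}))"
  have d': "2 \<le> d'" "d' \<le> (2115 / 10000) * N"
    using opposite_degree[OF C c c2 no] by (auto simp: d'_def)
  have d: "2 \<le> d" "d \<le> (2115 / 10000) * N"
    using opposite_degree[OF core_sym[OF C] c(2,1) c1 no'] by (auto simp: d_def)
  have c12: "c1 \<noteq> c2" "c1 \<notin> ext B A" "c2 \<notin> ext A B" using c cc(11) by auto
  define q where "q = real (card (mid A B))"
  define f where "f w = (if w = c1 then d' + 1 else d + 1)" for w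
  have nb1: "real (card (nb c1 (V - rest A B))) \<le> d' + 1"
  proof -
    have "card (nb c1 (ext B A)) \<le> card (nb c1 (ext B A) - {c2}) + 1"
      by (metis One_nat_def add.commute card_Diff1_le card_Suc_Diff1 finite_nb insert_Diff1 le_add2 le_eq_less_or_eq plus_1_eq_Suc Diff_empty Diff_insert0)
    then show ?thesis unfolding nb_outside_rest[OF C c(1)] d'_def by linarith
  qed
  have nb2: "real (card (nb c2 (V - rest A B))) \<le> d + 1"
  proof -
    have "card (nb c2 (ext A B)) \<le> card (nb c2 (ext A B) - {c1}) + 1"
      by (metis One_nat_def add.commute card_Diff1_le card_Suc_Diff1 finite_nb insert_Diff1 le_add2 le_eq_less_or_eq plus_1_eq_Suc Diff_empty Diff_insert0)
    then show ?thesis unfolding rest_sym[of A B] nb_outside_rest[OF core_sym[OF C] c(2)] d_def by linarith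
  qed
  have P: "{c1, c2} \<subseteq> mid A B" using c c1 c2 by (auto simp: mid_def)
  have "max ((15 / 100) * N * (q - real (card {c1, c2})))
      (real (card (nb c2 (ext A B) - {c1})) * real (card (nb c1 (ext B A) - {c2}))) - 1 / 4
      \<le> (234 / 100) * (\<Sum>w\<in>{c1, c2}. (f w + (644 / 100000) * (1 + q))\<^sup>2) / N + (87 / 10000) * (1 + q)\<^sup>2"
    unfolding q_def
  proof (rule few_rest_gain[OF C M t P])
    show "nb c2 (ext A B) - {c1} \<subseteq> ext A B - {c1, c2}" using c12 by (auto simp: nb_def)
    show "nb c1 (ext B A) - {c2} \<subseteq> ext B A - {c1, c2}" using c12 by (auto simp: nb_def)
    show "real (card (nb w (V - rest A B))) \<le> f w" if "w \<in> {c1, c2}" for w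
      using that nb1 nb2 c12 by (auto simp: f_def)
  qed (use sz d d' no c12 in \<open>auto simp: f_def\<close>)
  then have le: "max ((15 / 100) * N * (q - 2)) (d * d') - 1 / 4
      \<le> (234 / 100) * ((d' + 1 + (644 / 100000) * (1 + q))\<^sup>2 + (d + 1 + (644 / 100000) * (1 + q))\<^sup>2) / N + (87 / 10000) * (1 + q)\<^sup>2"
    using c12 by (simp add: f_def d_def d'_def)
  have "q \<le> (615 / 10000) * N" "0 \<le> q" using mid_rest_small[OF C] by (auto simp: q_def)
  moreover have "q \<ge> 4 \<or> q \<le> 3" unfolding q_def by (cases "card (mid A B) \<ge> 4") auto
  ultimately show False using opposite_sides_numeric[OF N_large _ _ _ d d' le] by blast
qed

text \<open>The ear lies in \<open>rest\<close>, so its exceptional length \<open>2 * k - 2\<close>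
  or \<open>2 * k - 3\<close> bounds \<open>card (rest A B)\<close> from below. With
  \<open>r \<le> 2 * k\<close> the core then exceeds \<open>N - r + 1\<close> by at most one or two
  vertices respectively, as many as the two contradictions remove.\<close>

lemma few_rest_in_family:
  assumes C: "core A B A' B'" and M: "\<mu>\<^sup>2 \<ge> ((N - real r + 1)\<^sup>2 - 1) / 4"
    and t: "card (rest A B) + 2 \<le> r" and r: "r \<le> 2 * k"
  shows "in_family_G (card V) r V E"
proof -
  note cc = coreD[OF C] and C' = core_sym[OF C]
  note L = cc(1) and L' = linked_sym[OF cc(1)]
  have t': "card (rest A B) \<le> 2 * k - 2" "card (rest B A) \<le> 2 * k - 2" using t r rest_sym[of A B] by auto
  define C0 where "C0 = ext A B \<union> ext B A"
  have C0V: "C0 \<subseteq> V" using cc by (auto simp: C0_def)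
  have restC0: "V - C0 = rest A B" "V - C0 = rest B A" by (auto simp: C0_def rest_def)
  have A'ne: "A' \<noteq> {}" using C N_large unfolding core_def by auto
  interpret coloured_core V E C0 "\<lambda>v. v \<in> ext A B"
  proof
    show "C0 \<subseteq> V" by (rule C0V)
    show "C0 \<noteq> {}" using A'ne cc(2,7) by (auto simp: C0_def)
    show "(u \<in> ext A B) \<noteq> (v \<in> ext A B)" if "u \<in> C0" "v \<in> C0" "adj u v" for u v
      using that ext_indep[OF L] ext_indep[OF L'] cc(11) unfolding C0_def by blast
    fix c1 c2 e
    assume c: "c1 \<in> C0" "c2 \<in> C0" "c1 \<noteq> c2" and e: "path e" "e \<noteq> []" "set e \<subseteq> V - C0"
      and ends: "adj c1 (hd e)" "adj (last e) c2"
    have "length e = card (set e)" using e(1) by (simp add: path_def distinct_card)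
    also have "\<dots> \<le> card (rest A B)" using e(3) mid_rest(3)[OF C] unfolding restC0(1) by (intro card_mono)
    finally have le: "length e \<le> card (rest A B)" .
    then have len: "length e \<le> 2 * k - 2" using t' by simp
    have eV: "set e \<subseteq> V - ext A B - ext B A" "set e \<subseteq> V - ext B A - ext A B" using e(3) by (auto simp: C0_def)
    show "even (length e) \<longleftrightarrow> (c1 \<in> ext A B) \<noteq> (c2 \<in> ext A B)"
    proof (rule ccontr)
      assume neg: "\<not> ?thesis"
      consider "c1 \<in> ext A B" "c2 \<in> ext A B" | "c1 \<in> ext B A" "c2 \<in> ext B A"
        | "c1 \<in> ext A B" "c2 \<in> ext B A" | "c1 \<in> ext B A" "c2 \<in> ext A B"
        using c by (auto simp: C0_def)
      then show False
      proof cases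
        case 1
        then have "even (length e)" using neg by blast
        from outer_same[OF L 1 c(3) e(1,2) eV(1) ends this len]
        have l: "length e = 2 * k - 2" and no: "nb c1 (ext B A) \<inter> nb c2 (ext B A) = {}" by auto
        have "N - real (card (rest A B)) - 1 \<le> N - real r + 1" using l le r by linarith
        then show False using same_side_contradiction[OF C M t'(1) _ 1 c(3) no] by blast
      next
        case 2
        then have "even (length e)" using neg cc(11) by blast
        from outer_same[OF L' 2 c(3) e(1,2) eV(2) ends this len]
        have l: "length e = 2 * k - 2" and no: "nb c1 (ext A B) \<inter> nb c2 (ext A B) = {}" by auto
        have "N - real (card (rest B A)) - 1 \<le> N - real r + 1" using l le r rest_sym[of A B] by simp
        then show False using same_side_contradiction[OF C' M t'(2) _ 2 c(3) no] by blast
      next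
        case 3
        then have "odd (length e)" using neg cc(11) by blast
        from outer_diff[OF L 3 e(1,2) eV(1) ends this len]
        have l: "length e = 2 * k - 3"
          and no: "\<And>a b. a \<in> nb c2 (ext A B) - {c1} \<Longrightarrow> b \<in> nb c1 (ext B A) - {c2} \<Longrightarrow> \<not> adj a b" by blast+
        have "N - real (card (rest A B)) - 2 \<le> N - real r + 1" using l le r by linarith
        then show False using opposite_sides_contradiction[OF C M t'(1) _ 3 no] by blast
      next
        case 4
        then have "odd (length e)" using neg cc(11) by blast
        from outer_diff[OF L' 4 e(1,2) eV(2) ends this len]
        have l: "length e = 2 * k - 3"
          and no: "\<And>a b. a \<in> nb c2 (ext B A) - {c1} \<Longrightarrow> b \<in> nb c1 (ext A B) - {c2} \<Longrightarrow> \<not> adj a b" by blast+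
        have "N - real (card (rest B A)) - 2 \<le> N - real r + 1" using l le r rest_sym[of A B] by simp
        then show False using opposite_sides_contradiction[OF C' M t'(2) _ 4 no] by blast
      qed
    qed
  qed
  show ?thesis using in_family[OF refl, of r] t unfolding restC0(1) by simp
qed

text \<open>If \<open>rest\<close> has at least \<open>r - 1\<close> vertices,
  \<open>many_rest_contradiction\<close> with \<open>M = N - r + 1\<close> leaves only the tie.
  Entries on \<open>rest\<close> are then below 1, so \<open>v0\<close> lies in a side, and
  exchanging the sides puts it into \<open>A\<close>.\<close>

lemma family_or_exact:
  assumes M: "\<mu>\<^sup>2 \<ge> ((N - real r + 1)\<^sup>2 - 1) / 4" and r: "3 \<le> r" "r \<le> 2 * k"
  shows "in_family_G (card V) r V E \<or>
    (\<exists>A B A' B'. core A B A' B' \<and> mid A B = {} \<and> card (rest A B) = r - 1 \<and> v0 \<in> A)"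
proof (cases "card (rest A0 B0) + 2 \<le> r")
  case True
  then show ?thesis using few_rest_in_family[OF core_exists M] r by blast
next
  case False
  define M' where "M' = N - real r + 1"
  have M2: "M' \<ge> N - 2 * \<kappa>" using r(2) by (simp add: M'_def)
  have t: "N - real (card (rest A0 B0)) \<le> M'" using False by (simp add: M'_def)
  have mid: "mid A0 B0 = {}" and t2: "\<not> N - real (card (rest A0 B0)) \<le> M' - 1"
    using many_rest_contradiction[OF core_exists M[folded M'_def] M2 t] by blast+
  have t3: "card (rest A0 B0) = r - 1" using t t2 r by (simp add: M'_def)
  have "v0 \<notin> rest A0 B0"
  proof
    assume "v0 \<in> rest A0 B0"
    from rest_entries(1)[OF core_exists this] have "1 \<le> 1 / ((437 / 1000) * N)" using v0 mid by simp
    then show False using N_large by (simp add: field_simps)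
  qed
  then have "v0 \<in> A0 \<or> v0 \<in> B0" using v0(1) mid_rest(4)[OF core_exists] mid by auto
  then show ?thesis using core_exists core_sym[OF core_exists] mid t3 mid_sym[of A0 B0] rest_sym[of A0 B0] by metis
qed

end

section \<open>The main theorem\<close>

lemma (in fin_graph) perron_nb:
  assumes "V \<noteq> {}"
  shows "\<exists>x. (\<forall>v. x v \<ge> 0) \<and> (\<exists>v\<in>V. x v > 0) \<and>
    (\<forall>v\<in>V. (\<Sum>u\<in>nb v V. x u) = graph_lambda V E * x v) \<and>
    (\<forall>y. qform V (adjm E) y \<le> graph_lambda V E * sqnorm V y)"
proof -
  obtain x where x: "\<And>v. x v \<ge> 0" "\<exists>v\<in>V. x v > 0"
    "\<And>v. v \<in> V \<Longrightarrow> (\<Sum>u\<in>V. adjm E v u * x u) = graph_lambda V E * x v"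
    "\<And>y. qform V (adjm E) y \<le> graph_lambda V E * sqnorm V y"
    using graph_lambda_perron[OF finV assms] by blast
  have "(\<Sum>u\<in>nb v V. x u) = graph_lambda V E * x v" if "v \<in> V" for v
    using x(3)[OF that] sum_adjm[OF that order_refl] by simp
  then show ?thesis using x by blast
qed

lemma quarter_square_le:
  fixes m :: nat
  shows "((real m)\<^sup>2 - 1) / 4 \<le> real (m div 2) * real (m - m div 2)"
proof (cases "even m")
  case True
  then obtain j where "m = 2 * j" by blast
  then show ?thesis by (simp add: power2_eq_square)
next
  case False
  then obtain j where "m = 2 * j + 1" by (elim oddE)
  then show ?thesis by (simp add: power2_eq_square algebra_simps)
qed

lemma TK_lambda_low:
  assumes r: "3 \<le> r" "r + 1 \<le> n"
  shows "sqrt (real ((n - r + 1) div 2) * real ((n - r + 1) - (n - r + 1) div 2)) \<le> graph_lambda {0..<n} (TK_edges n r)"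
proof -
  define m where "m = n - r + 1"
  have m: "m \<le> n" "2 \<le> m" using r by (auto simp: m_def)
  interpret fin_graph "{0..<n}" "TK_edges n r" by unfold_locales (rule TK_simple[OF r])
  have ne: "{0..<n} \<noteq> {}" using r by auto
  have ray: "qform {0..<n} (adjm (TK_edges n r)) y \<le> graph_lambda {0..<n} (TK_edges n r) * sqnorm {0..<n} y" for y
    using perron_nb[OF ne] by blast
  have "sqrt (real (card {0..<m div 2}) * real (card {m div 2..<m})) \<le> graph_lambda {0..<n} (TK_edges n r)"
    using m ray by (intro complete_bipartite_low) (auto simp: TK_edges_TKadj TKadj_def m_def)
  then show ?thesis by (simp add: m_def)
qed

lemma TK_lambda_eq:
  fixes n r :: nat
  defines "\<nu> \<equiv> graph_lambda {0..<n} (TK_edges n r)" and "m \<equiv> n - r + 1"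
  assumes r: "3 \<le> r" "r + 1 \<le> n" and g: "g = real (r - 1) / (\<nu> - real (r - 1) + 1)" and big: "\<nu> > real (r - 1)" "\<nu> > g"
  shows "\<nu>\<^sup>2 = real (m - m div 2) * (real (m div 2) + g / (\<nu> - g))"
proof -
  have m: "m \<le> n" "2 \<le> m" "n - m = r - 1" using r by (auto simp: m_def)
  interpret fin_graph "{0..<n}" "TK_edges n r" by unfold_locales (rule TK_simple[OF r])
  have ne: "{0..<n} \<noteq> {}" using r by auto
  obtain x where x: "\<And>v. x v \<ge> 0" "\<exists>v\<in>{0..<n}. x v > 0"
    "\<And>v. v \<in> {0..<n} \<Longrightarrow> (\<Sum>u\<in>nb v {0..<n}. x u) = \<nu> * x v"
    using perron_nb[OF ne] unfolding \<nu>_def[symmetric] by blast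
  have c: "card {m..<n} = r - 1" using m by simp
  have "\<nu>\<^sup>2 = real (card {m div 2..<m}) * (real (card {0..<m div 2}) + g / (\<nu> - g))"
  proof (rule TK_eigen[where A = "{0..<m div 2}" and B = "{m div 2..<m}" and T = "{m..<n}" and c = 0 and x = x])
    show "{0..<n} = {0..<m div 2} \<union> {m div 2..<m} \<union> {m..<n}" using m by auto
    show "adj u v \<longleftrightarrow> TKadj {0..<m div 2} {m div 2..<m} {m..<n} 0 u v" for u v
      by (simp add: TK_edges_TKadj m_def)
    show "g = real (card {m..<n}) / (\<nu> - real (card {m..<n}) + 1)" using g c by simp
    show "\<nu> > real (card {m..<n})" using big c by simp
  qed (use x big m in auto)
  then show ?thesis by simp
qed

theorem theorem1p8:
  fixes V :: "'a set" and E :: "'a set set" and n k r :: nat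
  assumes "k \<ge> 2" and "3 \<le> r" and "r \<le> 2 * k" and "n \<ge> 712 * k"
    and "simple_graph V E" and "card V = n"
    and "\<not> contains_cycle V E (2 * k + 1)"
    and "graph_lambda V E \<ge> graph_lambda {0..<n} (TK_edges n r)"
  shows "in_family_G n r V E \<or> graph_iso V E {0..<n} (TK_edges n r)"
proof -
  define \<nu> where "\<nu> = graph_lambda {0..<n} (TK_edges n r)"
  define \<mu> where "\<mu> = graph_lambda V E"
  define m where "m = n - r + 1"
  have nr: "r + 1 \<le> n" using assms(1,3,4) by linarith
  have m: "m \<le> n" "2 \<le> m" "real m = real n - real r + 1" using nr assms(2) by (auto simp: m_def)
  have nu_mu: "\<nu> \<le> \<mu>" using assms(8) by (simp add: \<nu>_def \<mu>_def)
  have low: "sqrt (real (m div 2) * real (m - m div 2)) \<le> \<nu>"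
    using TK_lambda_low[OF assms(2) nr] by (simp add: \<nu>_def m_def)
  have nu0: "\<nu> \<ge> 0" by (rule order_trans[OF _ low]) simp
  have "real (m div 2) * real (m - m div 2) = (sqrt (real (m div 2) * real (m - m div 2)))\<^sup>2" by simp
  also have "\<dots> \<le> \<nu>\<^sup>2" using low by (intro power_mono) auto
  finally have nu_sq: "((real m)\<^sup>2 - 1) / 4 \<le> \<nu>\<^sup>2" using quarter_square_le[of m] by linarith
  have nu_low: "(real m - 1) / 2 \<le> \<nu>"
  proof (rule power2_le_imp_le[OF _ nu0])
    have "((real m - 1) / 2)\<^sup>2 \<le> ((real m)\<^sup>2 - 1) / 4" using m(2) by (simp add: power2_eq_square field_simps)
    then show "((real m - 1) / 2)\<^sup>2 \<le> \<nu>\<^sup>2" using nu_sq by linarith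
  qed
  have kn: "712 * real k \<le> real n" using assms(4) by (simp flip: of_nat_mult)
  have rk: "real r \<le> 2 * real k" using assms(3) by (simp flip: of_nat_mult)
  have nu_n: "real n / 2 - real k \<le> \<nu>"
  proof -
    have "real m - 1 \<le> 2 * \<nu>" using nu_low by simp
    then have "real n - 2 * real k \<le> 2 * \<nu>" using m(3) rk by linarith
    then show ?thesis by simp
  qed
  interpret fin_graph V E by unfold_locales (rule assms(5))
  interpret odd_cycle_free V E k by unfold_locales (use assms in auto)
  have Vne: "V \<noteq> {}" using assms(1,4,6) by auto
  obtain x' where x': "\<And>v. x' v \<ge> 0" "\<exists>v\<in>V. x' v > 0" "\<And>v. v \<in> V \<Longrightarrow> (\<Sum>u\<in>nb v V. x' u) = \<mu> * x' v"
    using perron_nb[OF Vne] unfolding \<mu>_def[symmetric] by blast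
  have "Max (x' ` V) \<in> x' ` V" using finV Vne by (intro Max_in) auto
  then obtain v0 where v0: "v0 \<in> V" "x' v0 = Max (x' ` V)" by auto
  then have max: "x' v \<le> x' v0" if "v \<in> V" for v using that finV by simp
  then have pos: "x' v0 > 0" using x'(2) by force
  define x where "x v = x' v / x' v0" for v
  have sp: "spectral_graph V E k x \<mu> v0"
  proof unfold_locales
    show "0 \<le> x v" for v using x'(1) by (simp add: x_def)
    show "x v \<le> 1" if "v \<in> V" for v using max[OF that] pos by (simp add: x_def)
    show "v0 \<in> V" "x v0 = 1" using v0 pos by (auto simp: x_def)
    show "(\<Sum>u\<in>nb v V. x u) = \<mu> * x v" if "v \<in> V" for v
      using x'(3)[OF that] by (simp add: x_def flip: sum_divide_distrib)
    show "712 * k \<le> card V" using assms by simp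
    show "real (card V) / 2 - real k \<le> \<mu>" using nu_n nu_mu assms(6) by simp
  qed
  interpret spectral_graph V E k x \<mu> v0 by (rule sp)
  have "\<nu>\<^sup>2 \<le> \<mu>\<^sup>2" using nu_mu nu0 by (intro power_mono) auto
  then have M: "((real (card V) - real r + 1)\<^sup>2 - 1) / 4 \<le> \<mu>\<^sup>2" using nu_sq m(3) assms(6) by simp
  consider "in_family_G (card V) r V E"
    | A B A' B' where "core A B A' B'" "mid A B = {}" "card (rest A B) = r - 1" "v0 \<in> A"
    using family_or_exact[OF M assms(2,3)] by blast
  then show ?thesis
  proof cases
    case 1
    then show ?thesis using assms(6) by simp
  next
    case 2
    note cc = coreD[OF 2(1)]
    define T where "T = rest A B"
    have ext_eq: "ext A B = A" "ext B A = B" using 2(2) cc(7,8) by (auto simp: mid_def)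
    have VABT: "V = A \<union> B \<union> T" using cc(4,5) ext_eq by (auto simp: T_def rest_def)
    have dis: "A \<inter> B = {}" "A \<inter> T = {}" "B \<inter> T = {}" using cc(6) ext_eq by (auto simp: T_def rest_def)
    have fin: "finite A" "finite B" "finite T" using VABT finV by auto
    have cT: "card T = r - 1" using 2(3) by (simp add: T_def)
    have "card V = card A + card B + card T"
      unfolding VABT using fin dis by (subst card_Un_disjoint) (auto simp: card_Un_disjoint)
    then have ab: "card A + card B = m" using cT assms(2,6) nr by (simp add: m_def)
    define g where "g = real (r - 1) / (\<nu> - real (r - 1) + 1)"
    define h where "h = g / (\<nu> - g)"
    \<comment> \<open>\<open>n / 2 - k \<ge> 356 k - k\<close>. Hence \<open>g\<close> is a quotient
      of at most 2k by at least 353k, and \<open>g < 1 < \<nu> - g\<close> gives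
      \<open>h < 1\<close>, as \<open>balanced_opt\<close> requires.\<close>
    have nu_k: "\<nu> \<ge> 355 * real k" using nu_n kn by linarith
    have rk': "real (r - 1) \<le> 2 * real k" "real (r - 1) > 0" "real k \<ge> 2" using rk assms(1,2) by auto
    have den: "\<nu> - real (r - 1) + 1 \<ge> 353 * real k" using nu_k rk' by linarith
    have g01: "0 < g" "g < 1" using den rk' by (auto simp: g_def field_simps)
    have big: "\<nu> > real (r - 1)" "\<nu> > g" "\<nu> - g > 1" using nu_k rk' g01 by linarith+
    have h01: "0 < h" "h < 1" using g01 big by (auto simp: h_def)
    have TK: "\<nu>\<^sup>2 = real (m - m div 2) * (real (m div 2) + h)"
      using TK_lambda_eq[OF assms(2) nr, of g] big g_def unfolding \<nu>_def[symmetric] m_def[symmetric] h_def by simp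
    have up: "real (card B) * (real (card A) + h) \<le> \<nu>\<^sup>2"
      unfolding TK by (rule balanced_opt(1)[OF ab h01])
    obtain b where "b \<in> B" "adj v0 b"
      using two_nbs[OF ext_nb[OF cc(1), of v0]] 2(4) ext_eq by metis
    have "real (card B) * (real (card A) + h) = \<nu>\<^sup>2 \<and> (\<forall>u\<in>V. \<forall>v\<in>V. adj u v \<longleftrightarrow> TKadj A B T v0 u v)"
    proof (rule exact_comparison[OF VABT dis 2(4), where x = x and \<mu> = \<mu> and g = g])
      show "\<not> adj u v" if "u \<in> A" "v \<in> A" for u v using ext_indep[OF cc(1)] that ext_eq by simp
      show "\<not> adj u v" if "u \<in> B" "v \<in> B" for u v using ext_indep[OF linked_sym[OF cc(1)]] that ext_eq by simp
      show "card (nb w (A \<union> B)) \<le> 1" if "w \<in> T" for w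
        using card_nb_rest[OF cc(1)] that by (simp add: T_def rest_def)
      show "\<exists>b\<in>B. adj v0 b" using \<open>b \<in> B\<close> \<open>adj v0 b\<close> by blast
      show "g = real (card T) / (\<nu> - real (card T) + 1)" by (simp add: g_def cT)
    qed (use nn le1 v0 pos eig nu_mu h_def big up cT in \<open>auto simp: x_def\<close>)
    then have eq: "real (card B) * (real (card A) + h) = \<nu>\<^sup>2"
      and adj_TK: "\<And>u v. u \<in> V \<Longrightarrow> v \<in> V \<Longrightarrow> adj u v \<longleftrightarrow> TKadj A B T v0 u v" by blast+
    have cB: "card B = m - m div 2" using balanced_opt(2)[OF ab h01] eq TK by simp
    then have cA: "card A = m div 2" using ab by simp
    have Un: "{0..<m div 2} \<union> {m div 2..<m} \<union> {m..<n} = {0..<n}" using m by auto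
    have "\<exists>f. bij_betw f (A \<union> B \<union> T) ({0..<m div 2} \<union> {m div 2..<m} \<union> {m..<n}) \<and>
      (\<forall>u\<in>A \<union> B \<union> T. \<forall>v\<in>A \<union> B \<union> T. TKadj A B T v0 u v \<longleftrightarrow>
        TKadj {0..<m div 2} {m div 2..<m} {m..<n} 0 (f u) (f v))"
      using fin dis 2(4) cA cB cT m nr assms(2) by (intro TKadj_iso) (auto simp: m_def)
    then obtain f where f: "bij_betw f V {0..<n}"
      "\<And>u v. u \<in> V \<Longrightarrow> v \<in> V \<Longrightarrow> TKadj A B T v0 u v \<longleftrightarrow> TKadj {0..<m div 2} {m div 2..<m} {m..<n} 0 (f u) (f v)"
      unfolding Un VABT[symmetric] by blast
    have "graph_iso V E {0..<n} (TK_edges n r)"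
      unfolding graph_iso_def TK_edges_TKadj m_def[symmetric] using f adj_TK by blast
    then show ?thesis ..
  qed
qed

end
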